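(* Let $\Sigma$ be a $d$-dimensional finite CW complex with $n$ facets, cut lattice $\mathcal{C}=\operatorname{im}_{\mathbb{Z}}\partial_d^*$ and flow lattice $\mathcal{F}=\ker_{\mathbb{Z}}\partial_d$ in $\mathbb{Z}^n$, and let $\mathbf{t}=\mathbf{t}_{d-1}(\Sigma)=|\operatorname{tor}(\tilde H_{d-1}(\Sigma;\mathbb{Z}))|$. Then $$|\mathcal{C}^\sharp/\mathcal{C}|=|K(\Sigma)|=\tau_d(\Sigma),\qquad |\mathbb{Z}^n/(\mathcal{C}\oplus\mathcal{F})|=\tau_d(\Sigma)/\mathbf{t},\qquad |\mathcal{F}^\sharp/\mathcal{F}|=|K^*(\Sigma)|=\tau_d(\Sigma)/\mathbf{t}^2.$$
   Context: $\Sigma$ is a finite CW complex with the convention that it has a unique cell of dimension $-1$ (so cellular homology is reduced); $d$-cells are facets; $\Sigma_{(i)}$ is the $i$-skeleton. Cells are oriented, $\partial_i$ are the cellular boundary maps and $\partial_i^*$ their transposes; $C_d(\Sigma;\mathbb{Z})\cong\mathbb{Z}^n$ with facets orthonormal. For a lattice $\mathcal{L}$, $\mathcal{L}^\sharp=\{v\in\mathcal{L}\otimes\mathbb{R}:\langle v,w\rangle\in\mathbb{Z}\ \forall w\in\mathcal{L}\}$. $K(\Sigma)=\operatorname{tor}(\ker\partial_{d-1}/\operatorname{im}\partial_d\partial_d^* )$ (critical group). An acyclization is a $(d+1)$-dimensional complex $\Omega$ with $\Omega_{(d)}=\Sigma$ and $\tilde H_{d+1}(\Omega;\mathbb{Z})=\tilde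 H_d(\Omega;\mathbb{Z})=0$, and $K^*(\Sigma)=C_{d+1}(\Omega;\mathbb{Z})/\operatorname{im}(\partial_{d+1}^*\partial_{d+1})$ (cocritical group; independent of $\Omega$ up to isomorphism). A cellular spanning forest (CSF) of $\Sigma$ is a subcomplex $\Upsilon$ with $\Upsilon_{(d-1)}=\Sigma_{(d-1)}$ whose facets index a basis of the column space of $\partial_d$ over $\mathbb{R}$. For a complex or pair $X$, $\mathbf{t}_i(X)=|\operatorname{tor}(\tilde H_i(X;\mathbb{Z}))|$. The complexity is $\tau_d(\Sigma)=\sum_{\Upsilon}\mathbf{t}_{d-1}(\Upsilon)^2$, summed over all CSFs $\Upsilon$ of $\Sigma$. *)

theory Defs
  imports "HOL-Homology.Homology" "HOL-Library.Function_Algebras"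
begin

section \<open>Finite CW complexes\<close>

definition disc_topology :: "nat \<Rightarrow> (nat \<Rightarrow> real) topology" where
  "disc_topology k = subtopology (Euclidean_space k) {x. (\<Sum>i<k. (x i)\<^sup>2) \<le> 1}"

definition disc_boundary :: "nat \<Rightarrow> (nat \<Rightarrow> real) set" where
  "disc_boundary k = {x \<in> topspace (disc_topology k). (\<Sum>i<k. (x i)\<^sup>2) = 1}"

record ('a, 'c) cw =
  cw_space :: "'a topology"
  cw_cells :: "'c set"
  cw_dim :: "'c \<Rightarrow> nat"
  cw_char :: "'c \<Rightarrow> (nat \<Rightarrow> real) \<Rightarrow> 'a"

definition open_cell :: "('a, 'c) cw \<Rightarrow> 'c \<Rightarrow> 'a set" where
  "open_cell X c = cw_char X c ` (topspace (disc_topology (cw_dim X c)) - disc_boundary (cw_dim X c))"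

definition skel :: "('a, 'c) cw \<Rightarrow> int \<Rightarrow> 'a set" where
  "skel X k = (\<Union>c \<in> {c \<in> cw_cells X. int (cw_dim X c) \<le> k}. open_cell X c)"

abbreviation skel_topology :: "('a, 'c) cw \<Rightarrow> int \<Rightarrow> 'a topology" where
  "skel_topology X k \<equiv> subtopology (cw_space X) (skel X k)"

text \<open>For finitely many cells in a Hausdorff space the weak topology is automatic, and an injective
  characteristic map is automatically a homeomorphism from the open disc onto the open cell.\<close>

definition finite_cw :: "('a, 'c) cw \<Rightarrow> bool" where
  "finite_cw X \<longleftrightarrow>
     finite (cw_cells X) \<and> Hausdorff_space (cw_space X) \<and>
     topspace (cw_space X) = (\<Union>c \<in> cw_cells X. open_cell X c) \<and>
     disjoint_family_on (open_cell X) (cw_cells X) \<and>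
     (\<forall>c \<in> cw_cells X.
        continuous_map (disc_topology (cw_dim X c)) (cw_space X) (cw_char X c) \<and>
        inj_on (cw_char X c) (topspace (disc_topology (cw_dim X c)) - disc_boundary (cw_dim X c)) \<and>
        cw_char X c ` disc_boundary (cw_dim X c) \<subseteq> skel X (int (cw_dim X c) - 1))"

definition cw_has_dim :: "('a, 'c) cw \<Rightarrow> nat \<Rightarrow> bool" where
  "cw_has_dim X d \<longleftrightarrow> (\<forall>c \<in> cw_cells X. cw_dim X c \<le> d) \<and> (\<exists>c \<in> cw_cells X. cw_dim X c = d)"

text \<open>The cells of each dimension, including the conventional unique cell \<open>None\<close> of dimension \<open>-1\<close>.\<close>

definition graded_cells :: "('a, 'c) cw \<Rightarrow> int \<Rightarrow> 'c option set" where
  "graded_cells X i =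
     (if i = - 1 then {None} else Some ` {c \<in> cw_cells X. int (cw_dim X c) = i})"


section \<open>The cellular boundary map\<close>

text \<open>A fixed generator of the infinite cyclic group \<open>H\<^sub>k(D\<^sup>k, S\<^sup>k\<^sup>-\<^sup>1)\<close>. The orientation of a cell is the one its
  characteristic map induces from this generator; precomposing with a reflection reverses it.\<close>

definition disc_class :: "nat \<Rightarrow> (nat \<Rightarrow> real) chain set" where
  "disc_class k =
     (let G = relative_homology_group (int k) (disc_topology k) (disc_boundary k)
      in SOME g. g \<in> carrier G \<and> carrier (subgroup_generated G {g}) = carrier G)"

definition cell_class :: "('a, 'c) cw \<Rightarrow> 'c \<Rightarrow> 'a chain set" where
  "cell_class X c =
     (let k = cw_dim X c
      in hom_induced (int k) (disc_topology k) (disc_boundary k)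
           (skel_topology X (int k)) (skel X (int k - 1)) (cw_char X c) (disc_class k))"

text \<open>The composite \<open>H\<^sub>k(X\<^sub>k, X\<^sub>k\<^sub>-\<^sub>1) \<rightarrow> H\<^sub>k\<^sub>-\<^sub>1(X\<^sub>k\<^sub>-\<^sub>1) \<rightarrow> H\<^sub>k\<^sub>-\<^sub>1(X\<^sub>k\<^sub>-\<^sub>1, X\<^sub>k\<^sub>-\<^sub>2)\<close>.\<close>

definition cellular_boundary :: "('a, 'c) cw \<Rightarrow> int \<Rightarrow> 'a chain set \<Rightarrow> 'a chain set" where
  "cellular_boundary X k z =
     hom_induced (k - 1) (subtopology (skel_topology X k) (skel X (k - 1))) {}
       (skel_topology X (k - 1)) (skel X (k - 2)) id
       (hom_boundary k (skel_topology X k) (skel X (k - 1)) z)"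

text \<open>\<open>B\<close> is the matrix of the cellular boundary maps in the bases of oriented cells, with
  \<open>B c f\<close> the coefficient of \<open>f\<close> in the boundary of \<open>c\<close>. In dimension 0 it is the augmentation.
  Homology groups are written multiplicatively, so the sum of the \<open>B c f \<cdot> [f]\<close> is a product of powers.
  Only the entries with \<open>dim f = dim c - 1\<close> are relevant.\<close>

definition cellular_matrix :: "('a, 'c) cw \<Rightarrow> ('c option \<Rightarrow> 'c option \<Rightarrow> int) \<Rightarrow> bool" where
  "cellular_matrix X B \<longleftrightarrow>
     (\<forall>v \<in> cw_cells X. cw_dim X v = 0 \<longrightarrow> B (Some v) None = 1) \<and>
     (\<forall>c \<in> cw_cells X. cw_dim X c \<ge> 1 \<longrightarrow>
        (let k = int (cw_dim X c);
             H = relative_homology_group (k - 1) (skel_topology X (k - 1)) (skel X (k - 2))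
         in cellular_boundary X k (cell_class X c) =
              finprod H (\<lambda>f. cell_class X f [^]\<^bsub>H\<^esub> B (Some c) (Some f))
                {f \<in> cw_cells X. int (cw_dim X f) = k - 1}))"


section \<open>Cellular chains and homology\<close>

text \<open>Below, \<open>E i\<close> is the set of cells of dimension \<open>i\<close> and \<open>B\<close> a boundary matrix; an integral chain is an
  integer function supported on \<open>E i\<close>.\<close>

definition additive_group :: "'g::ab_group_add set \<Rightarrow> 'g monoid" where
  "additive_group A = \<lparr>carrier = A, monoid.mult = (+), one = 0\<rparr>"

definition cell_chains :: "(int \<Rightarrow> 'b set) \<Rightarrow> int \<Rightarrow> ('b \<Rightarrow> int) set" where
  "cell_chains E i = {x. \<forall>c. c \<notin> E i \<longrightarrow> x c = 0}"

definition boundary ::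
  "(int \<Rightarrow> 'b set) \<Rightarrow> ('b \<Rightarrow> 'b \<Rightarrow> int) \<Rightarrow> int \<Rightarrow> ('b \<Rightarrow> int) \<Rightarrow> 'b \<Rightarrow> int" where
  "boundary E B i x = (\<lambda>f. if f \<in> E (i - 1) then \<Sum>c \<in> E i. B c f * x c else 0)"

text \<open>The transpose of \<open>boundary E B i\<close>.\<close>

definition coboundary ::
  "(int \<Rightarrow> 'b set) \<Rightarrow> ('b \<Rightarrow> 'b \<Rightarrow> int) \<Rightarrow> int \<Rightarrow> ('b \<Rightarrow> int) \<Rightarrow> 'b \<Rightarrow> int" where
  "coboundary E B i y = (\<lambda>c. if c \<in> E i then \<Sum>f \<in> E (i - 1). B c f * y f else 0)"

definition cycles :: "(int \<Rightarrow> 'b set) \<Rightarrow> ('b \<Rightarrow> 'b \<Rightarrow> int) \<Rightarrow> int \<Rightarrow> ('b \<Rightarrow> int) set" where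
  "cycles E B i = {x \<in> cell_chains E i. boundary E B i x = 0}"

definition cellular_homology ::
  "(int \<Rightarrow> 'b set) \<Rightarrow> ('b \<Rightarrow> 'b \<Rightarrow> int) \<Rightarrow> int \<Rightarrow> ('b \<Rightarrow> int) set monoid" where
  "cellular_homology E B i =
     additive_group (cycles E B i) Mod (boundary E B (i + 1) ` cell_chains E (i + 1))"

definition torsion_part :: "'g monoid \<Rightarrow> 'g monoid" where
  "torsion_part G = G\<lparr>carrier := {x \<in> carrier G. \<exists>n::nat. 0 < n \<and> x [^]\<^bsub>G\<^esub> n = \<one>\<^bsub>G\<^esub>}\<rparr>"

definition torsion_number :: "(int \<Rightarrow> 'b set) \<Rightarrow> ('b \<Rightarrow> 'b \<Rightarrow> int) \<Rightarrow> int \<Rightarrow> nat" where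
  "torsion_number E B i = order (torsion_part (cellular_homology E B i))"


section \<open>Cellular spanning forests and complexity\<close>

definition fun_scale :: "real \<Rightarrow> ('b \<Rightarrow> real) \<Rightarrow> 'b \<Rightarrow> real" where
  "fun_scale r v = (\<lambda>c. r * v c)"

definition boundary_column ::
  "(int \<Rightarrow> 'b set) \<Rightarrow> ('b \<Rightarrow> 'b \<Rightarrow> int) \<Rightarrow> int \<Rightarrow> 'b \<Rightarrow> 'b \<Rightarrow> real" where
  "boundary_column E B i c = (\<lambda>f. if f \<in> E (i - 1) then real_of_int (B c f) else 0)"

text \<open>A subcomplex with full \<open>(d-1)\<close>-skeleton is given by its set \<open>U\<close> of facets; its cells are
  \<open>E(d := U)\<close> and its boundary matrix is a restriction of \<open>B\<close>.\<close>

definition spanning_forest ::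
  "(int \<Rightarrow> 'b set) \<Rightarrow> ('b \<Rightarrow> 'b \<Rightarrow> int) \<Rightarrow> int \<Rightarrow> 'b set \<Rightarrow> bool" where
  "spanning_forest E B d U \<longleftrightarrow>
     U \<subseteq> E d \<and> inj_on (boundary_column E B d) U \<and>
     \<not> module.dependent fun_scale (boundary_column E B d ` U) \<and>
     module.span fun_scale (boundary_column E B d ` U) =
       module.span fun_scale (boundary_column E B d ` E d)"

definition complexity :: "(int \<Rightarrow> 'b set) \<Rightarrow> ('b \<Rightarrow> 'b \<Rightarrow> int) \<Rightarrow> int \<Rightarrow> nat" where
  "complexity E B d =
     (\<Sum>U \<in> {U. spanning_forest E B d U}. (torsion_number (E(d := U)) B (d - 1))\<^sup>2)"


section \<open>Lattices, critical and cocritical groups\<close>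

definition cut_lattice :: "(int \<Rightarrow> 'b set) \<Rightarrow> ('b \<Rightarrow> 'b \<Rightarrow> int) \<Rightarrow> int \<Rightarrow> ('b \<Rightarrow> int) set" where
  "cut_lattice E B d = coboundary E B d ` cell_chains E (d - 1)"

definition flow_lattice :: "(int \<Rightarrow> 'b set) \<Rightarrow> ('b \<Rightarrow> 'b \<Rightarrow> int) \<Rightarrow> int \<Rightarrow> ('b \<Rightarrow> int) set" where
  "flow_lattice E B d = cycles E B d"

definition real_vectors :: "('b \<Rightarrow> int) set \<Rightarrow> ('b \<Rightarrow> real) set" where
  "real_vectors L = (\<lambda>v c. real_of_int (v c)) ` L"

definition dual_lattice :: "'b set \<Rightarrow> ('b \<Rightarrow> int) set \<Rightarrow> ('b \<Rightarrow> real) set" where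
  "dual_lattice S L =
     {v \<in> module.span fun_scale (real_vectors L).
        \<forall>w \<in> real_vectors L. (\<Sum>c \<in> S. v c * w c) \<in> \<int>}"

definition discriminant_group :: "'b set \<Rightarrow> ('b \<Rightarrow> int) set \<Rightarrow> ('b \<Rightarrow> real) set monoid" where
  "discriminant_group S L = additive_group (dual_lattice S L) Mod real_vectors L"

definition critical_group ::
  "(int \<Rightarrow> 'b set) \<Rightarrow> ('b \<Rightarrow> 'b \<Rightarrow> int) \<Rightarrow> int \<Rightarrow> ('b \<Rightarrow> int) set monoid" where
  "critical_group E B d =
     torsion_part (additive_group (cycles E B (d - 1)) Mod
       ((\<lambda>y. boundary E B d (coboundary E B d y)) ` cell_chains E (d - 1)))"

text \<open>The arguments \<open>E\<close> and \<open>A\<close> here belong to an acyclization of the \<open>d\<close>-dimensional complex.\<close>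

definition cocritical_group ::
  "(int \<Rightarrow> 'b set) \<Rightarrow> ('b \<Rightarrow> 'b \<Rightarrow> int) \<Rightarrow> int \<Rightarrow> ('b \<Rightarrow> int) set monoid" where
  "cocritical_group E A d =
     additive_group (cell_chains E (d + 1)) Mod
       ((\<lambda>x. coboundary E A (d + 1) (boundary E A (d + 1) x)) ` cell_chains E (d + 1))"


section \<open>Acyclizations\<close>

text \<open>\<open>X\<close> is identified with the \<open>d\<close>-skeleton of \<open>Y\<close>, compatibly with all characteristic maps.\<close>

definition is_skeleton :: "nat \<Rightarrow> ('a, 'c) cw \<Rightarrow> ('b, 'e) cw \<Rightarrow> bool" where
  "is_skeleton d X Y \<longleftrightarrow>
     (\<exists>h j. homeomorphic_map (cw_space X) (skel_topology Y (int d)) h \<and>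
        bij_betw j (cw_cells X) {c \<in> cw_cells Y. cw_dim Y c \<le> d} \<and>
        (\<forall>c \<in> cw_cells X. cw_dim Y (j c) = cw_dim X c \<and>
           (\<forall>x \<in> topspace (disc_topology (cw_dim X c)). cw_char Y (j c) x = h (cw_char X c x))))"

text \<open>An acyclization may have no \<open>(d+1)\<close>-cells: this is forced when \<open>\<partial>\<^sub>d\<close> is injective.\<close>

definition acyclization ::
  "nat \<Rightarrow> ('a, 'c) cw \<Rightarrow> ('b, 'e) cw \<Rightarrow> ('e option \<Rightarrow> 'e option \<Rightarrow> int) \<Rightarrow> bool" where
  "acyclization d X Y A \<longleftrightarrow>
     finite_cw Y \<and> (\<forall>c \<in> cw_cells Y. cw_dim Y c \<le> d + 1) \<and> cellular_matrix Y A \<and>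
     is_skeleton d X Y \<and>
     trivial_group (cellular_homology (graded_cells Y) A (int d + 1)) \<and>
     trivial_group (cellular_homology (graded_cells Y) A (int d))"

text \<open>The same notion for cellular chain complexes: \<open>(E', A)\<close> extends \<open>(E, B)\<close> by new cells of dimension \<open>d + 1\<close>
  whose boundaries form an integral basis of the kernel of \<open>\<partial>\<^sub>d\<close>. Such an extension always
  exists, whereas an actual CW complex may fail to: a 3-cell attached to a torus has zero boundary.\<close>

definition chain_acyclization ::
  "int \<Rightarrow> (int \<Rightarrow> 'b set) \<Rightarrow> ('b \<Rightarrow> 'b \<Rightarrow> int) \<Rightarrow> (int \<Rightarrow> 't set) \<Rightarrow> ('t \<Rightarrow> 't \<Rightarrow> int) \<Rightarrow> bool" where
  "chain_acyclization d E B E' A \<longleftrightarrow>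
     (\<exists>j. \<forall>i \<le> d. bij_betw j (E i) (E' i) \<and> (\<forall>c \<in> E i. \<forall>f \<in> E (i - 1). A (j c) (j f) = B c f)) \<and>
     finite (E' (d + 1)) \<and> (\<forall>i > d + 1. E' i = {}) \<and>
     (\<forall>x \<in> cell_chains E' (d + 1). boundary E' A d (boundary E' A (d + 1) x) = 0) \<and>
     trivial_group (cellular_homology E' A (d + 1)) \<and>
     trivial_group (cellular_homology E' A d)"

end

theory Submission
  imports Defs "Jordan_Normal_Form.Determinant"
begin

text \<open>Write \<open>M\<close> for the matrix of \<open>\<partial>\<^sub>d\<close>. Saturated sublattices of \<open>\<int>\<^sup>n\<close> have bases with integral dual systems,
  so bases \<open>P\<close>, \<open>Q\<close> of the saturations of the column and row lattices give \<open>M = P t Q\<^sup>T\<close> with \<open>t\<close> square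
  and nonsingular. With \<open>G = Q\<^sup>T Q\<close>, each quotient is the cokernel of a square integer matrix, whose order
  is the absolute value of its determinant: \<open>\<bar>det t\<bar>\<close> for the torsion of homology,
  \<open>det (t G t\<^sup>T)\<close> for the critical group and \<open>\<C>\<^sup>\<sharp>/\<C>\<close>, \<open>\<bar>det (G t\<^sup>T)\<bar>\<close> for \<open>\<int>\<^sup>n/(\<C> \<oplus> \<F>)\<close>,
  and \<open>det G\<close> for the cocritical group and \<open>\<F>\<^sup>\<sharp>/\<F>\<close>. The spanning forests are the sets \<open>U\<close> of facets with
  \<open>det Q\<^sub>U \<noteq> 0\<close>, their torsion is \<open>\<bar>det t det Q\<^sub>U\<bar>\<close>, and the Cauchy--Binet formula for \<open>det G\<close> sums these up.

  Topology enters through \<open>\<partial>\<^sub>d\<^sub>-\<^sub>1 \<partial>\<^sub>d = 0\<close> and through the uniqueness of the boundary matrix, which makes it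
  agree with that of an acyclization. Both need that the cell classes are independent in
  \<open>H\<^sub>k(X\<^sub>k, X\<^sub>k\<^sub>-\<^sub>1)\<close>: the map to the local homology at the centre of a \<open>k\<close>-cell kills the other cells, and by
  excision it sends the class of that cell to an element of infinite order.\<close>

text \<open>Cuts and flows are linked by measuring one index twice, that of the saturated cut
  lattice plus \<open>F\<close> in \<open>int_vectors T\<close>. The coordinates \<open>Qt\<close>,
  whose kernel there is \<open>F\<close>, give \<open>det G\<close>. Pairing with an integral basis
  of \<open>F\<close> kills exactly the saturated cuts and gives the Gram determinant of that basis.
  The boundaries of the new cells of an acyclization are such a basis, so every acyclization gives
  the same order. Apart from dual lattices and the definition of forests the linear algebra stays
  integral: adjugates stand in for inverses, and integral dual vectors let coordinates be read off
  by pairing. A quotient with infinite carrier has \<open>order\<close> 0, so nonvanishing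
  determinants certify that the equalities compare finite groups. On the topological side only the
  infinite order of local images is tracked. It passes through injective maps and already determines
  exponents, so the relative homology of consecutive skeleta is never computed.\<close>

hide_const (open) Polynomial.order

subsection \<open>Quotients of additive groups\<close>

text \<open>A predicate on sets, with the group fixed by the type: lattices and their quotients can
  be compared without carrying monoid records along.\<close>

definition add_subgroup :: "'g::ab_group_add set \<Rightarrow> bool" where
  "add_subgroup A \<longleftrightarrow> 0 \<in> A \<and> (\<forall>x\<in>A. \<forall>y\<in>A. x - y \<in> A)"

lemma add_subgroupD:
  assumes "add_subgroup A"
  shows "0 \<in> A" "x \<in> A \<Longrightarrow> y \<in> A \<Longrightarrow> x - y \<in> A" "x \<in> A \<Longrightarrow> - x \<in> A"
    "x \<in> A \<Longrightarrow> y \<in> A \<Longrightarrow> x + y \<in> A"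
proof -
  show z: "0 \<in> A" and d: "x \<in> A \<Longrightarrow> y \<in> A \<Longrightarrow> x - y \<in> A" for x y
    using assms by (auto simp: add_subgroup_def)
  show m: "x \<in> A \<Longrightarrow> - x \<in> A" for x
    using d[OF z, of x] by simp
  show "x \<in> A \<Longrightarrow> y \<in> A \<Longrightarrow> x + y \<in> A"
    using d[of x "- y"] m[of y] by simp
qed

text \<open>An infinite quotient gets the value 0, because \<open>order\<close> is a cardinality;
  the nonzero determinants below exclude that case.\<close>

definition lattice_index :: "'g::ab_group_add set \<Rightarrow> 'g set \<Rightarrow> nat" where
  "lattice_index A H = order (additive_group A Mod H)"

lemma carrier_additive_Mod:
  "carrier (additive_group A Mod H) = (\<lambda>a. (\<lambda>h. h + a) ` H) ` A"
  by (auto simp: FactGroup_def RCOSETS_def r_coset_def additive_group_def)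

lemma coset_eq_iff:
  assumes "add_subgroup H"
  shows "(\<lambda>h. h + a) ` H = (\<lambda>h. h + b) ` H \<longleftrightarrow> a - b \<in> H"
proof
  note H = add_subgroupD[OF assms]
  assume "(\<lambda>h. h + a) ` H = (\<lambda>h. h + b) ` H"
  then have "0 + a \<in> (\<lambda>h. h + b) ` H" using H(1) by blast
  then show "a - b \<in> H" by auto
next
  note H = add_subgroupD[OF assms]
  assume ab: "a - b \<in> H"
  have *: "(\<lambda>h. h + a) ` H \<subseteq> (\<lambda>h. h + b) ` H" if "a - b \<in> H" for a b
  proof
    fix x assume "x \<in> (\<lambda>h. h + a) ` H"
    then obtain h where h: "h \<in> H" "x = h + a" by blast
    then have "h + (a - b) \<in> H" "x = (h + (a - b)) + b" using H that by auto
    then show "x \<in> (\<lambda>h. h + b) ` H" by blast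
  qed
  show "(\<lambda>h. h + a) ` H = (\<lambda>h. h + b) ` H"
    using *[OF ab] *[of b a] H(3)[OF ab] by auto
qed

text \<open>Functions with the same fibres have images in bijection: send \<open>f x\<close> to
  \<open>g x\<close>. The value does not depend on which \<open>x\<close> is chosen by
  \<open>SOME\<close>.\<close>

lemma card_image_eq_classifiers:
  assumes "\<And>x y. x \<in> A \<Longrightarrow> y \<in> A \<Longrightarrow> f x = f y \<longleftrightarrow> g x = g y"
  shows "card (f ` A) = card (g ` A)"
proof (rule bij_betw_same_card)
  show "bij_betw (\<lambda>u. g (SOME x. x \<in> A \<and> f x = u)) (f ` A) (g ` A)"
  proof (rule bij_betw_imageI)
    have s: "(SOME x. x \<in> A \<and> f x = u) \<in> A \<and> f (SOME x. x \<in> A \<and> f x = u) = u" if "u \<in> f ` A" for u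
      by (rule someI_ex) (use that in auto)
    show "inj_on (\<lambda>u. g (SOME x. x \<in> A \<and> f x = u)) (f ` A)"
    proof (rule inj_onI)
      fix u v assume uv: "u \<in> f ` A" "v \<in> f ` A"
        and g: "g (SOME x. x \<in> A \<and> f x = u) = g (SOME x. x \<in> A \<and> f x = v)"
      note su = s[OF uv(1)] and sv = s[OF uv(2)]
      have "f (SOME x. x \<in> A \<and> f x = u) = f (SOME x. x \<in> A \<and> f x = v)"
        by (rule assms[THEN iffD2]) (use su sv g in auto)
      then show "u = v" using su sv by simp
    qed
    have k: "g (SOME x. x \<in> A \<and> f x = f a) = g a" if "a \<in> A" for a
      using s[of "f a"] that by (intro assms[THEN iffD1]) auto
    show "(\<lambda>u. g (SOME x. x \<in> A \<and> f x = u)) ` f ` A = g ` A"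
      unfolding image_image using k by (rule image_cong[OF refl])
  qed
qed

text \<open>Replaces counting cosets by counting the values of a complete invariant.\<close>

lemma lattice_index_classifier:
  assumes "add_subgroup H"
    and "\<And>x y. x \<in> A \<Longrightarrow> y \<in> A \<Longrightarrow> f x = f y \<longleftrightarrow> x - y \<in> H"
  shows "lattice_index A H = card (f ` A)"
  unfolding lattice_index_def Coset.order_def carrier_additive_Mod
  by (rule card_image_eq_classifiers) (simp add: assms coset_eq_iff)

text \<open>The isomorphism theorem for indices: the kernel of \<open>h\<close> lies in
  \<open>H\<close>, so \<open>h\<close> induces a bijection between the quotients. Later
  \<open>h\<close> is a coordinate map or the pairing with a basis.\<close>

lemma lattice_index_transfer:
  fixes h :: "'g::ab_group_add \<Rightarrow> 'h::ab_group_add"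
  assumes A: "add_subgroup A" and H: "add_subgroup H" "H \<subseteq> A"
    and h: "\<And>x y. x \<in> A \<Longrightarrow> y \<in> A \<Longrightarrow> h (x - y) = h x - h y"
    and ker: "\<And>x. x \<in> A \<Longrightarrow> h x = 0 \<Longrightarrow> x \<in> H"
    and im: "h ` A = A'" "h ` H = H'"
  shows "lattice_index A H = lattice_index A' H'"
proof -
  have h0: "h 0 = 0" using h[of 0 0] add_subgroupD(1)[OF A] by simp
  have H': "add_subgroup H'"
    unfolding add_subgroup_def
  proof (intro conjI ballI)
    show "0 \<in> H'" unfolding im(2)[symmetric] using h0 add_subgroupD(1)[OF H(1)] by force
    fix x y assume "x \<in> H'" "y \<in> H'"
    then obtain u v where "u \<in> H" "v \<in> H" "x = h u" "y = h v" using im by auto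
    then have "u \<in> A" "v \<in> A" "u - v \<in> H" using H(2) add_subgroupD(2)[OF H(1)] by auto
    then have "x - y = h (u - v)" "u - v \<in> H" using h[of u v] \<open>x = h u\<close> \<open>y = h v\<close> by simp_all
    then show "x - y \<in> H'" unfolding im(2)[symmetric] by simp
  qed
  have "lattice_index A' H' = card ((\<lambda>a. (\<lambda>h. h + a) ` H') ` A')"
    by (rule lattice_index_classifier) (simp_all add: H' coset_eq_iff)
  also have "\<dots> = card ((\<lambda>x. (\<lambda>k. k + h x) ` H') ` A)"
    using im(1) by (simp add: image_image flip: im(1))
  also have "\<dots> = lattice_index A H"
  proof (rule lattice_index_classifier[symmetric, OF H(1)])
    fix x y assume xy: "x \<in> A" "y \<in> A"
    have "x - y \<in> H" if "h x - h y \<in> H'"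
    proof -
      from that[folded im(2)] obtain u where u: "u \<in> H" "h (x - y) = h u" using h[OF xy] by auto
      then have "h ((x - y) - u) = 0" "(x - y) - u \<in> A"
        using h[of "x - y" u] add_subgroupD(2)[OF A] xy H by auto
      then have "(x - y) - u \<in> H" using ker by blast
      then have "((x - y) - u) + u \<in> H" using u add_subgroupD(4)[OF H(1)] by blast
      then show ?thesis by simp
    qed
    moreover have "h x - h y \<in> H'" if "x - y \<in> H"
      using imageI[OF that, of h] h[OF xy] im(2) by simp
    ultimately show "(\<lambda>k. k + h x) ` H' = (\<lambda>k. k + h y) ` H' \<longleftrightarrow> x - y \<in> H"
      by (auto simp: coset_eq_iff[OF H'])
  qed
  finally show ?thesis by simp
qed

lemma add_subgroup_image:
  assumes "add_subgroup A" "\<And>x y. x \<in> A \<Longrightarrow> y \<in> A \<Longrightarrow> h (x - y) = h x - h y"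
  shows "add_subgroup (h ` A)"
  unfolding add_subgroup_def
proof (intro conjI ballI)
  note A = add_subgroupD[OF assms(1)]
  have "h 0 = 0" using assms(2)[of 0 0] A(1) by simp
  then show "0 \<in> h ` A" using A(1) by force
  fix x y assume "x \<in> h ` A" "y \<in> h ` A"
  then obtain u v where "u \<in> A" "v \<in> A" "x = h u" "y = h v" by auto
  then have "x - y = h (u - v)" "u - v \<in> A" using assms(2)[of u v] A(2)[of u v] by simp_all
  then show "x - y \<in> h ` A" by simp
qed

lemma comm_group_additive_group:
  assumes "add_subgroup A"
  shows "comm_group (additive_group A)"
proof (rule comm_groupI)
  note A = add_subgroupD[OF assms]
  fix x assume "x \<in> carrier (additive_group A)"
  then show "\<exists>y\<in>carrier (additive_group A). y \<otimes>\<^bsub>additive_group A\<^esub> x = \<one>\<^bsub>additive_group A\<^esub>"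
    using A by (intro bexI[of _ "- x"]) (auto simp: additive_group_def)
qed (use add_subgroupD[OF assms] in \<open>auto simp: additive_group_def algebra_simps\<close>)

lemma normal_additive_group:
  assumes "add_subgroup A" "add_subgroup H" "H \<subseteq> A"
  shows "H \<lhd> additive_group A"
proof -
  interpret comm_group "additive_group A" by (rule comm_group_additive_group[OF assms(1)])
  have inv: "inv\<^bsub>additive_group A\<^esub> x = - x" if "x \<in> A" for x
    by (rule inv_equality) (use that add_subgroupD[OF assms(1)] in \<open>auto simp: additive_group_def\<close>)
  have "subgroup H (additive_group A)"
    by (rule subgroupI)
      (use assms add_subgroupD[OF assms(2)] inv in \<open>auto simp: additive_group_def\<close>)
  then show ?thesis by (simp add: normal_iff_subgroup)
qed

lemma trivial_additive_Mod:
  assumes "add_subgroup A" "add_subgroup H"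
    and "trivial_group (additive_group A Mod H)"
  shows "A \<subseteq> H"
proof
  fix x assume x: "x \<in> A"
  define q where "q a = (\<lambda>h. h + a) ` H" for a
  have "carrier (additive_group A Mod H) = {\<one>\<^bsub>additive_group A Mod H\<^esub>}"
    using assms(3) unfolding trivial_group_def by (rule conjunct2)
  then have im: "q ` A = {\<one>\<^bsub>additive_group A Mod H\<^esub>}"
    unfolding carrier_additive_Mod q_def .
  have "q a = \<one>\<^bsub>additive_group A Mod H\<^esub>" if "a \<in> A" for a
    using imageI[OF that, of q] unfolding im by (rule singletonD)
  then have "q x = q 0" using x add_subgroupD(1)[OF assms(1)] by simp
  then have "(\<lambda>h. h + x) ` H = (\<lambda>h. h + 0) ` H" by (simp only: q_def)
  then show "x \<in> H" unfolding coset_eq_iff[OF assms(2)] by simp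
qed

text \<open>A coset is torsion exactly when a positive multiple of its representative lies in
  \<open>H\<close>. Torsion subgroups thereby become quotients of lattices.\<close>

lemma order_torsion_part:
  fixes A H :: "('b \<Rightarrow> int) set"
  assumes A: "add_subgroup A" and H: "add_subgroup H" "H \<subseteq> A"
  shows "order (torsion_part (additive_group A Mod H)) =
    lattice_index {x \<in> A. \<exists>n::nat. 0 < n \<and> (\<lambda>c. int n * x c) \<in> H} H"
proof -
  let ?G = "additive_group A"
  let ?M = "additive_group A Mod H"
  interpret N: normal H ?G by (rule normal_additive_group[OF assms])
  have G: "Group.group ?G" by (rule comm_group.axioms(2)[OF comm_group_additive_group[OF A]])
  have M: "Group.group ?M" by (rule N.factorgroup_is_group)
  have pow: "x [^]\<^bsub>?G\<^esub> n = (\<lambda>c. int n * x c)" for x and n :: nat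
    by (induction n) (auto simp: additive_group_def fun_eq_iff algebra_simps)
  have rc: "H #>\<^bsub>?G\<^esub> a = (\<lambda>h. h + a) ` H" for a
    by (auto simp: r_coset_def additive_group_def)
  \<comment> \<open>The projection to the quotient is a homomorphism, so powers of a coset are
    cosets of multiples.\<close>
  have mpow: "(H #>\<^bsub>?G\<^esub> x) [^]\<^bsub>?M\<^esub> n = H #>\<^bsub>?G\<^esub> (\<lambda>c. int n * x c)" if "x \<in> A" for x and n :: nat
  proof -
    interpret h: group_hom ?G ?M "\<lambda>a. H #>\<^bsub>?G\<^esub> a"
      by (intro group_hom.intro group_hom_axioms.intro N.r_coset_hom_Mod M G)
    have "x \<in> carrier ?G" using that by (simp add: additive_group_def)
    from h.hom_nat_pow[OF this, of n] show ?thesis unfolding pow by (rule sym)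
  qed
  have one: "\<one>\<^bsub>?M\<^esub> = (\<lambda>h. h + 0) ` H" by (simp add: FactGroup_def)
  have carr: "carrier (torsion_part ?M) =
     (\<lambda>a. (\<lambda>h. h + a) ` H) ` {x \<in> A. \<exists>n::nat. 0 < n \<and> (\<lambda>c. int n * x c) \<in> H}"
    (is "?L = ?R")
  proof (rule Set.set_eqI)
    fix z
    have "z \<in> ?L \<longleftrightarrow> (\<exists>a\<in>A. z = (\<lambda>h. h + a) ` H \<and> (\<exists>n::nat. 0 < n \<and> z [^]\<^bsub>?M\<^esub> n = \<one>\<^bsub>?M\<^esub>))"
      by (auto simp add: torsion_part_def carrier_additive_Mod image_iff simp del: one_FactGroup)
    also have "\<dots> \<longleftrightarrow> (\<exists>a\<in>A. z = (\<lambda>h. h + a) ` H \<and> (\<exists>n::nat. 0 < n \<and> (\<lambda>c. int n * a c) \<in> H))"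
    proof (intro bex_cong refl conj_cong ex_cong1)
      fix a n assume "a \<in> A" and z: "z = (\<lambda>h. h + a) ` H"
      show "(z [^]\<^bsub>?M\<^esub> n = \<one>\<^bsub>?M\<^esub>) = ((\<lambda>c. int n * a c) \<in> H)" for n :: nat
        unfolding z using mpow[OF \<open>a \<in> A\<close>, of n] coset_eq_iff[OF H(1), of "\<lambda>c. int n * a c" 0]
        unfolding rc one by simp
    qed
    also have "\<dots> \<longleftrightarrow> z \<in> ?R" by blast
    finally show "z \<in> ?L \<longleftrightarrow> z \<in> ?R" .
  qed
  show ?thesis
    unfolding lattice_index_def Coset.order_def carr carrier_additive_Mod ..
qed

subsection \<open>Integer vectors, matrices and determinants\<close>

text \<open>Functions on the whole type with a support condition: vectors on a set of facets and on
  all facets stay in one type.\<close>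

definition int_vectors :: "'b set \<Rightarrow> ('b \<Rightarrow> int) set" where
  "int_vectors S = {x. \<forall>c. c \<notin> S \<longrightarrow> x c = 0}"

definition mat_apply :: "'i set \<Rightarrow> 'j set \<Rightarrow> ('i \<Rightarrow> 'j \<Rightarrow> 'a) \<Rightarrow> ('j \<Rightarrow> 'a) \<Rightarrow> 'i \<Rightarrow> 'a::comm_ring_1" where
  "mat_apply S T B x = (\<lambda>i. if i \<in> S then \<Sum>j\<in>T. B i j * x j else 0)"

abbreviation sq_apply :: "nat \<Rightarrow> (nat \<Rightarrow> nat \<Rightarrow> 'a) \<Rightarrow> (nat \<Rightarrow> 'a) \<Rightarrow> nat \<Rightarrow> 'a::comm_ring_1" where
  "sq_apply r \<equiv> mat_apply {..<r} {..<r}"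

definition sq_det :: "nat \<Rightarrow> (nat \<Rightarrow> nat \<Rightarrow> int) \<Rightarrow> int" where
  "sq_det r B = det (mat r r (\<lambda>(i, j). B i j))"

lemma add_subgroup_int_vectors: "add_subgroup (int_vectors S)"
  by (auto simp: add_subgroup_def int_vectors_def)

lemma mat_apply_in_int_vectors: "mat_apply S T B x \<in> int_vectors S"
  by (simp add: mat_apply_def int_vectors_def)

lemma mat_apply_diff: "mat_apply S T B (x - y) = mat_apply S T B x - mat_apply S T B y"
  by (auto simp: mat_apply_def fun_eq_iff algebra_simps sum_subtractf)

lemma mat_apply_scale: "mat_apply S T B (\<lambda>c. k * x c) = (\<lambda>c. k * mat_apply S T B x c)"
  by (auto simp: mat_apply_def fun_eq_iff sum_distrib_left algebra_simps)

lemma mat_apply_mat_apply: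
  "mat_apply S T A (mat_apply T U B x) = mat_apply S U (\<lambda>i k. \<Sum>j\<in>T. A i j * B j k) x"
proof -
  have "(\<Sum>j\<in>T. A i j * (\<Sum>k\<in>U. B j k * x k)) = (\<Sum>k\<in>U. (\<Sum>j\<in>T. A i j * B j k) * x k)" for i
    unfolding sum_distrib_left sum_distrib_right by (subst sum.swap) (simp add: mult.assoc)
  then show ?thesis by (auto simp: mat_apply_def fun_eq_iff)
qed

lemma mat_apply_cong:
  assumes "\<And>i j. i \<in> S \<Longrightarrow> j \<in> T \<Longrightarrow> A i j = B i j"
  shows "mat_apply S T A x = mat_apply S T B x"
  using assms by (auto simp: mat_apply_def fun_eq_iff intro!: sum.cong)

lemma mat_apply_0: "mat_apply S T B (\<lambda>_. 0) = (\<lambda>_. 0)" "mat_apply S T B 0 = 0"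
  by (auto simp: mat_apply_def fun_eq_iff)

lemma add_subgroup_mat_apply_image:
  "add_subgroup (mat_apply S T B ` int_vectors U :: ('i \<Rightarrow> int) set)"
  by (intro add_subgroup_image add_subgroup_int_vectors mat_apply_diff)

lemma sum_delta_mult:
  fixes d :: "'a::comm_ring_1"
  assumes "finite T" "i \<in> T"
  shows "(\<Sum>j\<in>T. (if i = j then d else 0) * x j) = d * x i"
    "(\<Sum>j\<in>T. (if j = i then d else 0) * x j) = d * x i"
    "(\<Sum>j\<in>T. x j * (if i = j then d else 0)) = d * x i"
    "(\<Sum>j\<in>T. x j * (if j = i then d else 0)) = d * x i"
  using assms by (simp_all add: if_distrib[of "\<lambda>u. u * _"] if_distrib[of "(*) _"] mult.commute cong: if_cong)

lemma mat_apply_diagonal: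
  assumes "finite T" "x \<in> int_vectors T"
    and "\<And>i j. i \<in> T \<Longrightarrow> j \<in> T \<Longrightarrow> B i j = (if i = j then d else 0)"
  shows "mat_apply T T B x = (\<lambda>i. d * x i)"
proof -
  have "mat_apply T T B x = mat_apply T T (\<lambda>i j. if i = j then d else 0) x"
    using assms(3) by (rule mat_apply_cong)
  then show ?thesis
    using assms(1,2) by (auto simp: mat_apply_def int_vectors_def fun_eq_iff sum_delta_mult)
qed

lemma sq_det_cong:
  assumes "\<And>i j. i < r \<Longrightarrow> j < r \<Longrightarrow> A i j = B i j"
  shows "sq_det r A = sq_det r B"
proof -
  have "mat r r (\<lambda>(i, j). A i j) = mat r r (\<lambda>(i, j). B i j)"
    using assms by (intro eq_matI) auto
  then show ?thesis by (simp add: sq_det_def)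
qed

lemma sq_det_mult: "sq_det r (\<lambda>i k. \<Sum>j<r. A i j * B j k) = sq_det r A * sq_det r B"
proof -
  have "mat r r (\<lambda>(i, k). \<Sum>j<r. A i j * B j k) = mat r r (\<lambda>(i, j). A i j) * mat r r (\<lambda>(i, j). B i j)"
    by (intro eq_matI) (auto simp: scalar_prod_def lessThan_atLeast0)
  then show ?thesis by (simp add: sq_det_def det_mult[of _ r])
qed

lemma sq_det_transpose: "sq_det r (\<lambda>i j. A j i) = sq_det r A"
proof -
  have "mat r r (\<lambda>(i, j). A j i) = (mat r r (\<lambda>(i, j). A i j))\<^sup>T"
    by (intro eq_matI) auto
  then show ?thesis by (simp add: sq_det_def det_transpose[of _ r])
qed

text \<open>The adjugate acts as an inverse up to the factor \<open>sq_det r B\<close>, without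
  leaving the ring.\<close>

lemma sq_det_adjugate:
  obtains A where
    "\<And>i k. i < r \<Longrightarrow> k < r \<Longrightarrow> (\<Sum>j<r. B i j * A j k) = (if i = k then sq_det r B else 0)"
    "\<And>i k. i < r \<Longrightarrow> k < r \<Longrightarrow> (\<Sum>j<r. A i j * B j k) = (if i = k then sq_det r B else 0)"
proof -
  define M where "M = mat r r (\<lambda>(i, j). B i j)"
  have M: "M \<in> carrier_mat r r" by (simp add: M_def)
  note a = adj_mat[OF M]
  show thesis
  proof (rule that[of "\<lambda>i j. adj_mat M $$ (i, j)"])
    fix i k assume ik: "i < r" "k < r"
    have "(M * adj_mat M) $$ (i, k) = (\<Sum>j<r. B i j * adj_mat M $$ (j, k))"
      using ik M a(1) by (auto simp: scalar_prod_def lessThan_atLeast0 M_def intro!: sum.cong)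
    then show "(\<Sum>j<r. B i j * adj_mat M $$ (j, k)) = (if i = k then sq_det r B else 0)"
      using ik unfolding a(2) by (simp add: sq_det_def M_def split: if_splits)
    have "(adj_mat M * M) $$ (i, k) = (\<Sum>j<r. adj_mat M $$ (i, j) * B j k)"
      using ik M a(1) by (auto simp: scalar_prod_def lessThan_atLeast0 M_def intro!: sum.cong)
    then show "(\<Sum>j<r. adj_mat M $$ (i, j) * B j k) = (if i = k then sq_det r B else 0)"
      using ik unfolding a(3) by (simp add: sq_det_def M_def split: if_splits)
  qed
qed

lemma sq_det_eq_0_imp_kernel:
  assumes "sq_det r B = 0"
  obtains x where "x \<in> int_vectors {..<r}" "x \<noteq> 0" "sq_apply r B x = 0"
proof -
  define M where "M = mat r r (\<lambda>(i, j). B i j)"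
  have M: "M \<in> carrier_mat r r" by (simp add: M_def)
  obtain v where v: "v \<in> carrier_vec r" "v \<noteq> 0\<^sub>v r" "M *\<^sub>v v = 0\<^sub>v r"
    using det_0_iff_vec_prod_zero[OF M] assms by (auto simp: sq_det_def M_def)
  define x where "x i = (if i < r then v $ i else 0)" for i
  show thesis
  proof (rule that[of x])
    show "x \<in> int_vectors {..<r}" by (simp add: int_vectors_def x_def)
    obtain i where "i < r" "v $ i \<noteq> 0" using v(1,2) by (metis carrier_vecD eq_vecI index_zero_vec)
    then have "x i \<noteq> 0" by (simp add: x_def)
    then show "x \<noteq> 0" by auto
    have "(\<Sum>j<r. B i j * x j) = 0" if "i < r" for i
    proof -
      have "(M *\<^sub>v v) $ i = (\<Sum>j<r. B i j * x j)"
        using that v(1) by (auto simp: M_def scalar_prod_def lessThan_atLeast0 x_def intro!: sum.cong)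
      then show ?thesis using v(3) that by simp
    qed
    then show "sq_apply r B x = 0" by (auto simp: mat_apply_def fun_eq_iff)
  qed
qed

lemma sq_det_nonzero_imp_inj:
  assumes "sq_det r B \<noteq> 0" "x \<in> int_vectors {..<r}" "sq_apply r B x = 0"
  shows "x = 0"
proof -
  obtain A where A: "\<And>i k. i < r \<Longrightarrow> k < r \<Longrightarrow> (\<Sum>j<r. A i j * B j k) = (if i = k then sq_det r B else 0)"
    by (rule sq_det_adjugate[of r B]) blast
  have "(\<lambda>i. sq_det r B * x i) = sq_apply r A (sq_apply r B x)"
    unfolding mat_apply_mat_apply by (rule mat_apply_diagonal[symmetric]) (use assms A in auto)
  also have "\<dots> = 0" using assms(3) by (simp add: mat_apply_0)
  finally show ?thesis using assms(1) by (auto simp: fun_eq_iff)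
qed

text \<open>One multiplier serves all vectors. This is how equality of saturations and surjectivity
  onto dual coordinates are obtained later.\<close>

lemma sq_det_nonzero_multiple:
  assumes "sq_det r B \<noteq> 0"
  obtains k :: nat where "0 < k"
    "\<And>a. a \<in> int_vectors {..<r} \<Longrightarrow> \<exists>z\<in>int_vectors {..<r}. sq_apply r B z = (\<lambda>i. int k * a i)"
proof -
  define D where "D = sq_det r B"
  obtain A where A: "\<And>i k. i < r \<Longrightarrow> k < r \<Longrightarrow> (\<Sum>j<r. B i j * A j k) = (if i = k then D else 0)"
    unfolding D_def by (rule sq_det_adjugate[of r B]) blast
  show thesis
  proof (rule that[of "nat \<bar>D\<bar>"])
    show "0 < nat \<bar>D\<bar>" using assms by (simp add: D_def)
    fix a assume a: "a \<in> int_vectors {..<r}"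
    \<comment> \<open>The factor \<open>sgn D\<close> turns the multiplier \<open>D\<close> into its
      absolute value, a natural number.\<close>
    define z where "z = sq_apply r A (\<lambda>i. sgn D * a i)"
    have sa: "(\<lambda>i. sgn D * a i) \<in> int_vectors {..<r}" using a by (simp add: int_vectors_def)
    have "sq_apply r B z = (\<lambda>i. D * (sgn D * a i))"
      unfolding z_def mat_apply_mat_apply by (rule mat_apply_diagonal[OF _ sa]) (auto simp: A)
    also have "\<dots> = (\<lambda>i. int (nat \<bar>D\<bar>) * a i)" by (auto simp: sgn_if)
    finally show "\<exists>z\<in>int_vectors {..<r}. sq_apply r B z = (\<lambda>i. int (nat \<bar>D\<bar>) * a i)"
      unfolding z_def using mat_apply_in_int_vectors by blast
  qed
qed

subsection \<open>The index of the column lattice of a square matrix\<close>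

lemma sq_det_add_col:
  assumes "a < r" "b < r" "a \<noteq> b"
  shows "sq_det r (\<lambda>i k. if k = a then B i a + c * B i b else B i k) = sq_det r B"
proof -
  have "mat r r (\<lambda>(i, k). if k = a then B i a + c * B i b else B i k)
      = addcol c a b (mat r r (\<lambda>(i, j). B i j))"
    by (intro eq_matI) (use assms in auto)
  then show ?thesis using assms by (simp add: sq_det_def det_addcol[of b r a])
qed

lemma sq_det_swap_col:
  assumes "a < r" "b < r" "a \<noteq> b"
  shows "sq_det r (\<lambda>i k. B i (Transposition.transpose a b k)) = - sq_det r B"
proof -
  have "mat r r (\<lambda>(i, k). B i (Transposition.transpose a b k)) = swapcols a b (mat r r (\<lambda>(i, j). B i j))"
    by (intro eq_matI) (use assms in \<open>auto simp: transpose_def\<close>)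
  then show ?thesis using assms by (simp add: sq_det_def det_swapcols[of a r b])
qed

text \<open>A column operation is a change of variable. As this change is invertible over the
  integers, \<open>image_add_col\<close> follows.\<close>

lemma mat_apply_add_col:
  fixes a b r :: nat and B :: "nat \<Rightarrow> nat \<Rightarrow> int"
  assumes "a < r" "b < r" "a \<noteq> b"
  shows "sq_apply r (\<lambda>i k. if k = a then B i a + c * B i b else B i k) x
    = sq_apply r B (x(b := x b + c * x a))"
proof -
  have "(\<Sum>k<r. (if k = a then B i a + c * B i b else B i k) * x k)
      = (\<Sum>k<r. B i k * (x(b := x b + c * x a)) k)" for i
  proof -
    have "(\<Sum>k<r. (if k = a then B i a + c * B i b else B i k) * x k)
        = (\<Sum>k<r. B i k * x k + (if k = a then c * B i b * x a else 0))"
      by (rule sum.cong) (auto simp: algebra_simps)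
    also have "\<dots> = (\<Sum>k<r. B i k * x k) + c * B i b * x a" using assms by (simp add: sum.distrib)
    also have "\<dots> = (\<Sum>k<r. B i k * x k + (if k = b then c * B i b * x a else 0))"
      using assms by (simp add: sum.distrib)
    also have "\<dots> = (\<Sum>k<r. B i k * (x(b := x b + c * x a)) k)"
      by (rule sum.cong) (auto simp: algebra_simps)
    finally show ?thesis .
  qed
  then show ?thesis unfolding mat_apply_def by (simp only:)
qed

lemma image_add_col:
  fixes a b r :: nat and B :: "nat \<Rightarrow> nat \<Rightarrow> int"
  assumes "a < r" "b < r" "a \<noteq> b"
  shows "sq_apply r (\<lambda>i k. if k = a then B i a + c * B i b else B i k) ` int_vectors {..<r}
    = sq_apply r B ` int_vectors {..<r}" (is "?l = ?r")
proof
  show "?l \<subseteq> ?r"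
  proof
    fix v assume "v \<in> ?l"
    then obtain x where "x \<in> int_vectors {..<r}" "v = sq_apply r B (x(b := x b + c * x a))"
      using mat_apply_add_col[OF assms] by auto
    moreover from this have "x(b := x b + c * x a) \<in> int_vectors {..<r}"
      using assms by (auto simp: int_vectors_def)
    ultimately show "v \<in> ?r" by blast
  qed
  show "?r \<subseteq> ?l"
  proof
    fix v assume "v \<in> ?r"
    then obtain x where x: "x \<in> int_vectors {..<r}" "v = sq_apply r B x" by auto
    have "(x(b := x b - c * x a))(b := (x(b := x b - c * x a)) b + c * (x(b := x b - c * x a)) a) = x"
      using assms by auto
    then have "v = sq_apply r (\<lambda>i k. if k = a then B i a + c * B i b else B i k) (x(b := x b - c * x a))"
      unfolding mat_apply_add_col[OF assms] using x by simp
    moreover have "x(b := x b - c * x a) \<in> int_vectors {..<r}"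
      using assms x by (auto simp: int_vectors_def)
    ultimately show "v \<in> ?l" by blast
  qed
qed

lemma image_swap_col:
  fixes a b r :: nat and B :: "nat \<Rightarrow> nat \<Rightarrow> int"
  assumes "a < r" "b < r"
  shows "sq_apply r (\<lambda>i k. B i (Transposition.transpose a b k)) ` int_vectors {..<r}
    = sq_apply r B ` int_vectors {..<r}" (is "?l = ?r")
proof -
  have bij: "bij_betw (Transposition.transpose a b) {..<r} {..<r}"
    using assms by (intro permutes_imp_bij permutes_swap_id) auto
  have eq: "sq_apply r (\<lambda>i k. B i (Transposition.transpose a b k)) x
      = sq_apply r B (x \<circ> Transposition.transpose a b)" for x
  proof -
    have "(\<Sum>k<r. B i (Transposition.transpose a b k) * x k) = (\<Sum>k<r. B i k * x (Transposition.transpose a b k))" for i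
      by (rule sum.reindex_bij_betw[OF bij, of "\<lambda>k. B i k * x (Transposition.transpose a b k)", simplified])
    then show ?thesis unfolding mat_apply_def o_def by (simp only:)
  qed
  have mem: "x \<circ> Transposition.transpose a b \<in> int_vectors {..<r}" if "x \<in> int_vectors {..<r}" for x :: "nat \<Rightarrow> int"
    using that assms by (auto simp: int_vectors_def transpose_def)
  have inv: "(x \<circ> Transposition.transpose a b) \<circ> Transposition.transpose a b = x" for x :: "nat \<Rightarrow> int"
    by (simp add: fun_eq_iff)
  show ?thesis
  proof (intro equalityI subsetI)
    fix v assume "v \<in> ?l" then show "v \<in> ?r" using eq mem by auto
  next
    fix v assume "v \<in> ?r"
    then obtain x where x: "x \<in> int_vectors {..<r}" "v = sq_apply r B x" by auto
    then have "v = sq_apply r (\<lambda>i k. B i (Transposition.transpose a b k)) (x \<circ> Transposition.transpose a b)"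
      by (simp add: eq inv)
    then show "v \<in> ?l" using mem[OF x(1)] by blast
  qed
qed

lemma sq_det_last_row:
  assumes "\<And>j. j < n \<Longrightarrow> B n j = 0"
  shows "sq_det (Suc n) B = B n n * sq_det n B"
proof -
  define M where "M = mat (Suc n) (Suc n) (\<lambda>(i, j). B i j)"
  have M: "M \<in> carrier_mat (Suc n) (Suc n)" by (simp add: M_def)
  have "det M = (\<Sum>j<Suc n. M $$ (n, j) * cofactor M n j)"
    by (rule laplace_expansion_row[OF M]) simp
  also have "\<dots> = M $$ (n, n) * cofactor M n n" using assms by (simp add: M_def)
  also have "mat_delete M n n = mat n n (\<lambda>(i, j). B i j)"
    by (intro eq_matI) (auto simp: M_def mat_delete_def)
  then have "cofactor M n n = sq_det n B" by (simp add: cofactor_def sq_det_def)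
  finally show ?thesis by (simp add: M_def sq_det_def)
qed

text \<open>Subtracting a multiple of the last column brings the last entry of a vector into the
  residues modulo \<open>B n n\<close>; the first \<open>n\<close> entries then matter only modulo
  the other columns. So the set of cosets is a product.\<close>

lemma index_last_row:
  fixes B :: "nat \<Rightarrow> nat \<Rightarrow> int"
  assumes z: "\<And>j. j < n \<Longrightarrow> B n j = 0" and g: "B n n \<noteq> 0"
  shows "lattice_index (int_vectors {..<Suc n}) (sq_apply (Suc n) B ` int_vectors {..<Suc n})
    = nat \<bar>B n n\<bar> * lattice_index (int_vectors {..<n}) (sq_apply n B ` int_vectors {..<n})"
proof -
  define g where "g = B n n"
  define H where "H = sq_apply n B ` int_vectors {..<n}"
  define q where "q a = (\<lambda>h. h + a) ` H" for a :: "nat \<Rightarrow> int"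
  \<comment> \<open>The multiple of the last column to subtract: \<open>g * s x\<close> equals
    \<open>\<bar>g\<bar> * (x n div \<bar>g\<bar>)\<close> for either sign of
    \<open>g\<close>.\<close>
  define s where "s x = sgn g * (x n div \<bar>g\<bar>)" for x :: "nat \<Rightarrow> int"
  define w where "w x = (\<lambda>i. if i < n then x i - s x * B i n else 0)" for x
  define f where "f x = (x n mod \<bar>g\<bar>, q (w x))" for x
  have g0: "g \<noteq> 0" using g by (simp add: g_def)
  have xn: "x n = x n mod \<bar>g\<bar> + g * s x" for x :: "nat \<Rightarrow> int"
    unfolding s_def mult.assoc[symmetric] abs_sgn[symmetric] by (simp add: mod_mult_div_eq)
  have H: "add_subgroup H" unfolding H_def by (rule add_subgroup_mat_apply_image)
  have app: "sq_apply (Suc n) B y = (\<lambda>i. if i < n then y n * B i n + (\<Sum>j<n. B i j * y j)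
      else if i = n then g * y n else 0)" for y
    using z by (auto simp: mat_apply_def fun_eq_iff g_def)
  have cls: "f x = f y \<longleftrightarrow> x - y \<in> sq_apply (Suc n) B ` int_vectors {..<Suc n}"
    if xy: "x \<in> int_vectors {..<Suc n}" "y \<in> int_vectors {..<Suc n}" for x y
  proof
    assume "f x = f y"
    then have u: "x n mod \<bar>g\<bar> = y n mod \<bar>g\<bar>" and "q (w x) = q (w y)" by (auto simp: f_def)
    then have "w x - w y \<in> H" unfolding q_def coset_eq_iff[OF H] by simp
    then obtain z where z: "z \<in> int_vectors {..<n}" "w x - w y = sq_apply n B z"
      by (auto simp: H_def)
    have "x - y = sq_apply (Suc n) B (z(n := s x - s y))"
    proof
      fix i consider "i < n" | "i = n" | "i > n" by linarith
      then show "(x - y) i = sq_apply (Suc n) B (z(n := s x - s y)) i"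
      proof cases
        case 1
        then show ?thesis using fun_cong[OF z(2), of i]
          unfolding app by (simp add: w_def mat_apply_def algebra_simps)
      next
        case 2
        then show ?thesis unfolding app using xn[of x] xn[of y] u by (simp add: algebra_simps)
      next
        case 3
        then show ?thesis unfolding app using xy by (simp add: int_vectors_def)
      qed
    qed
    moreover have "z(n := s x - s y) \<in> int_vectors {..<Suc n}" using z(1) by (auto simp: int_vectors_def)
    ultimately show "x - y \<in> sq_apply (Suc n) B ` int_vectors {..<Suc n}" by blast
  next
    assume "x - y \<in> sq_apply (Suc n) B ` int_vectors {..<Suc n}"
    then obtain v where v: "v \<in> int_vectors {..<Suc n}" "x - y = sq_apply (Suc n) B v" by auto
    have d: "x n = y n + g * v n" using fun_cong[OF v(2), of n] by (simp add: app algebra_simps)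
    have u: "x n mod \<bar>g\<bar> = y n mod \<bar>g\<bar>"
      unfolding d by (simp add: mod_eq_dvd_iff)
    have "g * (s x - s y) = g * v n"
      using xn[of x] xn[of y] u d unfolding right_diff_distrib by linarith
    then have sv: "s x - s y = v n" using g0 by simp
    have "w x - w y = sq_apply n B (\<lambda>i. if i < n then v i else 0)"
    proof
      fix i show "(w x - w y) i = sq_apply n B (\<lambda>i. if i < n then v i else 0) i"
        using fun_cong[OF v(2), of i] unfolding app
        by (simp add: w_def mat_apply_def algebra_simps flip: sv)
    qed
    moreover have "(\<lambda>i. if i < n then v i else 0) \<in> int_vectors {..<n}" by (simp add: int_vectors_def)
    ultimately have "w x - w y \<in> H" unfolding H_def by blast
    then show "f x = f y" using u unfolding f_def q_def by (simp add: coset_eq_iff[OF H])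
  qed
  have "f ` int_vectors {..<Suc n} = {0..<\<bar>g\<bar>} \<times> q ` int_vectors {..<n}"
  proof (intro equalityI subsetI)
    fix z assume "z \<in> f ` int_vectors {..<Suc n}"
    moreover have "w x \<in> int_vectors {..<n}" for x by (simp add: w_def int_vectors_def)
    ultimately show "z \<in> {0..<\<bar>g\<bar>} \<times> q ` int_vectors {..<n}" using g0 by (auto simp: f_def)
  next
    fix z assume "z \<in> {0..<\<bar>g\<bar>} \<times> q ` int_vectors {..<n}"
    then obtain u a where ua: "z = (u, q a)" "0 \<le> u" "u < \<bar>g\<bar>" "a \<in> int_vectors {..<n}" by auto
    have "s (a(n := u)) = 0" using ua by (simp add: s_def)
    then have "w (a(n := u)) = a" using ua by (auto simp: w_def int_vectors_def)
    then have "z = f (a(n := u))" using ua by (simp add: f_def)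
    moreover have "a(n := u) \<in> int_vectors {..<Suc n}" using ua by (auto simp: int_vectors_def)
    ultimately show "z \<in> f ` int_vectors {..<Suc n}" by blast
  qed
  moreover have "lattice_index (int_vectors {..<Suc n}) (sq_apply (Suc n) B ` int_vectors {..<Suc n})
      = card (f ` int_vectors {..<Suc n})"
    by (rule lattice_index_classifier[OF add_subgroup_mat_apply_image cls])
  moreover have "lattice_index (int_vectors {..<n}) H = card (q ` int_vectors {..<n})"
    by (rule lattice_index_classifier[OF H]) (simp add: q_def coset_eq_iff[OF H])
  ultimately show ?thesis by (simp add: card_cartesian_product H_def g_def)
qed

text \<open>Column operations change neither the column lattice nor the absolute determinant.
  Euclid's algorithm on the last row reaches the shape of \<open>index_last_row\<close>, and
  induction on \<open>r\<close> handles the smaller block.\<close>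

theorem lattice_index_sq_det:
  assumes "sq_det r B \<noteq> 0"
  shows "lattice_index (int_vectors {..<r}) (sq_apply r B ` int_vectors {..<r}) = nat \<bar>sq_det r B\<bar>"
  using assms
proof (induction r arbitrary: B)
  case 0
  have "int_vectors {..<0::nat} = {0}" by (auto simp: int_vectors_def fun_eq_iff)
  then have idx: "lattice_index (int_vectors {..<0}) (sq_apply 0 B ` int_vectors {..<0})
      = card ((\<lambda>x. ()) ` int_vectors {..<0::nat})"
    by (intro lattice_index_classifier add_subgroup_mat_apply_image) (auto simp: mat_apply_0)
  show ?case unfolding idx unfolding \<open>int_vectors {..<0::nat} = {0}\<close> by (simp add: sq_det_def det_dim_zero)
next
  case (Suc n)
  have last: "lattice_index (int_vectors {..<Suc n}) (sq_apply (Suc n) B ` int_vectors {..<Suc n})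
      = nat \<bar>sq_det (Suc n) B\<bar>"
    if "sq_det (Suc n) B \<noteq> 0" "\<And>j. j < n \<Longrightarrow> B n j = 0" for B
    using that sq_det_last_row[of n B] index_last_row[of n B] Suc.IH[of B]
    by (auto simp: abs_mult nat_mult_distrib)
  show ?case using Suc.prems
  \<comment> \<open>The size of the last row is the measure for Euclid's algorithm.\<close>
  proof (induction "\<Sum>j<Suc n. nat \<bar>B n j\<bar>" arbitrary: B rule: less_induct)
    case less
    consider "\<And>j. j < n \<Longrightarrow> B n j = 0"
      | (one) a where "a < n" "\<And>j. j < Suc n \<Longrightarrow> j \<noteq> a \<Longrightarrow> B n j = 0"
      | (two) a b where "a < Suc n" "b < Suc n" "a \<noteq> b" "B n a \<noteq> 0" "B n b \<noteq> 0"
    proof (cases "\<forall>j<n. B n j = 0")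
      case False
      then obtain a where a: "a < n" "B n a \<noteq> 0" by blast
      show thesis
      proof (cases "\<forall>j<Suc n. j \<noteq> a \<longrightarrow> B n j = 0")
        case True
        then show ?thesis using a one by blast
      next
        case False
        then obtain b where "b < Suc n" "b \<noteq> a" "B n b \<noteq> 0" by blast
        then show ?thesis using two[of a b] a by simp
      qed
    qed blast
    then show ?case
    proof cases
      case 1
      then show ?thesis using less.prems by (intro last)
    next
      case one
      have an: "a < Suc n" "n < Suc n" "a \<noteq> n" using one by auto
      have "B n (Transposition.transpose a n j) = 0" if "j < n" for j
        using that one an by (cases "j = a") (auto simp: transpose_def)
      then show ?thesis
        using last[of "\<lambda>i k. B i (Transposition.transpose a n k)"] less.prems
        unfolding image_swap_col[OF an(1,2)] sq_det_swap_col[OF an] by simp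
    next
      case two
      have *: "lattice_index (int_vectors {..<Suc n}) (sq_apply (Suc n) B ` int_vectors {..<Suc n})
          = nat \<bar>sq_det (Suc n) B\<bar>"
        if ab: "a < Suc n" "b < Suc n" "a \<noteq> b" and "B n b \<noteq> 0" "\<bar>B n b\<bar> \<le> \<bar>B n a\<bar>" for a b
      proof -
        \<comment> \<open>Subtractive Euclid: with this sign the new entry has absolute value
          \<open>\<bar>B n a\<bar> - \<bar>B n b\<bar>\<close>, which is smaller because
          \<open>B n b\<close> is nonzero.\<close>
        define c where "c = - sgn (B n a) * sgn (B n b)"
        have "\<bar>B n a + c * B n b\<bar> < \<bar>B n a\<bar>"
          using that by (auto simp: c_def sgn_if abs_if split: if_splits)
        then have lt: "nat \<bar>if a = a then B n a + c * B n b else B n a\<bar> < nat \<bar>B n a\<bar>" by simp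
        have "(\<Sum>j<Suc n. nat \<bar>if j = a then B n a + c * B n b else B n j\<bar>) < (\<Sum>j<Suc n. nat \<bar>B n j\<bar>)"
          by (rule sum_strict_mono_ex1) (use lt ab in auto)
        from less.hyps[of "\<lambda>i k. if k = a then B i a + c * B i b else B i k", OF this]
        show ?thesis
          unfolding image_add_col[OF ab] sq_det_add_col[OF ab] using less.prems by simp
      qed
      show ?thesis
      proof (cases "\<bar>B n b\<bar> \<le> \<bar>B n a\<bar>")
        case True
        then show ?thesis by (rule *[OF two(1,2,3,5)])
      next
        case False
        then show ?thesis by (intro *[OF two(2,1) two(3)[symmetric] two(4)]) simp
      qed
    qed
  qed
qed

subsection \<open>The Cauchy--Binet formula for Gram determinants\<close>

text \<open>Multilinearity in the rows: expanding all row sums means choosing a summand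
  \<open>f i\<close> for every row \<open>i\<close>.\<close>

lemma sq_det_sum_expand:
  assumes "finite S"
  shows "sq_det r (\<lambda>i j. \<Sum>c\<in>S. a i c * b c j)
    = (\<Sum>f\<in>PiE {..<r} (\<lambda>_. S). (\<Prod>i<r. a i (f i)) * sq_det r (\<lambda>i j. b (f i) j))"
proof -
  let ?P = "{p. p permutes {..<r}}" and ?F = "PiE {..<r} (\<lambda>_. S)"
  have d: "sq_det r B = (\<Sum>p\<in>?P. signof p * (\<Prod>i<r. B i (p i)))" for B
    unfolding sq_det_def det_def
    by (auto simp: lessThan_atLeast0 intro!: sum.cong prod.cong dest: permutes_in_image)
  have "sq_det r (\<lambda>i j. \<Sum>c\<in>S. a i c * b c j)
      = (\<Sum>p\<in>?P. signof p * (\<Sum>f\<in>?F. \<Prod>i<r. a i (f i) * b (f i) (p i)))"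
    unfolding d by (intro sum.cong refl arg_cong2[of _ _ _ _ "(*)"] prod_sum_PiE) (use assms in auto)
  also have "\<dots> = (\<Sum>f\<in>?F. \<Sum>p\<in>?P. signof p * (\<Prod>i<r. a i (f i) * b (f i) (p i)))"
    unfolding sum_distrib_left by (rule sum.swap)
  also have "\<dots> = (\<Sum>f\<in>?F. (\<Prod>i<r. a i (f i)) * sq_det r (\<lambda>i j. b (f i) j))"
    unfolding d sum_distrib_left prod.distrib by (intro sum.cong refl) (simp add: algebra_simps)
  finally show ?thesis .
qed

lemma sq_det_identical_rows:
  assumes "i < r" "j < r" "i \<noteq> j" "\<And>k. B i k = B j k"
  shows "sq_det r B = 0"
proof -
  have "row (mat r r (\<lambda>(i, j). B i j)) i = row (mat r r (\<lambda>(i, j). B i j)) j"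
    using assms by (intro eq_vecI) auto
  then show ?thesis
    unfolding sq_det_def using assms by (intro det_identical_rows[of _ r i j]) auto
qed

text \<open>In the expansion of the left side a repeated value of \<open>f\<close> gives two equal
  rows, so only injective \<open>f\<close> survive. Those with image \<open>U\<close> make up the
  same expansion over \<open>U\<close> alone. Gram determinants on the right spare an ordering of
  \<open>U\<close>.\<close>

theorem cauchy_binet_gram:
  assumes S: "finite S"
  shows "sq_det r (\<lambda>i j. \<Sum>c\<in>S. q i c * q j c)
    = (\<Sum>U\<in>{U. U \<subseteq> S \<and> card U = r}. sq_det r (\<lambda>i j. \<Sum>c\<in>U. q i c * q j c))"
proof -
  define g where "g f = (\<Prod>i<r. q i (f i)) * sq_det r (\<lambda>i j. q j (f i))" for f
  have inj: "sq_det r (\<lambda>i j. \<Sum>c\<in>T. q i c * q j c) = (\<Sum>f\<in>{f \<in> PiE {..<r} (\<lambda>_. T). inj_on f {..<r}}. g f)"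
    if "finite T" for T
  proof -
    have "sq_det r (\<lambda>i j. \<Sum>c\<in>T. q i c * q j c) = (\<Sum>f\<in>PiE {..<r} (\<lambda>_. T). g f)"
      unfolding g_def by (rule sq_det_sum_expand[OF that, of r q "\<lambda>c j. q j c"])
    also have "\<dots> = (\<Sum>f\<in>{f \<in> PiE {..<r} (\<lambda>_. T). inj_on f {..<r}}. g f)"
    proof (rule sum.mono_neutral_right)
      show "\<forall>f\<in>PiE {..<r} (\<lambda>_. T) - {f \<in> PiE {..<r} (\<lambda>_. T). inj_on f {..<r}}. g f = 0"
      proof
        fix f assume "f \<in> PiE {..<r} (\<lambda>_. T) - {f \<in> PiE {..<r} (\<lambda>_. T). inj_on f {..<r}}"
        then obtain i j where "i < r" "j < r" "i \<noteq> j" "f i = f j" by (auto simp: inj_on_def)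
        then have "sq_det r (\<lambda>i j. q j (f i)) = 0" by (intro sq_det_identical_rows[of i r j]) auto
        then show "g f = 0" by (simp add: g_def)
      qed
    qed (use that in \<open>auto intro: finite_PiE\<close>)
    finally show ?thesis .
  qed
  have fin: "finite {f \<in> PiE {..<r} (\<lambda>_. S). inj_on f {..<r}}" "finite {U. U \<subseteq> S \<and> card U = r}"
    using S by (auto intro!: finite_subset[OF _ finite_PiE[of "{..<r}" "\<lambda>_. S"]])
  have "(\<Sum>f\<in>{f \<in> PiE {..<r} (\<lambda>_. S). inj_on f {..<r}}. g f)
      = (\<Sum>U\<in>{U. U \<subseteq> S \<and> card U = r}.
          sum g {f \<in> {f \<in> PiE {..<r} (\<lambda>_. S). inj_on f {..<r}}. f ` {..<r} = U})"
  proof (rule sum.group[OF fin, of "\<lambda>f. f ` {..<r}", symmetric])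
    show "(\<lambda>f. f ` {..<r}) ` {f \<in> PiE {..<r} (\<lambda>_. S). inj_on f {..<r}} \<subseteq> {U. U \<subseteq> S \<and> card U = r}"
    proof (rule image_subsetI)
      fix f assume "f \<in> {f \<in> PiE {..<r} (\<lambda>_. S). inj_on f {..<r}}"
      then show "f ` {..<r} \<in> {U. U \<subseteq> S \<and> card U = r}" by (simp add: card_image PiE_iff image_subset_iff)
    qed
  qed
  also have "\<dots> = (\<Sum>U\<in>{U. U \<subseteq> S \<and> card U = r}. sum g {f \<in> PiE {..<r} (\<lambda>_. U). inj_on f {..<r}})"
  proof (intro sum.cong refl arg_cong2[of _ _ _ _ sum])
    fix U assume "U \<in> {U. U \<subseteq> S \<and> card U = r}"
    then have U: "U \<subseteq> S" "card U = r" by auto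
    have "f ` {..<r} = U" if "f \<in> PiE {..<r} (\<lambda>_. U)" "inj_on f {..<r}" for f
      by (rule card_subset_eq) (use that U S in \<open>auto simp: card_image intro: finite_subset\<close>)
    then show "{f \<in> {f \<in> PiE {..<r} (\<lambda>_. S). inj_on f {..<r}}. f ` {..<r} = U}
        = {f \<in> PiE {..<r} (\<lambda>_. U). inj_on f {..<r}}"
      using U by (auto simp: PiE_iff)
  qed
  also have "\<dots> = (\<Sum>U\<in>{U. U \<subseteq> S \<and> card U = r}. sq_det r (\<lambda>i j. \<Sum>c\<in>U. q i c * q j c))"
    by (intro sum.cong refl inj[symmetric]) (use S in \<open>auto intro: finite_subset\<close>)
  finally show ?thesis using inj[OF S] by simp
qed

text \<open>The minor depends on the enumeration \<open>e\<close> up to sign; its square does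
  not.\<close>

lemma sq_det_gram_bij:
  assumes "bij_betw e {..<r} U"
  shows "sq_det r (\<lambda>i j. \<Sum>c\<in>U. q i c * q j c) = (sq_det r (\<lambda>i k. q i (e k)))\<^sup>2"
proof -
  have "sq_det r (\<lambda>i j. \<Sum>c\<in>U. q i c * q j c) = sq_det r (\<lambda>i j. \<Sum>k<r. q i (e k) * q j (e k))"
    by (intro sq_det_cong sum.reindex_bij_betw[OF assms, symmetric])
  also have "\<dots> = sq_det r (\<lambda>i k. q i (e k)) * sq_det r (\<lambda>k j. q j (e k))"
    by (rule sq_det_mult)
  also have "sq_det r (\<lambda>k j. q j (e k)) = sq_det r (\<lambda>i k. q i (e k))"
    by (rule sq_det_transpose)
  finally show ?thesis by (simp add: power2_eq_square)
qed

subsection \<open>Bases of saturated lattices\<close>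

definition inner_on :: "'b set \<Rightarrow> ('b \<Rightarrow> int) \<Rightarrow> ('b \<Rightarrow> int) \<Rightarrow> int" where
  "inner_on S x y = (\<Sum>c\<in>S. x c * y c)"

lemma inner_on_commute: "inner_on S x y = inner_on S y x"
  by (simp add: inner_on_def mult.commute)

lemma inner_on_diff:
  "inner_on S x (y - z) = inner_on S x y - inner_on S x z"
  "inner_on S (y - z) x = inner_on S y x - inner_on S z x"
  by (simp_all add: inner_on_def algebra_simps sum_subtractf)

lemma inner_on_sum:
  "inner_on S x (\<lambda>c. \<Sum>i\<in>I. a i * p i c) = (\<Sum>i\<in>I. a i * inner_on S x (p i))"
  "inner_on S (\<lambda>c. \<Sum>i\<in>I. a i * p i c) x = (\<Sum>i\<in>I. a i * inner_on S (p i) x)"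
proof -
  show "inner_on S x (\<lambda>c. \<Sum>i\<in>I. a i * p i c) = (\<Sum>i\<in>I. a i * inner_on S x (p i))"
    unfolding inner_on_def sum_distrib_left by (subst sum.swap) (simp add: algebra_simps)
  then show "inner_on S (\<lambda>c. \<Sum>i\<in>I. a i * p i c) x = (\<Sum>i\<in>I. a i * inner_on S (p i) x)"
    by (simp add: inner_on_commute)
qed

lemma inner_on_scale:
  "inner_on S x (\<lambda>c. k * y c) = k * inner_on S x y"
  "inner_on S (\<lambda>c. k * y c) x = k * inner_on S y x"
  by (simp_all add: inner_on_def sum_distrib_left algebra_simps)

text \<open>In the basis theorem this yields a functional with value 1 on a primitive
  vector.\<close>

lemma bezout_inner_on:
  assumes "finite S"
  shows "\<exists>u\<in>int_vectors S. inner_on S u y = Gcd (y ` S)"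
  using assms
proof (induction S)
  case empty
  show ?case by (auto simp: int_vectors_def inner_on_def intro!: exI[of _ 0])
next
  case (insert s S)
  then obtain u where u: "u \<in> int_vectors S" "inner_on S u y = Gcd (y ` S)" by blast
  obtain a b where ab: "a * y s + b * Gcd (y ` S) = gcd (y s) (Gcd (y ` S))"
    using bezout_int by blast
  define w where "w c = (if c = s then a else b * u c)" for c
  have "inner_on S w y = b * inner_on S u y"
    unfolding inner_on_def sum_distrib_left using insert(2) by (intro sum.cong) (auto simp: w_def)
  then have "inner_on (insert s S) w y = Gcd (y ` insert s S)"
    using insert(1,2) ab u(2) by (simp add: inner_on_def w_def)
  moreover have "w \<in> int_vectors (insert s S)" using u(1) by (auto simp: w_def int_vectors_def)
  ultimately show ?case by blast
qed

lemma biorthogonal_le_card: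
  assumes S: "finite S"
    and qp: "\<And>i j. i < r \<Longrightarrow> j < r \<Longrightarrow> inner_on S (q i) (p j) = (if i = j then 1 else 0)"
  shows "r \<le> card S"
proof -
  \<comment> \<open>The \<open>p i\<close> remain independent modulo 2, which embeds \<open>(\<int>/2)\<^sup>r\<close> into \<open>(\<int>/2)\<^sup>S\<close>.\<close>
  define f where "f I = {c \<in> S. odd (\<Sum>i\<in>I. p i c)}" for I
  have "inj_on f (Pow {..<r})"
  proof (rule inj_onI)
    fix I J assume I: "I \<in> Pow {..<r}" and J: "J \<in> Pow {..<r}" and "f I = f J"
    then have par: "even ((\<Sum>i\<in>I. p i c) - (\<Sum>i\<in>J. p i c))" if "c \<in> S" for c
      using that by (auto simp: f_def Set.set_eq_iff)
    have "k \<in> I \<longleftrightarrow> k \<in> J" if k: "k < r" for k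
    proof -
      have *: "(\<Sum>c\<in>S. q k c * (\<Sum>i\<in>I. p i c)) = (if k \<in> I then 1 else 0)" if I: "I \<subseteq> {..<r}" for I
      proof -
        have "(\<Sum>c\<in>S. q k c * (\<Sum>i\<in>I. p i c)) = (\<Sum>i\<in>I. inner_on S (q k) (p i))"
          unfolding inner_on_def sum_distrib_left by (rule sum.swap)
        also have "\<dots> = (\<Sum>i\<in>I. if k = i then 1 else 0)"
          by (intro sum.cong refl qp) (use k I in auto)
        finally show ?thesis using finite_subset[OF I] by simp
      qed
      have "(if k \<in> I then 1 else 0) - (if k \<in> J then 1 else 0)
          = (\<Sum>c\<in>S. q k c * ((\<Sum>i\<in>I. p i c) - (\<Sum>i\<in>J. p i c)))"
        using *[of I] *[of J] I J by (simp add: right_diff_distrib sum_subtractf)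
      moreover have "even \<dots>" by (intro dvd_sum dvd_mult par)
      ultimately have "even ((if k \<in> I then 1 else 0) - (if k \<in> J then 1 else 0) :: int)" by (simp only:)
      then show ?thesis by (simp split: if_splits)
    qed
    then show "I = J" using I J by auto
  qed
  moreover have "f ` Pow {..<r} \<subseteq> Pow S" by (auto simp: f_def)
  ultimately have "card (Pow {..<r}) \<le> card (Pow S)" using S by (intro card_inj_on_le) auto
  then show ?thesis by (simp add: card_Pow S)
qed

definition saturated_in :: "'b set \<Rightarrow> ('b \<Rightarrow> int) set \<Rightarrow> bool" where
  "saturated_in S L \<longleftrightarrow> (\<forall>x\<in>int_vectors S. \<forall>k::nat. 0 < k \<longrightarrow> (\<lambda>c. int k * x c) \<in> L \<longrightarrow> x \<in> L)"

lemma add_subgroup_scale: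
  fixes L :: "('b \<Rightarrow> int) set"
  assumes "add_subgroup L" "x \<in> L"
  shows "(\<lambda>c. k * x c) \<in> L"
proof -
  note L = add_subgroupD[OF assms(1)]
  have n: "(\<lambda>c. int n * x c) \<in> L" for n
  proof (induction n)
    case (Suc n)
    have "(\<lambda>c. int (Suc n) * x c) = (\<lambda>c. int n * x c) + x" by (auto simp: algebra_simps)
    then show ?case using L(4)[OF Suc assms(2)] by simp
  qed (use L(1) in \<open>simp add: zero_fun_def\<close>)
  show ?thesis
  proof (cases "k \<ge> 0")
    case True
    then show ?thesis using n[of "nat k"] by simp
  next
    case False
    then have "(\<lambda>c. k * x c) = - (\<lambda>c. int (nat (- k)) * x c)" by auto
    then show ?thesis using L(3)[OF n[of "nat (- k)"]] by simp
  qed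
qed

lemma add_subgroup_sum:
  fixes L :: "('b \<Rightarrow> int) set" and r :: nat
  assumes "add_subgroup L" "\<And>i. i < r \<Longrightarrow> p i \<in> L"
  shows "(\<lambda>c. \<Sum>i<r. a i * p i c) \<in> L"
  using assms(2)
proof (induction r)
  case (Suc r)
  have "(\<lambda>c. \<Sum>i<Suc r. a i * p i c) = (\<lambda>c. \<Sum>i<r. a i * p i c) + (\<lambda>c. a r * p r c)" by auto
  then show ?case
    using add_subgroupD(4)[OF assms(1) Suc.IH add_subgroup_scale[OF assms(1)]] Suc.prems
    by simp
qed (use add_subgroupD(1)[OF assms(1)] in \<open>simp add: zero_fun_def\<close>)

text \<open>A biorthogonal system of maximal length already spans \<open>L\<close>;
  \<open>biorthogonal_le_card\<close> makes the maximum exist. Otherwise an unspanned remainder,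
  divided by its content, would extend the system: saturation keeps the quotient in
  \<open>L\<close>, and Bezout supplies its dual vector.\<close>

theorem saturated_lattice_basis:
  fixes L :: "('b \<Rightarrow> int) set"
  assumes S: "finite S" and LS: "L \<subseteq> int_vectors S" and L: "add_subgroup L"
    and sat: "saturated_in S L"
  obtains r :: nat and p q where
    "\<And>i. i < r \<Longrightarrow> p i \<in> L" "\<And>i. i < r \<Longrightarrow> q i \<in> int_vectors S"
    "\<And>i j. i < r \<Longrightarrow> j < r \<Longrightarrow> inner_on S (q i) (p j) = (if i = j then 1 else 0)"
    "\<And>x. x \<in> L \<Longrightarrow> x = (\<lambda>c. \<Sum>i<r. inner_on S (q i) x * p i c)"
proof -
  define P where "P r \<longleftrightarrow> (\<exists>p q. (\<forall>i<r. p i \<in> L \<and> q i \<in> int_vectors S) \<and>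
     (\<forall>i<r. \<forall>j<r. inner_on S (q i) (p j) = (if i = j then 1 else 0)))" for r :: nat
  have "P 0" by (simp add: P_def)
  have bound: "r \<le> card S" if "P r" for r
  proof -
    obtain p q where "\<forall>i<r. \<forall>j<r. inner_on S (q i) (p j) = (if i = j then 1 else 0)"
      using \<open>P r\<close> unfolding P_def by blast
    then show "r \<le> card S" by (intro biorthogonal_le_card[OF S, of r q p]) auto
  qed
  define r where "r = Greatest P"
  have r: "P r" "\<And>r'. P r' \<Longrightarrow> r' \<le> r"
    unfolding r_def using GreatestI_nat[of P, OF \<open>P 0\<close> bound] Greatest_le_nat[of P, OF _ bound] by blast+
  then obtain p q where p: "\<And>i. i < r \<Longrightarrow> p i \<in> L" and q: "\<And>i. i < r \<Longrightarrow> q i \<in> int_vectors S"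
    and qp: "\<And>i j. i < r \<Longrightarrow> j < r \<Longrightarrow> inner_on S (q i) (p j) = (if i = j then 1 else 0)"
    unfolding P_def by blast
  have "x = (\<lambda>c. \<Sum>i<r. inner_on S (q i) x * p i c)" if x: "x \<in> L" for x
  proof (rule ccontr)
    assume ne: "x \<noteq> (\<lambda>c. \<Sum>i<r. inner_on S (q i) x * p i c)"
    define y where "y = x - (\<lambda>c. \<Sum>i<r. inner_on S (q i) x * p i c)"
    have y: "y \<in> L" "y \<noteq> 0"
      unfolding y_def using ne add_subgroupD(2)[OF L x add_subgroup_sum[OF L p]] by auto
    have qy: "inner_on S (q j) y = 0" if "j < r" for j
      unfolding y_def inner_on_diff inner_on_sum using that by (simp add: qp sum_delta_mult)
    define g where "g = Gcd (y ` S)"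
    obtain c0 where "y c0 \<noteq> 0" using y(2) by (auto simp: fun_eq_iff)
    moreover from this have "c0 \<in> S" using y(1) LS by (auto simp: int_vectors_def)
    ultimately have "g \<noteq> 0" unfolding g_def by (auto simp: Gcd_0_iff)
    moreover have "g \<ge> 0" unfolding g_def by simp
    ultimately have g0: "g > 0" by simp
    define z where "z c = y c div g" for c
    have yz: "y = (\<lambda>c. g * z c)"
    proof
      fix c show "y c = g * z c"
      proof (cases "c \<in> S")
        case True
        then have "g dvd y c" unfolding g_def by (intro Gcd_dvd) auto
        then show ?thesis by (simp add: z_def)
      next
        case False
        then show ?thesis using y(1) LS by (auto simp: z_def int_vectors_def)
      qed
    qed
    have "z \<in> int_vectors S" using y(1) LS by (auto simp: z_def int_vectors_def)
    then have z: "z \<in> L"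
      using sat[unfolded saturated_in_def, rule_format, of z "nat g"] y(1) g0 yz by simp
    have qz: "inner_on S (q j) z = 0" if "j < r" for j
      using qy[OF that] g0 unfolding yz inner_on_scale by simp
    obtain u where u: "u \<in> int_vectors S" "inner_on S u y = g"
      using bezout_inner_on[OF S, of y] unfolding g_def by blast
    then have uz: "inner_on S u z = 1" using g0 unfolding yz inner_on_scale by simp
    \<comment> \<open>The correction makes the Bezout vector annihilate the old \<open>p j\<close>.
      Its value 1 on \<open>z\<close> survives because the \<open>q i\<close> annihilate
      \<open>z\<close>.\<close>
    define w where "w = u - (\<lambda>c. \<Sum>i<r. inner_on S u (p i) * q i c)"
    have w: "w \<in> int_vectors S"
      unfolding w_def
      by (intro add_subgroupD(2)[OF add_subgroup_int_vectors u(1)]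
          add_subgroup_sum[OF add_subgroup_int_vectors q])
    have wp: "inner_on S w (p j) = 0" if "j < r" for j
      unfolding w_def inner_on_diff inner_on_sum using that by (simp add: qp sum_delta_mult)
    have wz: "inner_on S w z = 1"
      unfolding w_def inner_on_diff inner_on_sum by (simp add: qz uz)
    have "P (Suc r)"
      unfolding P_def
      by (intro exI[of _ "p(r := z)"] exI[of _ "q(r := w)"])
        (auto simp: less_Suc_eq p q z w qp qz wp wz)
    then show False using r(2)[of "Suc r"] by simp
  qed
  then show thesis using that[of r p q] p q qp by blast
qed

subsection \<open>A two-sided factorisation of an integer matrix\<close>

lemma mat_apply_add: "mat_apply S T B (x + y) = mat_apply S T B x + mat_apply S T B y"
  by (auto simp: mat_apply_def fun_eq_iff algebra_simps sum.distrib)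

lemma inner_on_mat_apply:
  "inner_on S y (mat_apply S T M x) = inner_on T (mat_apply T S (\<lambda>c f. M f c) y) x"
proof -
  have "(\<Sum>f\<in>S. y f * (\<Sum>c\<in>T. M f c * x c)) = (\<Sum>c\<in>T. (\<Sum>f\<in>S. M f c * y f) * x c)"
    unfolding sum_distrib_left sum_distrib_right by (subst sum.swap) (simp add: algebra_simps)
  then show ?thesis by (simp add: inner_on_def mat_apply_def)
qed

lemma inner_on_self_eq_0:
  assumes "finite S" "x \<in> int_vectors S" "inner_on S x x = 0"
  shows "x = 0"
proof
  fix c show "x c = 0 c"
    using assms sum_nonneg_eq_0_iff[of S "\<lambda>c. x c * x c"]
    by (cases "c \<in> S") (auto simp: inner_on_def int_vectors_def)
qed

lemma int_vectors_eq_0_iff: "x \<in> int_vectors S \<Longrightarrow> x = 0 \<longleftrightarrow> (\<forall>c\<in>S. x c = 0)"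
  by (auto simp: int_vectors_def fun_eq_iff)

definition saturation :: "'b set \<Rightarrow> ('b \<Rightarrow> int) set \<Rightarrow> ('b \<Rightarrow> int) set" where
  "saturation S H = {x \<in> int_vectors S. \<exists>k::nat. 0 < k \<and> (\<lambda>c. int k * x c) \<in> H}"

lemma saturation_subset: "saturation S H \<subseteq> int_vectors S"
  by (auto simp: saturation_def)

lemma subset_saturation: "H \<subseteq> int_vectors S \<Longrightarrow> H \<subseteq> saturation S H"
  by (force simp: saturation_def intro: exI[of _ 1])

lemma add_subgroup_saturation:
  assumes "add_subgroup H"
  shows "add_subgroup (saturation S H)"
  unfolding add_subgroup_def
proof (intro conjI ballI)
  show "0 \<in> saturation S H"
    using add_subgroupD(1)[OF assms] by (auto simp: saturation_def int_vectors_def zero_fun_def)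
  fix x y assume x: "x \<in> saturation S H" and y: "y \<in> saturation S H"
  then obtain k l :: nat where kl: "0 < k" "(\<lambda>c. int k * x c) \<in> H" "0 < l" "(\<lambda>c. int l * y c) \<in> H"
    by (auto simp: saturation_def)
  have "(\<lambda>c. int (k * l) * (x - y) c) = (\<lambda>c. int l * (int k * x c)) - (\<lambda>c. int k * (int l * y c))"
    by (auto simp: algebra_simps)
  also have "\<dots> \<in> H"
    using add_subgroup_scale[OF assms kl(2)] add_subgroup_scale[OF assms kl(4)]
    by (rule add_subgroupD(2)[OF assms])
  finally have "(\<lambda>c. int (k * l) * (x - y) c) \<in> H" .
  moreover have "0 < k * l" using kl by simp
  moreover have "x - y \<in> int_vectors S"
    using x y add_subgroupD(2)[OF add_subgroup_int_vectors] by (auto simp: saturation_def)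
  ultimately show "x - y \<in> saturation S H" unfolding saturation_def by blast
qed

lemma saturated_saturation: "saturated_in S (saturation S H)"
  unfolding saturated_in_def
proof (intro ballI allI impI)
  fix x :: "'a \<Rightarrow> int" and k :: nat
  assume x: "x \<in> int_vectors S" "0 < k" "(\<lambda>c. int k * x c) \<in> saturation S H"
  then obtain l :: nat where l: "0 < l" "(\<lambda>c. int l * (int k * x c)) \<in> H" by (auto simp: saturation_def)
  then have "(\<lambda>c. int (l * k) * x c) \<in> H" by (simp add: mult.assoc)
  moreover have "0 < l * k" using l x by simp
  ultimately show "x \<in> saturation S H" using x(1) unfolding saturation_def by blast
qed

text \<open>The vectors \<open>p'\<close> form an integral left inverse of the basis, so coordinates
  are obtained by pairing. Demanding them to be integral is what ties the notion to saturated
  lattices.\<close>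

definition lattice_basis ::
  "'b set \<Rightarrow> ('b \<Rightarrow> int) set \<Rightarrow> nat \<Rightarrow> (nat \<Rightarrow> 'b \<Rightarrow> int) \<Rightarrow> (nat \<Rightarrow> 'b \<Rightarrow> int) \<Rightarrow> bool" where
  "lattice_basis S L r p p' \<longleftrightarrow>
     finite S \<and> L \<subseteq> int_vectors S \<and> (\<forall>i<r. p i \<in> L) \<and> (\<forall>i<r. p' i \<in> int_vectors S) \<and>
     (\<forall>i<r. \<forall>j<r. inner_on S (p' i) (p j) = (if i = j then 1 else 0)) \<and>
     (\<forall>x\<in>L. x = (\<lambda>c. \<Sum>i<r. inner_on S (p' i) x * p i c))"

lemma lattice_basis_exists:
  assumes "finite S" "L \<subseteq> int_vectors S" "add_subgroup L" "saturated_in S L"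
  obtains r p p' where "lattice_basis S L r p p'"
proof -
  from saturated_lattice_basis[OF assms] obtain r :: nat and p p' where
    "\<And>i. i < r \<Longrightarrow> p i \<in> L" "\<And>i. i < r \<Longrightarrow> p' i \<in> int_vectors S"
    "\<And>i j. i < r \<Longrightarrow> j < r \<Longrightarrow> inner_on S (p' i) (p j) = (if i = j then 1 else 0)"
    "\<And>x. x \<in> L \<Longrightarrow> x = (\<lambda>c. \<Sum>i<r. inner_on S (p' i) x * p i c)"
    by blast
  then have "lattice_basis S L r p p'" using assms unfolding lattice_basis_def by blast
  then show thesis by (rule that)
qed

lemma lattice_basis_coordinates:
  assumes "lattice_basis S L r p p'"
  shows "z \<in> int_vectors {..<r} \<Longrightarrow> mat_apply {..<r} S p' (mat_apply S {..<r} (\<lambda>f i. p i f) z) = z"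
    and "z \<in> int_vectors {..<r} \<Longrightarrow> mat_apply {..<r} S p (mat_apply S {..<r} (\<lambda>f i. p' i f) z) = z"
    and "x \<in> L \<Longrightarrow> mat_apply S {..<r} (\<lambda>f i. p i f) (mat_apply {..<r} S p' x) = x"
proof -
  have bi: "(\<Sum>f\<in>S. p' i f * p j f) = (if i = j then 1 else 0)" if "i < r" "j < r" for i j
    using assms that by (auto simp: lattice_basis_def inner_on_def)
  then have bi': "(\<Sum>f\<in>S. p i f * p' j f) = (if i = j then 1 else 0)" if "i < r" "j < r" for i j
    using that by (subst mult.commute) auto
  show "z \<in> int_vectors {..<r} \<Longrightarrow> mat_apply {..<r} S p' (mat_apply S {..<r} (\<lambda>f i. p i f) z) = z"
    unfolding mat_apply_mat_apply by (subst mat_apply_diagonal[where d=1]) (auto simp: bi)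
  show "z \<in> int_vectors {..<r} \<Longrightarrow> mat_apply {..<r} S p (mat_apply S {..<r} (\<lambda>f i. p' i f) z) = z"
    unfolding mat_apply_mat_apply by (subst mat_apply_diagonal[where d=1]) (auto simp: bi')
  assume x: "x \<in> L"
  then have eq: "x = (\<lambda>c. \<Sum>i<r. inner_on S (p' i) x * p i c)" and xS: "x \<in> int_vectors S"
    using assms by (auto simp: lattice_basis_def)
  show "mat_apply S {..<r} (\<lambda>f i. p i f) (mat_apply {..<r} S p' x) = x"
  proof
    fix c
    show "mat_apply S {..<r} (\<lambda>f i. p i f) (mat_apply {..<r} S p' x) c = x c"
    proof (cases "c \<in> S")
      case True
      have "(\<Sum>i<r. p i c * mat_apply {..<r} S p' x i) = (\<Sum>i<r. inner_on S (p' i) x * p i c)"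
        by (intro sum.cong refl) (simp add: mat_apply_def inner_on_def)
      also have "\<dots> = x c" using fun_cong[OF eq, of c] by simp
      finally show ?thesis using True by (simp add: mat_apply_def[of S])
    qed (use xS in \<open>simp add: mat_apply_def[of S] int_vectors_def\<close>)
  qed
qed

lemma lattice_basis_mem:
  assumes "lattice_basis S L r p p'" "add_subgroup L"
  shows "mat_apply S {..<r} (\<lambda>f i. p i f) z \<in> L"
proof -
  have "p i c = 0" if "i < r" "c \<notin> S" for i c
    using assms that by (force simp: lattice_basis_def int_vectors_def)
  then have "mat_apply S {..<r} (\<lambda>f i. p i f) z = (\<lambda>c. \<Sum>i<r. z i * p i c)"
    by (auto simp: mat_apply_def fun_eq_iff mult.commute)
  then show ?thesis
    using add_subgroup_sum[OF assms(2), of r p] assms(1) by (simp add: lattice_basis_def)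
qed

text \<open>Half of the equality of row and column rank; the transpose of \<open>M\<close> gives the
  other half. If the matrix kills \<open>z\<close>, then \<open>Q' z\<close> is a cycle and hence
  orthogonal to \<open>Q z\<close>, which has a multiple in the row lattice. By biorthogonality that
  pairing is the one of \<open>z\<close> with itself.\<close>

lemma rank_le_and_kernel:
  fixes M :: "'s \<Rightarrow> 't \<Rightarrow> int"
  assumes P: "lattice_basis S (saturation S (mat_apply S T M ` int_vectors T)) r p p'"
    and Q: "lattice_basis T (saturation T (mat_apply T S (\<lambda>c f. M f c) ` int_vectors S)) s q q'"
  shows "s \<le> r"
    and "\<lbrakk>z \<in> int_vectors {..<s};
      mat_apply {..<r} {..<s} (\<lambda>i j. inner_on S (p' i) (mat_apply S T M (q' j))) z = 0\<rbrakk> \<Longrightarrow> z = 0"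
proof -
  define t where "t i j = inner_on S (p' i) (mat_apply S T M (q' j))" for i j
  have tq: "t = (\<lambda>i j. inner_on S (p' i) (mat_apply S T M (q' j)))" by (intro ext) (simp add: t_def)
  let ?bd = "mat_apply S T M" and ?Q' = "mat_apply T {..<s} (\<lambda>c j. q' j c)"
    and ?Q = "mat_apply T {..<s} (\<lambda>c j. q j c)"
  have T: "finite T" using Q by (simp add: lattice_basis_def)
  have ker: "z = 0" if z: "z \<in> int_vectors {..<s}" and tz: "mat_apply {..<r} {..<s} t z = 0" for z
  proof -
    have "?Q' z \<in> int_vectors T" by (rule mat_apply_in_int_vectors)
    then have "?bd (?Q' z) \<in> ?bd ` int_vectors T" by blast
    moreover have "?bd ` int_vectors T \<subseteq> saturation S (?bd ` int_vectors T)"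
      by (rule subset_saturation) (auto simp: mat_apply_in_int_vectors)
    ultimately have L: "?bd (?Q' z) \<in> saturation S (?bd ` int_vectors T)" by blast
    have "mat_apply {..<r} S p' (?bd (?Q' z)) = mat_apply {..<r} {..<s} t z"
      unfolding mat_apply_mat_apply
      by (rule mat_apply_cong) (auto simp: t_def inner_on_def mat_apply_def intro!: sum.cong)
    then have "?bd (?Q' z) = 0"
      using lattice_basis_coordinates(3)[OF P L] tz by (simp add: mat_apply_0)
    moreover have "?Q z \<in> saturation T (mat_apply T S (\<lambda>c f. M f c) ` int_vectors S)"
      by (rule lattice_basis_mem[OF Q]) (intro add_subgroup_saturation add_subgroup_mat_apply_image)
    then obtain k :: nat and y where k: "0 < k" "(\<lambda>c. int k * ?Q z c) = mat_apply T S (\<lambda>c f. M f c) y"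
      by (auto simp: saturation_def)
    ultimately have "inner_on T (\<lambda>c. int k * ?Q z c) (?Q' z) = 0"
      unfolding k(2) inner_on_mat_apply[symmetric] by (simp add: inner_on_def)
    then have "inner_on T (?Q z) (?Q' z) = 0" using k(1) by (simp add: inner_on_scale)
    also have "inner_on T (?Q z) (?Q' z) = inner_on {..<s} (mat_apply {..<s} T q' (?Q z)) z"
      by (rule inner_on_mat_apply)
    also have "\<dots> = inner_on {..<s} z z" by (simp add: lattice_basis_coordinates(1)[OF Q z])
    finally show "z = 0" by (intro inner_on_self_eq_0[OF _ z]) auto
  qed
  show "\<lbrakk>z \<in> int_vectors {..<s};
      mat_apply {..<r} {..<s} (\<lambda>i j. inner_on S (p' i) (mat_apply S T M (q' j))) z = 0\<rbrakk> \<Longrightarrow> z = 0"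
    by (rule ker[unfolded tq])
  show "s \<le> r"
  proof (rule ccontr)
    assume "\<not> s \<le> r"
    then have rs: "r < s" by simp
    \<comment> \<open>Padding with zero rows gives a square matrix, which is singular because row
      \<open>r\<close> vanishes.\<close>
    define u where "u i j = (if i < r then t i j else 0)" for i j
    have "sq_apply s u (\<lambda>_. 0) = (\<lambda>_. 0)" by (rule mat_apply_0)
    have "sq_det s u = 0"
    proof -
      have "sq_det s (\<lambda>i j. u j i) = 0"
      proof (rule ccontr)
        assume nz: "sq_det s (\<lambda>i j. u j i) \<noteq> 0"
        \<comment> \<open>In the transpose the zero row is column \<open>r\<close>, so the unit
          vector at \<open>r\<close> lies in the kernel.\<close>
        let ?e = "\<lambda>j. if j = r then 1 else 0 :: int"
        have "(\<Sum>j<s. u j i * ?e j) = 0" for i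
          by (rule sum.neutral) (simp add: u_def)
        then have ue: "sq_apply s (\<lambda>i j. u j i) ?e = 0"
          unfolding mat_apply_def by (simp add: fun_eq_iff)
        have "?e \<in> int_vectors {..<s}" using rs by (simp add: int_vectors_def)
        then have "?e = 0" using ue by (rule sq_det_nonzero_imp_inj[OF nz])
        from fun_cong[OF this, of r] show False by simp
      qed
      then show ?thesis by (simp add: sq_det_transpose[of s u])
    qed
    then obtain x where x: "x \<in> int_vectors {..<s}" "x \<noteq> 0" "sq_apply s u x = 0"
      by (rule sq_det_eq_0_imp_kernel)
    have "mat_apply {..<r} {..<s} t x = 0"
    proof
      fix i show "mat_apply {..<r} {..<s} t x i = 0 i"
        using fun_cong[OF x(3), of i] rs by (auto simp: mat_apply_def u_def)
    qed
    then show False using ker x by blast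
  qed
qed

locale matrix_bases =
  fixes S :: "'s set" and T :: "'t set" and M :: "'s \<Rightarrow> 't \<Rightarrow> int" and r :: nat
    and p p' :: "nat \<Rightarrow> 's \<Rightarrow> int" and q q' :: "nat \<Rightarrow> 't \<Rightarrow> int"
  assumes P: "lattice_basis S (saturation S (mat_apply S T M ` int_vectors T)) r p p'"
    and Q: "lattice_basis T (saturation T (mat_apply T S (\<lambda>c f. M f c) ` int_vectors S)) r q q'"

lemma matrix_bases_exist:
  fixes M :: "'s \<Rightarrow> 't \<Rightarrow> int"
  assumes "finite S" "finite T"
  obtains r p p' q q' where "matrix_bases S T M r p p' q q'"
proof -
  let ?L = "saturation S (mat_apply S T M ` int_vectors T)"
    and ?C = "saturation T (mat_apply T S (\<lambda>c f. M f c) ` int_vectors S)"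
  obtain r p p' where P: "lattice_basis S ?L r p p'"
    by (rule lattice_basis_exists[OF assms(1) saturation_subset
          add_subgroup_saturation[OF add_subgroup_mat_apply_image] saturated_saturation])
  obtain s q q' where Q: "lattice_basis T ?C s q q'"
    by (rule lattice_basis_exists[OF assms(2) saturation_subset
          add_subgroup_saturation[OF add_subgroup_mat_apply_image] saturated_saturation])
  have "s = r" using rank_le_and_kernel(1)[OF P Q] rank_le_and_kernel(1)[of T S "\<lambda>c f. M f c", OF Q P] by simp
  then have "matrix_bases S T M r p p' q q'" using P Q by (simp add: matrix_bases_def)
  then show thesis by (rule that)
qed

section \<open>The factorisation of \<open>M\<close> and its kernels\<close>

context matrix_bases
begin

lemma dual: "matrix_bases T S (\<lambda>c f. M f c) r q q' p p'"
  using P Q by (simp add: matrix_bases_def)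

lemma finite_S: "finite S" and finite_T: "finite T"
  using P Q by (auto simp: lattice_basis_def)

text \<open>Suffixes \<open>m\<close> and \<open>t\<close> mark the matrices with columns \<open>p i\<close>, \<open>p' i\<close>, \<open>q i\<close>, \<open>q' i\<close> and their
  transposes. The structure exploited below is \<open>M = P t Q\<^sup>T\<close> with \<open>P'\<^sup>T P = Q'\<^sup>T Q = 1\<close> and \<open>det t \<noteq> 0\<close>,
  a substitute for the Smith normal form.\<close>

abbreviation bd where "bd \<equiv> mat_apply S T M"
abbreviation cobd where "cobd \<equiv> mat_apply T S (\<lambda>c f. M f c)"
abbreviation "coords \<equiv> int_vectors {..<r}"
abbreviation "Pm \<equiv> mat_apply S {..<r} (\<lambda>f i. p i f)"
abbreviation "Pt \<equiv> mat_apply {..<r} S p"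
abbreviation "P't \<equiv> mat_apply {..<r} S p'"
abbreviation "P'm \<equiv> mat_apply S {..<r} (\<lambda>f i. p' i f)"
abbreviation "Qm \<equiv> mat_apply T {..<r} (\<lambda>c i. q i c)"
abbreviation "Qt \<equiv> mat_apply {..<r} T q"
abbreviation "Q't \<equiv> mat_apply {..<r} T q'"
abbreviation "Q'm \<equiv> mat_apply T {..<r} (\<lambda>c i. q' i c)"
abbreviation "L \<equiv> saturation S (bd ` int_vectors T)"
abbreviation "C' \<equiv> saturation T (cobd ` int_vectors S)"
abbreviation "F \<equiv> {x \<in> int_vectors T. bd x = 0}"

definition "t i j = inner_on S (p' i) (bd (q' j))"
definition "G i j = (\<Sum>c\<in>T. q i c * q j c)"

lemmas P_coords = lattice_basis_coordinates[OF P]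
lemmas Q_coords = lattice_basis_coordinates[OF Q]

lemma subgroup_L: "add_subgroup L" and subgroup_C': "add_subgroup C'"
  by (intro add_subgroup_saturation add_subgroup_mat_apply_image)+

lemma Pm_mem: "Pm z \<in> L" and Qm_mem: "Qm z \<in> C'"
  using lattice_basis_mem[OF P subgroup_L] lattice_basis_mem[OF Q subgroup_C'] by auto

lemma bd_mem: "x \<in> int_vectors T \<Longrightarrow> bd x \<in> L"
  by (rule subsetD[OF subset_saturation]) (auto simp: mat_apply_in_int_vectors)

lemma cobd_mem: "y \<in> int_vectors S \<Longrightarrow> cobd y \<in> C'"
  by (rule subsetD[OF subset_saturation]) (auto simp: mat_apply_in_int_vectors)

lemma Qt_eq_0_imp_orthogonal:
  assumes "x \<in> C'" "Qt w = 0"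
  shows "inner_on T x w = 0"
proof -
  have "inner_on T x w = inner_on T (Qm (Q't x)) w" by (simp add: Q_coords(3)[OF assms(1)])
  also have "\<dots> = inner_on {..<r} (Q't x) (Qt w)" by (simp add: inner_on_mat_apply)
  finally show ?thesis using assms(2) by (simp add: inner_on_def)
qed

text \<open>The coboundary of a unit vector is a row of \<open>M\<close>, so an entry of
  \<open>bd w\<close> is the pairing of \<open>w\<close> with a vector of the row lattice.\<close>

lemma Qt_eq_0_imp_bd_eq_0:
  assumes "Qt w = 0"
  shows "bd w = 0"
proof -
  have "bd w f = 0" if f: "f \<in> S" for f
  proof -
    let ?e = "\<lambda>g. if g = f then 1 else 0 :: int"
    have "?e \<in> int_vectors S" using f by (auto simp: int_vectors_def)
    then have "inner_on T (cobd ?e) w = 0" by (intro Qt_eq_0_imp_orthogonal cobd_mem assms)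
    then have "inner_on S ?e (bd w) = 0" by (simp add: inner_on_mat_apply)
    then show ?thesis using f finite_S
      by (simp add: inner_on_def if_distrib[of "\<lambda>u. u * _"] cong: if_cong)
  qed
  then show ?thesis by (auto simp: mat_apply_def fun_eq_iff)
qed

text \<open>\<open>x\<close> and \<open>Q'm (Qt x)\<close> have the same image under
  \<open>Qt\<close>, hence the same boundary, and \<open>t\<close> is the matrix of
  \<open>bd\<close> from the dual vectors \<open>q'\<close> to coordinates along
  \<open>p\<close>.\<close>

lemma bd_factor:
  assumes "x \<in> int_vectors T"
  shows "bd x = Pm (sq_apply r t (Qt x))"
proof -
  have Qc: "Qt x \<in> coords" by (rule mat_apply_in_int_vectors)
  have "Qt (x - Q'm (Qt x)) = 0" unfolding mat_apply_diff by (simp add: Q_coords(2)[OF Qc])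
  from Qt_eq_0_imp_bd_eq_0[OF this] have eq: "bd x = bd (Q'm (Qt x))" by (simp add: mat_apply_diff)
  have "P't (bd (Q'm z)) = sq_apply r t z" for z
    unfolding mat_apply_mat_apply
    by (rule mat_apply_cong) (auto simp: t_def inner_on_def mat_apply_def intro!: sum.cong)
  then have "Pm (sq_apply r t (Qt x)) = Pm (P't (bd x))" by (simp add: eq)
  then show ?thesis by (simp add: P_coords(3)[OF bd_mem[OF assms]])
qed

text \<open>This is \<open>bd_factor\<close> for the transposed matrix, where the transpose of
  \<open>t\<close> takes the place of \<open>t\<close>.\<close>

lemma cobd_factor:
  assumes "y \<in> int_vectors S"
  shows "cobd y = Qm (sq_apply r (\<lambda>i j. t j i) (Pt y))"
proof -
  interpret D: matrix_bases T S "\<lambda>c f. M f c" r q q' p p' by (rule dual)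
  have "D.t i j = t j i" for i j
    unfolding D.t_def t_def inner_on_mat_apply[of T "q' i" S "\<lambda>c f. M f c"]
    by (rule inner_on_commute)
  then have "D.t = (\<lambda>i j. t j i)" by (intro ext)
  then show ?thesis using D.bd_factor[OF assms] by simp
qed

lemma det_t: "sq_det r t \<noteq> 0"
proof
  assume "sq_det r t = 0"
  then obtain x where "x \<in> coords" "x \<noteq> 0" "sq_apply r t x = 0"
    by (rule sq_det_eq_0_imp_kernel)
  then show False using rank_le_and_kernel(2)[OF P Q, of x] unfolding t_def by blast
qed

lemma Pm_eq_0: "z \<in> coords \<Longrightarrow> Pm z = 0 \<Longrightarrow> z = 0"
  using P_coords(1)[of z] by (simp add: mat_apply_0)

lemma Qm_eq_0: "z \<in> coords \<Longrightarrow> Qm z = 0 \<Longrightarrow> z = 0"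
  using Q_coords(1)[of z] by (simp add: mat_apply_0)

lemma bd_eq_0_iff:
  assumes "x \<in> int_vectors T"
  shows "bd x = 0 \<longleftrightarrow> Qt x = 0"
proof
  assume "bd x = 0"
  then have "sq_apply r t (Qt x) = 0"
    using bd_factor[OF assms] by (intro Pm_eq_0 mat_apply_in_int_vectors) simp
  then show "Qt x = 0" by (rule sq_det_nonzero_imp_inj[OF det_t mat_apply_in_int_vectors])
qed (rule Qt_eq_0_imp_bd_eq_0)

lemma Qt_Qm: "Qt (Qm z) = sq_apply r G z"
  unfolding mat_apply_mat_apply G_def ..

text \<open>A kernel vector \<open>x\<close> of the Gram matrix makes \<open>Qm x\<close> a vector
  of length zero.\<close>

lemma det_G: "sq_det r G \<noteq> 0"
proof
  assume "sq_det r G = 0"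
  then obtain x where x: "x \<in> coords" "x \<noteq> 0" "sq_apply r G x = 0"
    by (rule sq_det_eq_0_imp_kernel)
  have "inner_on T (Qm x) (Qm x) = inner_on {..<r} x (Qt (Qm x))" by (simp add: inner_on_mat_apply)
  also have "\<dots> = 0" unfolding Qt_Qm x(3) by (simp add: inner_on_def)
  finally have "Qm x = 0" by (intro inner_on_self_eq_0[OF finite_T mat_apply_in_int_vectors])
  then show False using Qm_eq_0 x by blast
qed

text \<open>A unit vector minus its image under \<open>Q'm\<close> after \<open>Qt\<close> is a
  flow, and orthogonality to this flow says that \<open>x\<close> and \<open>Qm (Q't x)\<close>
  agree in that entry. So \<open>C'\<close> is the whole orthogonal complement of
  \<open>F\<close>.\<close>

lemma orthogonal_imp_mem_C':
  assumes "x \<in> int_vectors T" "\<And>w. w \<in> F \<Longrightarrow> inner_on T x w = 0"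
  shows "x \<in> C'"
proof -
  have "x = Qm (Q't x)"
  proof
    fix c show "x c = Qm (Q't x) c"
    proof (cases "c \<in> T")
      case True
      let ?e = "\<lambda>d. if d = c then 1 else 0 :: int"
      have e: "?e \<in> int_vectors T" using True by (auto simp: int_vectors_def)
      let ?w = "?e - Q'm (Qt ?e)"
      have w: "?w \<in> int_vectors T"
        by (rule add_subgroupD(2)[OF add_subgroup_int_vectors e mat_apply_in_int_vectors])
      have "Qt ?w = 0" unfolding mat_apply_diff by (simp add: Q_coords(2)[OF mat_apply_in_int_vectors])
      then have "?w \<in> F" using w Qt_eq_0_imp_bd_eq_0 by blast
      then have "inner_on T x ?e = inner_on T x (Q'm (Qt ?e))"
        using assms(2)[of ?w] by (simp add: inner_on_diff)
      also have "\<dots> = inner_on T (Qm (Q't x)) ?e" by (simp add: inner_on_mat_apply)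
      finally show ?thesis using True finite_T
        by (simp add: inner_on_def if_distrib[of "(*) _"] cong: if_cong)
    qed (use assms(1) in \<open>simp add: int_vectors_def mat_apply_def[of T]\<close>)
  qed
  then show ?thesis using Qm_mem by metis
qed

text \<open>The common pattern of the index computations: transfer to coordinates, then evaluate a
  determinant.\<close>

lemma index_by_coordinates:
  fixes h :: "'g::ab_group_add \<Rightarrow> nat \<Rightarrow> int"
  assumes "add_subgroup A" "add_subgroup H" "H \<subseteq> A"
    and "\<And>x y. x \<in> A \<Longrightarrow> y \<in> A \<Longrightarrow> h (x - y) = h x - h y"
    and "\<And>x. x \<in> A \<Longrightarrow> h x = 0 \<Longrightarrow> x \<in> H"
    and "h ` A = coords" "h ` H = sq_apply r B ` coords" "sq_det r B \<noteq> 0"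
  shows "lattice_index A H = nat \<bar>sq_det r B\<bar>"
  by (rule trans[OF lattice_index_transfer[OF assms(1-7)] lattice_index_sq_det[OF assms(8)]])

section \<open>Lattice indices in coordinates\<close>

lemma Qt_surj: "Qt ` int_vectors T = coords" and Pt_surj: "Pt ` int_vectors S = coords"
proof -
  show "Qt ` int_vectors T = coords"
  proof (intro equalityI subsetI)
    fix z assume "z \<in> coords"
    then have "z = Qt (Q'm z)" by (simp add: Q_coords(2))
    then show "z \<in> Qt ` int_vectors T" using mat_apply_in_int_vectors by blast
  qed (auto simp: mat_apply_in_int_vectors)
  show "Pt ` int_vectors S = coords"
  proof (intro equalityI subsetI)
    fix z assume "z \<in> coords"
    then have "z = Pt (P'm z)" by (simp add: P_coords(2))
    then show "z \<in> Pt ` int_vectors S" using mat_apply_in_int_vectors by blast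
  qed (auto simp: mat_apply_in_int_vectors)
qed

lemma P't_surj: "P't ` L = coords"
proof (intro equalityI subsetI)
  fix z assume "z \<in> coords"
  then have "z = P't (Pm z)" by (simp add: P_coords(1))
  then show "z \<in> P't ` L" using Pm_mem by blast
qed (auto simp: mat_apply_in_int_vectors)

lemma index_L_bd: "lattice_index L (bd ` int_vectors T) = nat \<bar>sq_det r t\<bar>"
proof (rule index_by_coordinates[where h = P't])
  show "P't ` bd ` int_vectors T = sq_apply r t ` coords"
    unfolding image_image Qt_surj[symmetric]
    by (intro image_cong refl) (simp add: bd_factor P_coords(1) mat_apply_in_int_vectors)
  show "x \<in> bd ` int_vectors T" if "x \<in> L" "P't x = 0" for x
    using P_coords(3)[OF that(1)] that(2) add_subgroupD(1)[OF add_subgroup_mat_apply_image]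
    by (metis mat_apply_0(2))
qed (auto simp: subgroup_L add_subgroup_mat_apply_image bd_mem mat_apply_diff P't_surj det_t)

text \<open>The product of \<open>t\<close>, \<open>G\<close> and the transpose of \<open>t\<close>:
  the Laplacian \<open>bd (cobd y)\<close> in coordinates.\<close>

abbreviation "TG \<equiv> \<lambda>i k. \<Sum>l<r. t i l * (\<Sum>j<r. G l j * t k j)"

lemma det_TG: "sq_det r TG = (sq_det r t)\<^sup>2 * sq_det r G"
proof -
  have "sq_det r TG = sq_det r t * (sq_det r G * sq_det r (\<lambda>j k. t k j))"
    unfolding sq_det_mult[of r t "\<lambda>l k. \<Sum>j<r. G l j * t k j"] sq_det_mult[of r G "\<lambda>j k. t k j"] ..
  then show ?thesis unfolding sq_det_transpose[of r t] by (simp add: power2_eq_square)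
qed

lemma bd_cobd: "y \<in> int_vectors S \<Longrightarrow> bd (cobd y) = Pm (sq_apply r TG (Pt y))"
  by (simp only: bd_factor mat_apply_in_int_vectors cobd_factor Qt_Qm
      mat_apply_mat_apply[of "{..<r}" "{..<r}" _ "{..<r}"])

lemma index_L_bd_cobd:
  "lattice_index L ((\<lambda>y. bd (cobd y)) ` int_vectors S) = nat ((sq_det r t)\<^sup>2 * \<bar>sq_det r G\<bar>)"
proof -
  have "lattice_index L ((\<lambda>y. bd (cobd y)) ` int_vectors S) = nat \<bar>sq_det r TG\<bar>"
  proof (rule index_by_coordinates[where h = P't])
    show sg: "add_subgroup ((\<lambda>y. bd (cobd y)) ` int_vectors S)"
      by (intro add_subgroup_image add_subgroup_int_vectors) (simp add: mat_apply_diff)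
    show "P't ` (\<lambda>y. bd (cobd y)) ` int_vectors S = sq_apply r TG ` coords"
      unfolding image_image Pt_surj[symmetric]
      by (intro image_cong refl) (simp only: bd_cobd P_coords(1) mat_apply_in_int_vectors)
    show "x \<in> (\<lambda>y. bd (cobd y)) ` int_vectors S" if "x \<in> L" "P't x = 0" for x
      using P_coords(3)[OF that(1)] that(2) add_subgroupD(1)[OF sg] by (metis mat_apply_0(2))
    show "sq_det r TG \<noteq> 0" unfolding det_TG using det_t det_G by simp
  qed (auto simp: subgroup_L bd_mem mat_apply_diff P't_surj mat_apply_in_int_vectors)
  then show ?thesis unfolding det_TG by (simp add: abs_mult)
qed

text \<open>Identifies the numerator of the critical group, which is a torsion part. The determinant
  of \<open>TG\<close> is nonzero, so a multiple of every vector of \<open>L\<close> lies in the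
  image of the Laplacian.\<close>

lemma saturation_bd_cobd: "saturation S ((\<lambda>y. bd (cobd y)) ` int_vectors S) = L"
proof (intro equalityI subsetI)
  fix x assume "x \<in> saturation S ((\<lambda>y. bd (cobd y)) ` int_vectors S)"
  then show "x \<in> L" using mat_apply_in_int_vectors unfolding saturation_def by blast
next
  fix x assume x: "x \<in> L"
  have "sq_det r TG \<noteq> 0" unfolding det_TG using det_t det_G by simp
  then obtain k :: nat where k: "0 < k" "\<And>a. a \<in> coords \<Longrightarrow> \<exists>z\<in>coords. sq_apply r TG z = (\<lambda>i. int k * a i)"
    by (rule sq_det_nonzero_multiple) blast
  obtain z where z: "z \<in> coords" "sq_apply r TG z = (\<lambda>i. int k * P't x i)"
    using k(2)[OF mat_apply_in_int_vectors] by blast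
  have y: "P'm z \<in> int_vectors S" by (rule mat_apply_in_int_vectors)
  have "bd (cobd (P'm z)) = Pm (\<lambda>i. int k * P't x i)"
    unfolding bd_cobd[OF y] P_coords(2)[OF z(1)] z(2) ..
  also have "\<dots> = (\<lambda>c. int k * Pm (P't x) c)" by (rule mat_apply_scale)
  finally have "(\<lambda>c. int k * x c) = bd (cobd (P'm z))" by (simp add: P_coords(3)[OF x])
  moreover have "x \<in> int_vectors S" using x saturation_subset by blast
  ultimately show "x \<in> saturation S ((\<lambda>y. bd (cobd y)) ` int_vectors S)"
    using y k(1) unfolding saturation_def by blast
qed

lemma subgroup_F: "add_subgroup F"
  using add_subgroupD[OF add_subgroup_int_vectors[of T]]
  by (auto simp: add_subgroup_def mat_apply_diff mat_apply_0)

lemma subgroup_sum: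
  assumes "add_subgroup A" "add_subgroup B"
  shows "add_subgroup {x + y | x y. x \<in> A \<and> y \<in> B}"
  unfolding add_subgroup_def
proof (intro conjI ballI)
  show "0 \<in> {x + y | x y. x \<in> A \<and> y \<in> B}"
    using add_subgroupD(1)[OF assms(1)] add_subgroupD(1)[OF assms(2)] by force
  fix u v assume "u \<in> {x + y | x y. x \<in> A \<and> y \<in> B}" "v \<in> {x + y | x y. x \<in> A \<and> y \<in> B}"
  then obtain a b a' b' where ab: "u = a + b" "v = a' + b'" "a \<in> A" "a' \<in> A" "b \<in> B" "b' \<in> B" by blast
  then have "u - v = (a - a') + (b - b')" "a - a' \<in> A" "b - b' \<in> B"
    using add_subgroupD(2)[OF assms(1)] add_subgroupD(2)[OF assms(2)] by auto
  then show "u - v \<in> {x + y | x y. x \<in> A \<and> y \<in> B}" by blast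
qed

text \<open>On \<open>int_vectors T\<close> the kernel of \<open>Qt\<close> is \<open>F\<close>.
  Adding \<open>F\<close> to \<open>A\<close> therefore absorbs the kernel and leaves the image
  unchanged.\<close>

lemma index_sum_F:
  assumes A: "add_subgroup A" "A \<subseteq> int_vectors T"
    and im: "Qt ` A = sq_apply r B ` coords" and B: "sq_det r B \<noteq> 0"
  shows "lattice_index (int_vectors T) {x + y | x y. x \<in> A \<and> y \<in> F} = nat \<bar>sq_det r B\<bar>"
proof (rule index_by_coordinates[where h = Qt])
  show "x \<in> {x + y | x y. x \<in> A \<and> y \<in> F}" if "x \<in> int_vectors T" "Qt x = 0" for x
    using that Qt_eq_0_imp_bd_eq_0 add_subgroupD(1)[OF A(1)] by force
  show "Qt ` {x + y | x y. x \<in> A \<and> y \<in> F} = sq_apply r B ` coords"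
  proof -
    have "Qt (x + y) = Qt x" if "y \<in> F" for x y
      using that bd_eq_0_iff by (auto simp: mat_apply_add)
    then have "Qt ` {x + y | x y. x \<in> A \<and> y \<in> F} \<subseteq> Qt ` A" by auto
    moreover have "Qt ` A \<subseteq> Qt ` {x + y | x y. x \<in> A \<and> y \<in> F}"
    proof (rule image_mono, rule subsetI)
      fix x assume "x \<in> A"
      then show "x \<in> {x + y | x y. x \<in> A \<and> y \<in> F}"
        using add_subgroupD(1)[OF subgroup_F]
        by (intro CollectI exI[of _ x] exI[of _ 0]) simp_all
    qed
    ultimately have "Qt ` {x + y | x y. x \<in> A \<and> y \<in> F} = Qt ` A" by (rule equalityI)
    then show ?thesis unfolding im .
  qed
  show "{x + y | x y. x \<in> A \<and> y \<in> F} \<subseteq> int_vectors T"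
    using A(2) add_subgroupD(4)[OF add_subgroup_int_vectors[of T]] by blast
  show "add_subgroup {x + y | x y. x \<in> A \<and> y \<in> F}"
    by (rule subgroup_sum[OF A(1) subgroup_F])
qed (simp_all add: add_subgroup_int_vectors mat_apply_diff Qt_surj B)

lemma index_cut_flow:
  "lattice_index (int_vectors T) {x + y | x y. x \<in> cobd ` int_vectors S \<and> y \<in> F}
    = nat (\<bar>sq_det r t\<bar> * \<bar>sq_det r G\<bar>)"
proof -
  let ?B = "\<lambda>i k. \<Sum>j<r. G i j * t k j"
  have det: "sq_det r ?B = sq_det r G * sq_det r t"
    unfolding sq_det_mult[of r G "\<lambda>j k. t k j"] sq_det_transpose[of r t] ..
  have "lattice_index (int_vectors T) {x + y | x y. x \<in> cobd ` int_vectors S \<and> y \<in> F} = nat \<bar>sq_det r ?B\<bar>"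
  proof (rule index_sum_F)
    show "Qt ` cobd ` int_vectors S = sq_apply r ?B ` coords"
      unfolding image_image Pt_surj[symmetric]
      by (intro image_cong refl) (simp add: cobd_factor Qt_Qm mat_apply_mat_apply[of "{..<r}" "{..<r}" G "{..<r}"])
    show "sq_det r ?B \<noteq> 0" unfolding det using det_t det_G by simp
  qed (auto simp: add_subgroup_mat_apply_image mat_apply_in_int_vectors)
  then show ?thesis unfolding det by (simp add: abs_mult mult.commute)
qed

text \<open>The quotient is evaluated once more, from the side of the flows, in
  \<open>index_gram_flow_basis\<close>.\<close>

lemma index_saturated_cut_flow:
  "lattice_index (int_vectors T) {x + y | x y. x \<in> C' \<and> y \<in> F} = nat \<bar>sq_det r G\<bar>"
proof (rule index_sum_F)
  show "Qt ` C' = sq_apply r G ` coords"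
  proof (intro equalityI subsetI)
    fix z assume "z \<in> Qt ` C'"
    then obtain x where "x \<in> C'" "z = Qt x" by blast
    then have "z = Qt (Qm (Q't x))" by (simp only: Q_coords(3))
    then have "z = sq_apply r G (Q't x)" unfolding Qt_Qm .
    then show "z \<in> sq_apply r G ` coords" using mat_apply_in_int_vectors by blast
  next
    fix z assume "z \<in> sq_apply r G ` coords"
    then obtain w where "z = Qt (Qm w)" unfolding Qt_Qm by blast
    then show "z \<in> Qt ` C'" using Qm_mem by blast
  qed
qed (auto simp: subgroup_C' det_G dest: saturation_subset[THEN subsetD])

end

subsection \<open>Discriminant groups\<close>

interpretation real_fun: vector_space fun_scale
  by unfold_locales (auto simp: fun_scale_def fun_eq_iff algebra_simps)

lemma real_vectors_mem: "x \<in> A \<Longrightarrow> (\<lambda>c. real_of_int (x c)) \<in> real_vectors A"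
  by (auto simp: real_vectors_def)

lemma add_subgroup_real_vectors:
  assumes "add_subgroup A"
  shows "add_subgroup (real_vectors A)"
  unfolding real_vectors_def
  by (rule add_subgroup_image[OF assms]) (auto simp: fun_eq_iff)

lemma lattice_index_real_vectors:
  assumes "add_subgroup A" "add_subgroup H" "H \<subseteq> A"
  shows "lattice_index (real_vectors A) (real_vectors H) = lattice_index A H"
proof (rule lattice_index_transfer[symmetric, OF assms, where h = "\<lambda>v c. real_of_int (v c)"])
  fix x :: "'a \<Rightarrow> int" assume "(\<lambda>c. real_of_int (x c)) = 0"
  then have "x c = 0" for c by (metis of_int_eq_0_iff zero_fun_apply)
  then have "x = 0" by auto
  then show "x \<in> H" using add_subgroupD(1)[OF assms(2)] by simp
qed (auto simp: real_vectors_def fun_eq_iff)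

text \<open>For a basis matrix \<open>R\<close> of \<Lambda>, pairing with the basis identifies the
  dual lattice with the integral vectors, and \<Lambda> itself with the column lattice of the Gram
  matrix of \<open>R\<close>.\<close>

theorem order_discriminant_group:
  fixes R :: "'t \<Rightarrow> nat \<Rightarrow> int"
  assumes T: "finite T"
    and inj: "\<And>z. z \<in> int_vectors {..<r} \<Longrightarrow> mat_apply T {..<r} R z = 0 \<Longrightarrow> z = 0"
    and \<Lambda>: "\<Lambda> = mat_apply T {..<r} R ` int_vectors {..<r}"
  shows "order (discriminant_group T \<Lambda>) =
    lattice_index (int_vectors {..<r}) ((\<lambda>x. mat_apply {..<r} T (\<lambda>n c. R c n) (mat_apply T {..<r} R x)) ` int_vectors {..<r})"
proof -
  let ?Rt = "mat_apply {..<r} T (\<lambda>n c. R c n)" and ?R = "mat_apply T {..<r} R"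
  define h where "h = mat_apply {..<r} T (\<lambda>n c. real_of_int (R c n))"
  define rl where "rl x = (\<lambda>c. real_of_int (x c))" for x :: "'t \<Rightarrow> int"
  let ?A = "dual_lattice T \<Lambda>" and ?H = "real_vectors \<Lambda>"
  have sub\<Lambda>: "add_subgroup \<Lambda>" unfolding \<Lambda> by (rule add_subgroup_mat_apply_image)
  have hrl: "h (rl x) = (\<lambda>n. real_of_int (?Rt x n))" for x
    by (auto simp: h_def rl_def mat_apply_def)
  have H: "add_subgroup ?H" by (rule add_subgroup_real_vectors[OF sub\<Lambda>])
  have A: "add_subgroup ?A"
    unfolding add_subgroup_def
  proof (intro conjI ballI)
    show "0 \<in> ?A" by (auto simp: dual_lattice_def real_fun.span_zero)
    fix x y assume "x \<in> ?A" "y \<in> ?A"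
    then show "x - y \<in> ?A"
      by (auto simp: dual_lattice_def real_fun.span_diff left_diff_distrib sum_subtractf)
  qed
  have HA: "?H \<subseteq> ?A"
  proof
    fix v assume v: "v \<in> ?H"
    have "(\<Sum>c\<in>T. v c * w c) \<in> \<int>" if "w \<in> ?H" for w
      using v that by (auto simp: real_vectors_def intro!: Ints_sum Ints_mult)
    then show "v \<in> ?A" using v by (auto simp: dual_lattice_def real_fun.span_base)
  qed
  have pairing: "(\<Sum>c\<in>T. v c * rl (?R y) c) = (\<Sum>n\<in>{..<r}. h v n * real_of_int (y n))" for v y
  proof -
    have "(\<Sum>c\<in>T. v c * rl (?R y) c) = (\<Sum>c\<in>T. \<Sum>n\<in>{..<r}. real_of_int (R c n) * v c * real_of_int (y n))"
      by (auto simp: rl_def mat_apply_def sum_distrib_left algebra_simps intro!: sum.cong)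
    also have "\<dots> = (\<Sum>n\<in>{..<r}. h v n * real_of_int (y n))"
      by (subst sum.swap) (auto simp: h_def mat_apply_def sum_distrib_right intro!: sum.cong)
    finally show ?thesis .
  qed
  have supp: "v c = 0" if "v \<in> real_fun.span ?H" "c \<notin> T" for v c
    using that(1)
  proof (induction rule: real_fun.span_induct_alt)
    case (step a x y)
    then show ?case using that(2) by (auto simp: real_vectors_def \<Lambda> mat_apply_def fun_scale_def)
  qed simp
  \<comment> \<open>A vector of the real span that is orthogonal to the lattice is orthogonal to the
    span, hence to itself.\<close>
  have hinj: "v = 0" if v: "v \<in> ?A" and hv: "h v = 0" for v
  proof -
    have sp: "v \<in> real_fun.span ?H" using v by (simp add: dual_lattice_def)
    have orth: "(\<Sum>c\<in>T. v c * w c) = 0" if "w \<in> ?H" for w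
      using that pairing[of v] hv by (auto simp: real_vectors_def \<Lambda> rl_def)
    have "(\<Sum>c\<in>T. v c * w c) = 0" if "w \<in> real_fun.span ?H" for w
      using that
    proof (induction rule: real_fun.span_induct_alt)
      case (step a x y)
      have "(\<Sum>c\<in>T. v c * (fun_scale a x + y) c) = a * (\<Sum>c\<in>T. v c * x c) + (\<Sum>c\<in>T. v c * y c)"
        by (simp add: fun_scale_def algebra_simps sum.distrib sum_distrib_left)
      then show ?case using step orth by simp
    qed simp
    from this[OF sp] have "\<forall>c\<in>T. v c * v c = 0"
      using sum_nonneg_eq_0_iff[OF T, of "\<lambda>c. v c * v c"] by simp
    then show "v = 0" using supp[OF sp] by (auto simp: fun_eq_iff)
  qed
  have img: "h ` ?A = real_vectors (int_vectors {..<r})"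
  proof (intro equalityI subsetI)
    fix w assume "w \<in> h ` ?A"
    then obtain v where v: "v \<in> ?A" "w = h v" by blast
    have int: "w n \<in> \<int>" for n
    proof (cases "n \<in> {..<r}")
      case True
      \<comment> \<open>Pairing with the \<open>n\<close>-th basis vector reads off entry
        \<open>n\<close> of \<open>h v\<close>.\<close>
      let ?e = "\<lambda>m. if m = n then 1 else 0 :: int"
      have "?e \<in> int_vectors {..<r}" using True by (auto simp: int_vectors_def)
      then have "rl (?R ?e) \<in> ?H" unfolding rl_def \<Lambda> by (intro real_vectors_mem imageI)
      then have "(\<Sum>c\<in>T. v c * rl (?R ?e) c) \<in> \<int>" using v(1) by (auto simp: dual_lattice_def)
      moreover have "(\<Sum>m\<in>{..<r}. h v m * real_of_int (?e m)) = h v n"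
        using True by (simp add: if_distrib[of real_of_int] if_distrib[of "(*) _"] cong: if_cong)
      ultimately show ?thesis using v(2) pairing by simp
    qed (simp add: v h_def mat_apply_def)
    have "w = (\<lambda>n. real_of_int \<lfloor>w n\<rfloor>)" using int by (auto simp: of_int_floor)
    moreover have "(\<lambda>n. \<lfloor>w n\<rfloor>) \<in> int_vectors {..<r}" by (auto simp: int_vectors_def v h_def mat_apply_def)
    ultimately show "w \<in> real_vectors (int_vectors {..<r})" unfolding real_vectors_def by (rule image_eqI)
  next
    fix w assume "w \<in> real_vectors (int_vectors {..<r})"
    then obtain a where a: "a \<in> int_vectors {..<r}" "w = (\<lambda>n. real_of_int (a n))"
      by (auto simp: real_vectors_def)
    have comp: "sq_apply r (\<lambda>i k. \<Sum>j\<in>T. R j i * R j k) z = ?Rt (?R z)" for z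
      unfolding mat_apply_mat_apply ..
    have gram_inj: "z = 0" if "z \<in> int_vectors {..<r}" "sq_apply r (\<lambda>i k. \<Sum>j\<in>T. R j i * R j k) z = 0" for z
    proof -
      have "inner_on T (?R z) (?R z) = inner_on {..<r} (?Rt (?R z)) z" by (rule inner_on_mat_apply)
      also have "\<dots> = 0" using that(2) unfolding comp by (simp add: inner_on_def)
      finally have "?R z = 0" by (intro inner_on_self_eq_0[OF T mat_apply_in_int_vectors])
      then show ?thesis by (rule inj[OF that(1)])
    qed
    have "sq_det r (\<lambda>i k. \<Sum>j\<in>T. R j i * R j k) \<noteq> 0"
    proof
      assume "sq_det r (\<lambda>i k. \<Sum>j\<in>T. R j i * R j k) = 0"
      then obtain z where z: "z \<in> int_vectors {..<r}" "z \<noteq> 0"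
        "sq_apply r (\<lambda>i k. \<Sum>j\<in>T. R j i * R j k) z = 0"
        by (rule sq_det_eq_0_imp_kernel)
      show False using z(2) gram_inj[OF z(1,3)] by (rule notE)
    qed
    then obtain k :: nat where k: "0 < k" "\<And>a. a \<in> int_vectors {..<r} \<Longrightarrow> \<exists>z\<in>int_vectors {..<r}.
        sq_apply r (\<lambda>i k. \<Sum>j\<in>T. R j i * R j k) z = (\<lambda>i. int k * a i)"
      by (rule sq_det_nonzero_multiple) blast
    then obtain z where z: "z \<in> int_vectors {..<r}" "?Rt (?R z) = (\<lambda>i. int k * a i)"
      using a(1) unfolding comp by blast
    \<comment> \<open>The preimage of \<open>a\<close> is \<open>R\<close> applied to the rational
      solution of the Gram system; \<open>k\<close> clears its denominators.\<close>
    define v where "v = fun_scale (1 / real k) (rl (?R z))"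
    have zH: "rl (?R z) \<in> ?H" unfolding rl_def \<Lambda> by (intro real_vectors_mem imageI z)
    have hv: "h v = w"
    proof -
      have "h v = (\<lambda>n. 1 / real k * h (rl (?R z)) n)"
        unfolding v_def fun_scale_def h_def mat_apply_scale ..
      then show ?thesis unfolding hrl z(2) a(2) using k(1) by auto
    qed
    have "(\<Sum>c\<in>T. v c * x c) \<in> \<int>" if "x \<in> ?H" for x
    proof -
      obtain y where "x = rl (?R y)" using \<open>x \<in> ?H\<close> by (auto simp: real_vectors_def \<Lambda> rl_def)
      then show ?thesis using pairing[of v y] unfolding hv a(2) by (auto intro!: Ints_sum Ints_mult)
    qed
    moreover have "v \<in> real_fun.span ?H" unfolding v_def by (intro real_fun.span_scale real_fun.span_base zH)
    ultimately have "v \<in> ?A" by (auto simp: dual_lattice_def)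
    then show "w \<in> h ` ?A" using hv by blast
  qed
  have imgH: "h ` ?H = real_vectors ((\<lambda>x. ?Rt (?R x)) ` int_vectors {..<r})"
    using hrl by (auto simp: real_vectors_def \<Lambda> image_image rl_def)
  have "order (discriminant_group T \<Lambda>) = lattice_index ?A ?H"
    by (simp add: discriminant_group_def lattice_index_def)
  also have "\<dots> = lattice_index (real_vectors (int_vectors {..<r})) (real_vectors ((\<lambda>x. ?Rt (?R x)) ` int_vectors {..<r}))"
  proof (rule lattice_index_transfer[OF A H HA _ _ img imgH])
    show "h (x - y) = h x - h y" for x y unfolding h_def by (rule mat_apply_diff)
    show "x \<in> ?H" if "x \<in> ?A" "h x = 0" for x
      using hinj[OF that] add_subgroupD(1)[OF H] by simp
  qed
  also have "\<dots> = lattice_index (int_vectors {..<r}) ((\<lambda>x. ?Rt (?R x)) ` int_vectors {..<r})"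
    by (intro lattice_index_real_vectors add_subgroup_int_vectors add_subgroup_image)
      (auto simp: mat_apply_diff mat_apply_in_int_vectors)
  finally show ?thesis .
qed

section \<open>Discriminant groups of the cut and flow lattices\<close>

context matrix_bases
begin

text \<open>The cut lattice need not be saturated, but it has the basis matrix \<open>Q t^T\<close>,
  and the Gram matrix of this basis is \<open>TG\<close>.\<close>

lemma order_discriminant_cut: "order (discriminant_group T (cobd ` int_vectors S)) = nat ((sq_det r t)\<^sup>2 * \<bar>sq_det r G\<bar>)"
proof -
  define R where "R c k = (\<Sum>i<r. q i c * t k i)" for c k
  have R: "mat_apply T {..<r} R z = Qm (sq_apply r (\<lambda>i j. t j i) z)" for z
    unfolding mat_apply_mat_apply R_def ..
  have Rt: "mat_apply {..<r} T (\<lambda>k c. R c k) x = sq_apply r t (Qt x)" for x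
    unfolding mat_apply_mat_apply R_def by (rule mat_apply_cong) (auto simp: mult.commute)
  have "order (discriminant_group T (cobd ` int_vectors S)) = lattice_index coords
      ((\<lambda>x. mat_apply {..<r} T (\<lambda>n c. R c n) (mat_apply T {..<r} R x)) ` coords)"
  proof (rule order_discriminant_group[OF finite_T])
    fix z assume z: "z \<in> coords" and "mat_apply T {..<r} R z = 0"
    then have "sq_apply r (\<lambda>i j. t j i) z = 0"
      unfolding R by (rule_tac Qm_eq_0[OF mat_apply_in_int_vectors])
    moreover have "sq_det r (\<lambda>i j. t j i) \<noteq> 0" using det_t by (simp add: sq_det_transpose[of r t])
    ultimately show "z = 0" using sq_det_nonzero_imp_inj z by blast
  next
    show "cobd ` int_vectors S = mat_apply T {..<r} R ` coords"
      unfolding Pt_surj[symmetric] image_image by (intro image_cong refl) (simp add: R cobd_factor)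
  qed
  also have "(\<lambda>x. mat_apply {..<r} T (\<lambda>n c. R c n) (mat_apply T {..<r} R x)) ` coords
      = sq_apply r TG ` coords"
    unfolding R Rt Qt_Qm by (simp only: mat_apply_mat_apply[of "{..<r}" "{..<r}" _ "{..<r}"])
  also have "lattice_index coords (sq_apply r TG ` coords) = nat \<bar>sq_det r TG\<bar>"
    by (rule lattice_index_sq_det) (use det_t det_G in \<open>simp add: det_TG\<close>)
  finally show ?thesis unfolding det_TG by (simp add: abs_mult)
qed

lemma saturated_F: "saturated_in T F"
  unfolding saturated_in_def
  by (auto simp: mat_apply_scale fun_eq_iff)

lemma orthogonal_C'_F: "x \<in> C' \<Longrightarrow> w \<in> F \<Longrightarrow> inner_on T x w = 0"
  using Qt_eq_0_imp_orthogonal bd_eq_0_iff by blast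

text \<open>Pairing with the columns of \<open>D\<close> has kernel \<open>C'\<close>, is onto
  because \<open>F\<close> is saturated, and sends \<open>C'\<close> plus \<open>F\<close> to the
  column lattice of the Gram matrix of \<open>D\<close>. The general index set \<open>N\<close>
  serves both a lattice basis and the new cells of an acyclization.\<close>

lemma index_gram_flow_basis:
  fixes D :: "'t \<Rightarrow> 'n \<Rightarrow> int"
  assumes N: "finite N" and inj: "\<And>z. z \<in> int_vectors N \<Longrightarrow> mat_apply T N D z = 0 \<Longrightarrow> z = 0"
    and F: "F = mat_apply T N D ` int_vectors N"
  shows "lattice_index (int_vectors N) ((\<lambda>x. mat_apply N T (\<lambda>n c. D c n) (mat_apply T N D x)) ` int_vectors N)
    = nat \<bar>sq_det r G\<bar>"
proof -
  let ?Dt = "mat_apply N T (\<lambda>n c. D c n)" and ?D = "mat_apply T N D"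
  let ?H = "{x + y | x y. x \<in> C' \<and> y \<in> F}"
  have C'0: "?Dt x = 0" if x: "x \<in> C'" for x
  proof (rule inner_on_self_eq_0[OF N mat_apply_in_int_vectors])
    have "inner_on N (?Dt x) (?Dt x) = inner_on T x (?D (?Dt x))"
      by (rule inner_on_mat_apply[symmetric])
    also have "\<dots> = 0" by (rule orthogonal_C'_F[OF x]) (simp only: F imageI mat_apply_in_int_vectors)
    finally show "inner_on N (?Dt x) (?Dt x) = 0" .
  qed
  \<comment> \<open>An auxiliary basis of \<open>F\<close>; its integral dual vectors are what makes
    \<open>?Dt\<close> onto.\<close>
  obtain k f f' where f: "lattice_basis T F k f f'"
    by (rule lattice_basis_exists[OF finite_T _ subgroup_F saturated_F]) auto
  have "lattice_index (int_vectors T) ?H = lattice_index (int_vectors N) ((\<lambda>x. ?Dt (?D x)) ` int_vectors N)"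
  proof (rule lattice_index_transfer[where h = ?Dt])
    show "add_subgroup ?H" by (rule subgroup_sum[OF subgroup_C' subgroup_F])
    show "?H \<subseteq> int_vectors T"
      using add_subgroupD(4)[OF add_subgroup_int_vectors[of T]] saturation_subset by blast
    show "x \<in> ?H" if "x \<in> int_vectors T" "?Dt x = 0" for x
    proof -
      have "x \<in> C'"
      proof (rule orthogonal_imp_mem_C'[OF that(1)])
        fix w assume "w \<in> F"
        then obtain y where "w = ?D y" unfolding F by blast
        then have "inner_on T x w = inner_on N (?Dt x) y" by (simp add: inner_on_mat_apply)
        then show "inner_on T x w = 0" using that(2) by (simp add: inner_on_def)
      qed
      then show ?thesis using add_subgroupD(1)[OF subgroup_F]
        by (intro CollectI exI[of _ x] exI[of _ 0]) simp_all
    qed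
    show "?Dt ` int_vectors T = int_vectors N"
    proof (intro equalityI subsetI)
      fix a assume a: "a \<in> int_vectors N"
      have "\<forall>i<k. \<exists>y. y \<in> int_vectors N \<and> f i = ?D y"
        using f unfolding lattice_basis_def F by blast
      then obtain y where y: "\<And>i. i < k \<Longrightarrow> y i \<in> int_vectors N" "\<And>i. i < k \<Longrightarrow> f i = ?D (y i)"
        by metis
      \<comment> \<open>\<open>x\<close> realizes the functional \<open>a\<close>: its pairing with
        \<open>f i = ?D (y i)\<close> is that of \<open>a\<close> with \<open>y i\<close>.\<close>
      define x where "x = (\<lambda>c. \<Sum>i<k. inner_on N a (y i) * f' i c)"
      have f': "\<And>i. i < k \<Longrightarrow> f' i \<in> int_vectors T" using f by (simp add: lattice_basis_def)
      have x: "x \<in> int_vectors T"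
        unfolding x_def by (rule add_subgroup_sum[OF add_subgroup_int_vectors f'])
      have pair: "inner_on T x (?D z) = inner_on N a z" if z: "z \<in> int_vectors N" for z
      proof -
        define s where "s i = inner_on T (f' i) (?D z)" for i
        define u where "u = (\<lambda>n. \<Sum>i<k. s i * y i n)"
        have "?D z \<in> F" unfolding F using z by blast
        then have "?D z = (\<lambda>c. \<Sum>i<k. s i * f i c)"
          using f unfolding lattice_basis_def s_def by blast
        also have "\<dots> = (\<lambda>c. \<Sum>i<k. s i * ?D (y i) c)"
          by (intro ext sum.cong refl) (simp add: y(2))
        also have "\<dots> = ?D u"
        proof
          fix c
          have "(\<Sum>i<k. s i * (\<Sum>n\<in>N. D c n * y i n)) = (\<Sum>n\<in>N. D c n * u n)"
            unfolding u_def sum_distrib_left by (subst sum.swap) (simp add: algebra_simps)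
          then show "(\<Sum>i<k. s i * ?D (y i) c) = ?D u c" by (simp add: mat_apply_def)
        qed
        finally have "?D (z - u) = 0" by (simp add: mat_apply_diff)
        moreover have "u \<in> int_vectors N"
          unfolding u_def by (rule add_subgroup_sum[OF add_subgroup_int_vectors y(1)])
        then have "z - u \<in> int_vectors N"
          by (rule add_subgroupD(2)[OF add_subgroup_int_vectors z])
        ultimately have "z - u = 0" by (intro inj)
        then have zu: "z = u" by simp
        have "inner_on T x (?D z) = (\<Sum>i<k. inner_on N a (y i) * s i)"
          unfolding x_def s_def by (rule inner_on_sum(2))
        also have "\<dots> = inner_on N a u"
          unfolding u_def inner_on_sum(1) by (simp add: mult.commute)
        finally show ?thesis by (simp add: zu[symmetric])
      qed
      \<comment> \<open>By \<open>pair\<close> the difference is orthogonal to every integral vector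
        on \<open>N\<close>, in particular to itself.\<close>
      have "inner_on N (?Dt x - a) (?Dt x - a) = 0"
      proof -
        have w: "?Dt x - a \<in> int_vectors N"
          by (rule add_subgroupD(2)[OF add_subgroup_int_vectors mat_apply_in_int_vectors a])
        have "inner_on N (?Dt x) (?Dt x - a) = inner_on T x (?D (?Dt x - a))"
          by (rule inner_on_mat_apply[symmetric])
        also have "\<dots> = inner_on N a (?Dt x - a)" by (rule pair[OF w])
        finally show ?thesis by (simp add: inner_on_diff(2))
      qed
      then have "?Dt x - a = 0"
        by (rule inner_on_self_eq_0[OF N
              add_subgroupD(2)[OF add_subgroup_int_vectors mat_apply_in_int_vectors a]])
      then have "a = ?Dt x" by simp
      then show "a \<in> ?Dt ` int_vectors T" using x by blast
    qed (auto simp: mat_apply_in_int_vectors)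
    show "?Dt ` ?H = (\<lambda>x. ?Dt (?D x)) ` int_vectors N"
    proof (intro equalityI subsetI)
      fix z assume "z \<in> ?Dt ` ?H"
      then obtain x y where xy: "x \<in> C'" "y \<in> F" "z = ?Dt (x + y)" by blast
      then have "z = ?Dt y" by (simp add: mat_apply_add C'0)
      then show "z \<in> (\<lambda>x. ?Dt (?D x)) ` int_vectors N" using xy(2) unfolding F by blast
    next
      fix z assume "z \<in> (\<lambda>x. ?Dt (?D x)) ` int_vectors N"
      then obtain y where y: "y \<in> F" "z = ?Dt (0 + y)" unfolding F by auto
      show "z \<in> ?Dt ` ?H"
        unfolding y(2) using y(1) add_subgroupD(1)[OF subgroup_C']
        by (intro imageI) blast
    qed
  qed (auto simp: add_subgroup_int_vectors mat_apply_diff)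
  then show ?thesis using index_saturated_cut_flow by simp
qed

lemma order_discriminant_flow: "order (discriminant_group T F) = nat \<bar>sq_det r G\<bar>"
proof -
  obtain k f f' where f: "lattice_basis T F k f f'"
    by (rule lattice_basis_exists[OF finite_T _ subgroup_F saturated_F]) auto
  let ?D = "\<lambda>c i. f i c"
  have inj: "z = 0" if "z \<in> int_vectors {..<k}" "mat_apply T {..<k} ?D z = 0" for z
    using lattice_basis_coordinates(1)[OF f that(1)] that(2) by (simp add: mat_apply_0)
  have F: "F = mat_apply T {..<k} ?D ` int_vectors {..<k}"
  proof (intro equalityI subsetI)
    fix x assume "x \<in> F"
    then have "x = mat_apply T {..<k} ?D (mat_apply {..<k} T f' x)"
      by (rule lattice_basis_coordinates(3)[OF f, symmetric])
    then show "x \<in> mat_apply T {..<k} ?D ` int_vectors {..<k}" using mat_apply_in_int_vectors by blast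
  next
    fix x assume "x \<in> mat_apply T {..<k} ?D ` int_vectors {..<k}"
    then obtain z where "x = mat_apply T {..<k} ?D z" by blast
    then show "x \<in> F" using lattice_basis_mem[OF f subgroup_F] by simp
  qed
  show ?thesis
    by (rule trans[OF order_discriminant_group[OF finite_T inj F] index_gram_flow_basis[OF _ inj F]]) simp_all
qed

lemma order_discriminant_flow_basis:
  fixes D :: "'t \<Rightarrow> 'n \<Rightarrow> int"
  assumes "finite N" "\<And>z. z \<in> int_vectors N \<Longrightarrow> mat_apply T N D z = 0 \<Longrightarrow> z = 0"
    "F = mat_apply T N D ` int_vectors N"
  shows "order (discriminant_group T F) =
    lattice_index (int_vectors N) ((\<lambda>x. mat_apply N T (\<lambda>n c. D c n) (mat_apply T N D x)) ` int_vectors N)"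
  using index_gram_flow_basis[OF assms] order_discriminant_flow by simp

end

subsection \<open>Spanning forests\<close>

lemma sum_fun_scale: "(\<Sum>i\<in>I. fun_scale (u i) (b i)) c = (\<Sum>i\<in>I. u i * b i c)"
  by (induction I rule: infinite_finite_induct) (auto simp: fun_scale_def)

text \<open>\<open>dependent\<close> speaks about sets and cannot see repeated columns; together
  with injectivity it expresses independence of the family.\<close>

lemma independent_family_iff:
  assumes I: "finite I"
  shows "inj_on b I \<and> \<not> real_fun.dependent (b ` I) \<longleftrightarrow>
    (\<forall>u. (\<Sum>i\<in>I. fun_scale (u i) (b i)) = 0 \<longrightarrow> (\<forall>i\<in>I. u i = 0))"
proof (intro iffI allI impI conjI)
  fix u assume ib: "inj_on b I \<and> \<not> real_fun.dependent (b ` I)" and z: "(\<Sum>i\<in>I. fun_scale (u i) (b i)) = 0"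
  have "(\<Sum>v\<in>b ` I. fun_scale (u (inv_into I b v)) v) = (\<Sum>i\<in>I. fun_scale (u i) (b i))"
    using ib by (subst sum.reindex) (auto intro!: sum.cong)
  then have z': "(\<Sum>v\<in>b ` I. fun_scale (u (inv_into I b v)) v) = 0" using z by (rule trans)
  have *: "\<forall>u. (\<Sum>v\<in>b ` I. fun_scale (u v) v) = 0 \<longrightarrow> (\<forall>v\<in>b ` I. u v = 0)"
    using ib I real_fun.dependent_finite[of "b ` I"] by blast
  have "\<forall>v\<in>b ` I. u (inv_into I b v) = 0"
    using *[THEN spec, of "\<lambda>v. u (inv_into I b v)"] z' by (rule mp)
  then show "\<forall>i\<in>I. u i = 0" using ib by auto
next
  assume a: "\<forall>u. (\<Sum>i\<in>I. fun_scale (u i) (b i)) = 0 \<longrightarrow> (\<forall>i\<in>I. u i = 0)"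
  show inj: "inj_on b I"
  proof (rule inj_onI)
    fix i j assume ij: "i \<in> I" "j \<in> I" "b i = b j"
    show "i = j"
    proof (rule ccontr)
      assume ne: "i \<noteq> j"
      define u where "u k = (if k = i then 1 else if k = j then - 1 else 0 :: real)" for k
      have "(\<Sum>k\<in>I. fun_scale (u k) (b k)) = (\<Sum>k\<in>{i, j}. fun_scale (u k) (b k))"
        by (rule sum.mono_neutral_right[OF I]) (use ij in \<open>auto simp: u_def fun_scale_def fun_eq_iff\<close>)
      also have "\<dots> = 0" using ne ij(3) by (auto simp: u_def fun_scale_def fun_eq_iff)
      finally have "u i = 0" using a ij(1) by blast
      then show False by (simp add: u_def)
    qed
  qed
  show "\<not> real_fun.dependent (b ` I)"
  proof
    assume "real_fun.dependent (b ` I)"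
    then obtain w where w: "\<exists>v\<in>b ` I. w v \<noteq> 0" "(\<Sum>v\<in>b ` I. fun_scale (w v) v) = 0"
      using real_fun.dependent_finite[of "b ` I"] I by auto
    have "(\<Sum>i\<in>I. fun_scale (w (b i)) (b i)) = 0" using w(2) inj by (simp add: sum.reindex)
    then have "\<forall>i\<in>I. w (b i) = 0" using a[rule_format, of "\<lambda>i. w (b i)"] by blast
    then show False using w(1) by blast
  qed
qed

section \<open>Forests as nonvanishing minors of \<open>Q\<close>\<close>

context matrix_bases
begin

definition "real_col c = (\<lambda>f. if f \<in> S then real_of_int (M f c) else 0)"
definition "real_basis i = (\<lambda>f. real_of_int (p i f))"
definition "gram_on U i j = (\<Sum>c\<in>U. q i c * q j c)"

lemma bd_real_col:
  assumes "x \<in> int_vectors T"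
  shows "(\<lambda>f. real_of_int (bd x f)) = (\<Sum>c\<in>T. fun_scale (real_of_int (x c)) (real_col c))"
proof
  fix f show "real_of_int (bd x f) = (\<Sum>c\<in>T. fun_scale (real_of_int (x c)) (real_col c)) f"
    unfolding sum_fun_scale by (cases "f \<in> S") (auto simp: mat_apply_def real_col_def mult.commute)
qed

lemma Pm_real_basis: "(\<lambda>f. real_of_int (Pm z f)) = (\<Sum>i<r. fun_scale (real_of_int (z i)) (real_basis i))"
proof
  have p0: "p i f = 0" if "i < r" "f \<notin> S" for i f
    using P that by (force simp: lattice_basis_def saturation_def int_vectors_def)
  fix f show "real_of_int (Pm z f) = (\<Sum>i<r. fun_scale (real_of_int (z i)) (real_basis i)) f"
    unfolding sum_fun_scale
    by (cases "f \<in> S") (auto simp: mat_apply_def real_basis_def mult.commute p0)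
qed

text \<open>Pairing a real relation with the dual vector \<open>p' i\<close> isolates its
  \<open>i\<close>-th coefficient.\<close>

lemma independent_real_basis: "inj_on real_basis {..<r} \<and> \<not> real_fun.dependent (real_basis ` {..<r})"
proof (subst independent_family_iff; (intro allI impI ballI)?)
  fix u i assume z: "(\<Sum>i<r. fun_scale (u i) (real_basis i)) = 0" and i: "i \<in> {..<r}"
  have bi: "(\<Sum>f\<in>S. p' i f * p j f) = (if i = j then 1 else 0)" if "j < r" for j
    using P i that by (auto simp: lattice_basis_def inner_on_def)
  have "0 = (\<Sum>f\<in>S. real_of_int (p' i f) * (\<Sum>j<r. fun_scale (u j) (real_basis j)) f)"
    unfolding z by simp
  also have "\<dots> = (\<Sum>j<r. u j * real_of_int (\<Sum>f\<in>S. p' i f * p j f))"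
    unfolding sum_fun_scale sum_distrib_left real_basis_def of_int_sum
    by (subst sum.swap) (simp add: algebra_simps)
  also have "\<dots> = (\<Sum>j<r. u j * (if i = j then 1 else 0))"
    by (intro sum.cong refl) (simp add: bi)
  also have "\<dots> = u i" using i by (simp add: if_distrib[of "(*) _"] cong: if_cong)
  finally show "u i = 0" by simp
qed simp

lemma real_col_mem_span: "c \<in> T \<Longrightarrow> real_col c \<in> real_fun.span (real_basis ` {..<r})"
proof -
  assume c: "c \<in> T"
  let ?e = "\<lambda>d. if d = c then 1 else 0 :: int"
  have e: "?e \<in> int_vectors T" using c by (auto simp: int_vectors_def)
  have "real_col c = (\<lambda>f. real_of_int (bd ?e f))"
    using c finite_T by (auto simp: real_col_def mat_apply_def if_distrib[of "(*) _"] cong: if_cong)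
  also have "\<dots> = (\<lambda>f. real_of_int (Pm (sq_apply r t (Qt ?e)) f))"
    unfolding bd_factor[OF e] ..
  also have "\<dots> \<in> real_fun.span (real_basis ` {..<r})"
    unfolding Pm_real_basis
    by (intro real_fun.span_sum real_fun.span_scale real_fun.span_base imageI)
  finally show ?thesis .
qed

lemma bd_eq_on_subset:
  assumes "U \<subseteq> T" "x \<in> int_vectors U"
  shows "x \<in> int_vectors T" "mat_apply S U M x = bd x"
proof -
  show "x \<in> int_vectors T" using assms by (auto simp: int_vectors_def)
  have "(\<Sum>c\<in>U. M f c * x c) = (\<Sum>c\<in>T. M f c * x c)" for f
    by (rule sum.mono_neutral_left[OF finite_T assms(1)]) (use assms(2) in \<open>auto simp: int_vectors_def\<close>)
  then show "mat_apply S U M x = bd x" by (auto simp: mat_apply_def)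
qed

lemma bd_image_subset: "U \<subseteq> T \<Longrightarrow> mat_apply S U M ` int_vectors U \<subseteq> bd ` int_vectors T"
  using bd_eq_on_subset by blast

lemma real_basis_mem_span:
  assumes U: "U \<subseteq> T" and i: "i < r" and L: "p i \<in> saturation S (mat_apply S U M ` int_vectors U)"
  shows "real_basis i \<in> real_fun.span (real_col ` U)"
proof -
  obtain k :: nat and x where k: "0 < k" "x \<in> int_vectors U" "(\<lambda>f. int k * p i f) = mat_apply S U M x"
    using L by (auto simp: saturation_def)
  have xT: "x \<in> int_vectors T" "mat_apply S U M x = bd x" by (rule bd_eq_on_subset[OF U k(2)])+
  have "real_basis i = fun_scale (1 / real k) (\<lambda>f. real_of_int (int k * p i f))"
    using k(1) by (auto simp: real_basis_def fun_scale_def)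
  also have "(\<lambda>f. real_of_int (int k * p i f)) = (\<lambda>f. real_of_int (bd x f))"
    using fun_cong[OF k(3)] xT(2) by (intro ext) simp
  also have "\<dots> = (\<Sum>c\<in>T. fun_scale (real_of_int (x c)) (real_col c))"
    by (rule bd_real_col[OF xT(1)])
  also have "\<dots> = (\<Sum>c\<in>U. fun_scale (real_of_int (x c)) (real_col c))"
    by (rule sum.mono_neutral_right[OF finite_T U])
      (use k(2) in \<open>auto simp: int_vectors_def fun_scale_def fun_eq_iff\<close>)
  finally have eq: "real_basis i = fun_scale (1 / real k) (\<Sum>c\<in>U. fun_scale (real_of_int (x c)) (real_col c))" .
  show ?thesis
    unfolding eq by (intro real_fun.span_scale real_fun.span_sum real_fun.span_base imageI)
qed

text \<open>Real spans do not see integer multiples, so they depend only on the saturation.\<close>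

lemma span_eq:
  assumes U: "U \<subseteq> T" and L: "L \<subseteq> saturation S (mat_apply S U M ` int_vectors U)"
  shows "real_fun.span (real_col ` U) = real_fun.span (real_basis ` {..<r})"
proof (rule antisym)
  show "real_fun.span (real_col ` U) \<subseteq> real_fun.span (real_basis ` {..<r})"
    by (rule real_fun.span_minimal) (use real_col_mem_span U in auto)
  have "p i \<in> L" if "i < r" for i using P that by (simp add: lattice_basis_def)
  then have "real_basis ` {..<r} \<subseteq> real_fun.span (real_col ` U)"
    using real_basis_mem_span[OF U] L by auto
  then show "real_fun.span (real_basis ` {..<r}) \<subseteq> real_fun.span (real_col ` U)"
    by (rule real_fun.span_minimal) simp
qed

lemma span_T: "real_fun.span (real_col ` T) = real_fun.span (real_basis ` {..<r})"
  by (rule span_eq) auto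

lemma dim_span: "real_fun.dim (real_fun.span (real_basis ` {..<r})) = r"
  using independent_real_basis real_fun.dim_eq_card_independent[of "real_basis ` {..<r}"]
  by (simp add: card_image)

text \<open>The Gram determinant is the square of the minor of \<open>Q\<close> on \<open>U\<close>,
  written without enumerating \<open>U\<close>.\<close>

definition "forest U \<longleftrightarrow> U \<subseteq> T \<and> card U = r \<and> sq_det r (gram_on U) \<noteq> 0"

lemma forest_enumeration:
  assumes "U \<subseteq> T" "card U = r"
  obtains e where "bij_betw e {..<r} U" "sq_det r (gram_on U) = (sq_det r (\<lambda>i k. q i (e k)))\<^sup>2"
    "Qt ` int_vectors U = sq_apply r (\<lambda>i k. q i (e k)) ` coords"
proof -
  have fU: "finite U" using assms finite_T by (blast intro: finite_subset)
  obtain e where e: "bij_betw e {..<r} U"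
    using ex_bij_betw_nat_finite[OF fU] assms(2) by (auto simp: lessThan_atLeast0)
  have Qt_e: "Qt x = sq_apply r (\<lambda>i k. q i (e k)) (\<lambda>k. if k < r then x (e k) else 0)"
    if "x \<in> int_vectors U" for x
  proof -
    have "(\<Sum>c\<in>T. q i c * x c) = (\<Sum>k<r. q i (e k) * (if k < r then x (e k) else 0))" for i
    proof -
      have "(\<Sum>c\<in>T. q i c * x c) = (\<Sum>c\<in>U. q i c * x c)"
        by (rule sum.mono_neutral_right[OF finite_T assms(1)]) (use that in \<open>auto simp: int_vectors_def\<close>)
      also have "\<dots> = (\<Sum>k<r. q i (e k) * x (e k))" by (rule sum.reindex_bij_betw[OF e, symmetric])
      finally show ?thesis by simp
    qed
    then show ?thesis unfolding mat_apply_def by (simp only:)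
  qed
  show thesis
  proof (rule that[OF e])
    show "sq_det r (gram_on U) = (sq_det r (\<lambda>i k. q i (e k)))\<^sup>2"
      using sq_det_gram_bij[OF e, of q] by (simp add: gram_on_def[abs_def])
    show "Qt ` int_vectors U = sq_apply r (\<lambda>i k. q i (e k)) ` coords"
    proof (intro equalityI subsetI)
      fix z assume "z \<in> Qt ` int_vectors U"
      then obtain x where "x \<in> int_vectors U" "z = Qt x" by blast
      moreover have "(\<lambda>k. if k < r then x (e k) else 0) \<in> coords" for x :: "'t \<Rightarrow> int"
        by (simp add: int_vectors_def)
      ultimately show "z \<in> sq_apply r (\<lambda>i k. q i (e k)) ` coords"
        using Qt_e by blast
    next
      fix z assume "z \<in> sq_apply r (\<lambda>i k. q i (e k)) ` coords"
      then obtain y where y: "y \<in> coords" "z = sq_apply r (\<lambda>i k. q i (e k)) y" by blast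
      define x where "x c = (if c \<in> U then y (inv_into {..<r} e c) else 0)" for c
      have x: "x \<in> int_vectors U" by (simp add: x_def int_vectors_def)
      have "(\<lambda>k. if k < r then x (e k) else 0) = y"
      proof
        fix k show "(if k < r then x (e k) else 0) = y k"
          using e y(1) by (auto simp: x_def bij_betw_def int_vectors_def)
      qed
      then have "z = Qt x" using Qt_e[OF x] y(2) by simp
      then show "z \<in> Qt ` int_vectors U" using x by blast
    qed
  qed
qed

text \<open>In coordinates the columns in \<open>U\<close> form the square matrix \<open>W\<close>,
  the product of \<open>t\<close> with the minor of \<open>Q\<close>. Its determinant is nonzero, so
  passing to \<open>U\<close> keeps the saturation and all forests share the numerator
  \<open>L\<close>. The index enters squared because the Gram determinant is the square of the
  minor.\<close>

lemma forest_lattice: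
  assumes "forest U"
  shows "saturation S (mat_apply S U M ` int_vectors U) = L"
    and "(int (lattice_index L (mat_apply S U M ` int_vectors U)))\<^sup>2 = (sq_det r t)\<^sup>2 * sq_det r (gram_on U)"
proof -
  have U: "U \<subseteq> T" "card U = r" and g: "sq_det r (gram_on U) \<noteq> 0" using assms by (auto simp: forest_def)
  obtain e where e: "bij_betw e {..<r} U" and det: "sq_det r (gram_on U) = (sq_det r (\<lambda>i k. q i (e k)))\<^sup>2"
    and im: "Qt ` int_vectors U = sq_apply r (\<lambda>i k. q i (e k)) ` coords"
    by (rule forest_enumeration[OF U])
  define W where "W i k = (\<Sum>j<r. t i j * q j (e k))" for i k
  have detW: "sq_det r W = sq_det r t * sq_det r (\<lambda>i k. q i (e k))"
    unfolding W_def[abs_def] by (rule sq_det_mult)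
  have W0: "sq_det r W \<noteq> 0" using g det det_t unfolding detW by auto
  let ?I = "mat_apply S U M ` int_vectors U"
  have I: "?I = bd ` int_vectors U"
    by (rule image_cong[OF refl]) (rule bd_eq_on_subset[OF U(1)])
  have P'tI: "P't ` ?I = sq_apply r W ` coords"
  proof -
    have "P't ` ?I = (\<lambda>x. sq_apply r t (Qt x)) ` int_vectors U"
      unfolding I image_image
      by (rule image_cong[OF refl])
        (simp only: bd_factor[OF bd_eq_on_subset(1)[OF U(1)]] P_coords(1) mat_apply_in_int_vectors)
    also have "\<dots> = sq_apply r t ` Qt ` int_vectors U" by (simp only: image_image)
    also have "\<dots> = sq_apply r W ` coords"
      unfolding im image_image mat_apply_mat_apply[of "{..<r}" "{..<r}" t] W_def[abs_def] ..
    finally show ?thesis .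
  qed
  have IL: "?I \<subseteq> L"
    by (rule order_trans[OF bd_image_subset[OF U(1)] image_subsetI[OF bd_mem]])
  show "saturation S ?I = L"
  proof (intro equalityI subsetI)
    fix x assume "x \<in> saturation S ?I"
    then obtain k :: nat where "x \<in> int_vectors S" "0 < k" "(\<lambda>c. int k * x c) \<in> ?I"
      by (auto simp: saturation_def)
    then show "x \<in> L"
      unfolding saturation_def by (intro CollectI conjI exI[of _ k] subsetD[OF bd_image_subset[OF U(1)]])
  next
    fix x assume x: "x \<in> L"
    from W0 obtain k :: nat where k: "0 < k" "\<And>a. a \<in> coords \<Longrightarrow>
        \<exists>z\<in>coords. sq_apply r W z = (\<lambda>i. int k * a i)"
      by (rule sq_det_nonzero_multiple) blast
    have "(\<lambda>i. int k * P't x i) \<in> sq_apply r W ` coords"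
      using k(2)[OF mat_apply_in_int_vectors[of "{..<r}" S p' x]] by force
    then obtain y where y: "y \<in> ?I" "(\<lambda>i. int k * P't x i) = P't y"
      unfolding P'tI[symmetric] by blast
    have "(\<lambda>c. int k * x c) = (\<lambda>c. int k * Pm (P't x) c)" by (simp only: P_coords(3)[OF x])
    also have "\<dots> = Pm (\<lambda>i. int k * P't x i)" by (rule mat_apply_scale[symmetric])
    also have "\<dots> = Pm (P't y)" unfolding y(2) ..
    also have "\<dots> = y" using y(1) IL by (intro P_coords(3)) blast
    finally have "(\<lambda>c. int k * x c) \<in> ?I" using y(1) by simp
    then show "x \<in> saturation S ?I" using k(1) x by (auto simp: saturation_def)
  qed
  have "lattice_index L ?I = nat \<bar>sq_det r W\<bar>"
  proof (rule index_by_coordinates[where h = P't])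
    show "x \<in> ?I" if "x \<in> L" "P't x = 0" for x
    proof -
      have "x = Pm (P't x)" by (rule P_coords(3)[OF that(1), symmetric])
      then have "x = 0" using that(2) by (simp add: mat_apply_0)
      then show ?thesis using add_subgroupD(1)[OF add_subgroup_mat_apply_image] by simp
    qed
  qed (simp_all add: subgroup_L add_subgroup_mat_apply_image IL mat_apply_diff P't_surj P'tI W0)
  then show "(int (lattice_index L ?I))\<^sup>2 = (sq_det r t)\<^sup>2 * sq_det r (gram_on U)"
    unfolding det detW by (simp add: power_mult_distrib)
qed

text \<open>Independent columns spanning the \<open>r\<close>-dimensional column space are
  \<open>r\<close> in number, and an integral kernel vector of the minor would be a relation between
  them. Conversely, \<open>r\<close> columns spanning a space of dimension \<open>r\<close> are
  distinct and independent.\<close>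

theorem forest_iff:
  "U \<subseteq> T \<and> inj_on real_col U \<and> \<not> real_fun.dependent (real_col ` U) \<and>
     real_fun.span (real_col ` U) = real_fun.span (real_col ` T) \<longleftrightarrow> forest U" (is "?l \<longleftrightarrow> ?r")
proof
  assume ?l
  then have U: "U \<subseteq> T" and ind: "inj_on real_col U \<and> \<not> real_fun.dependent (real_col ` U)"
    and sp: "real_fun.span (real_col ` U) = real_fun.span (real_basis ` {..<r})"
    by (auto simp: span_T)
  have fU: "finite U" using U finite_T by (rule finite_subset)
  have "card U = card (real_col ` U)" using ind by (simp add: card_image)
  also have "\<dots> = real_fun.dim (real_fun.span (real_col ` U))"
    using ind real_fun.dim_eq_card_independent[of "real_col ` U"] by simp
  also have "\<dots> = r" unfolding sp by (rule dim_span)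
  finally have card: "card U = r" .
  have "sq_det r (gram_on U) \<noteq> 0"
  proof
    assume g: "sq_det r (gram_on U) = 0"
    obtain e where e: "bij_betw e {..<r} U" and det: "sq_det r (gram_on U) = (sq_det r (\<lambda>i k. q i (e k)))\<^sup>2"
      and im: "Qt ` int_vectors U = sq_apply r (\<lambda>i k. q i (e k)) ` coords"
      by (rule forest_enumeration[OF U card])
    have "sq_det r (\<lambda>i k. q i (e k)) = 0" using det g by simp
    then obtain y where y: "y \<in> coords" "y \<noteq> 0" "sq_apply r (\<lambda>i k. q i (e k)) y = 0"
      by (rule sq_det_eq_0_imp_kernel)
    define x where "x c = (if c \<in> U then y (inv_into {..<r} e c) else 0)" for c
    have x: "x \<in> int_vectors U" by (simp add: x_def int_vectors_def)
    have xe: "x (e k) = y k" if "k < r" for k using e that by (auto simp: x_def bij_betw_def)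
    have "Qt x = 0"
    proof
      fix i
      have "(\<Sum>c\<in>T. q i c * x c) = (\<Sum>c\<in>U. q i c * x c)"
        by (rule sum.mono_neutral_right[OF finite_T U]) (use x in \<open>auto simp: int_vectors_def\<close>)
      also have "\<dots> = (\<Sum>k<r. q i (e k) * x (e k))" by (rule sum.reindex_bij_betw[OF e, symmetric])
      also have "\<dots> = (\<Sum>k<r. q i (e k) * y k)" by (simp add: xe)
      finally show "Qt x i = 0 i" using fun_cong[OF y(3), of i] by (simp add: mat_apply_def split: if_splits)
    qed
    then have "bd x = 0" by (rule Qt_eq_0_imp_bd_eq_0)
    then have "0 = (\<Sum>c\<in>T. fun_scale (real_of_int (x c)) (real_col c))"
      using bd_real_col[OF bd_eq_on_subset(1)[OF U x]] by (simp add: zero_fun_def)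
    also have "\<dots> = (\<Sum>c\<in>U. fun_scale (real_of_int (x c)) (real_col c))"
      by (rule sum.mono_neutral_right[OF finite_T U])
        (use x in \<open>auto simp: int_vectors_def fun_scale_def fun_eq_iff\<close>)
    finally have "\<forall>c\<in>U. real_of_int (x c) = 0"
      using ind[unfolded independent_family_iff[OF fU], rule_format, of "\<lambda>c. real_of_int (x c)"] by simp
    then have "y k = 0" if "k < r" for k using xe[OF that] e that by (auto simp: bij_betw_def)
    then have "y = 0" using y(1) by (auto simp: int_vectors_eq_0_iff)
    with y(2) show False ..
  qed
  then show ?r using U card by (simp add: forest_def)
next
  assume r: ?r
  then have U: "U \<subseteq> T" "card U = r" by (auto simp: forest_def)
  have fU: "finite U" using U(1) finite_T by (rule finite_subset)
  have sp: "real_fun.span (real_col ` U) = real_fun.span (real_basis ` {..<r})"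
    by (rule span_eq[OF U(1)]) (simp add: forest_lattice(1)[OF r])
  have "r = real_fun.dim (real_fun.span (real_col ` U))" unfolding sp by (rule dim_span[symmetric])
  also have "\<dots> \<le> card (real_col ` U)"
    by (rule real_fun.dim_le_card) (use fU in auto)
  finally have c: "card (real_col ` U) = card U" using U(2) card_image_le[OF fU, of real_col] by simp
  then have "inj_on real_col U" by (rule eq_card_imp_inj_on[OF fU])
  moreover have "\<not> real_fun.dependent (real_col ` U)"
  proof -
    \<comment> \<open>A basis \<open>V\<close> extracted from the columns already has as many
      elements as there are columns, so it consists of all of them.\<close>
    obtain V where V: "V \<subseteq> real_col ` U" "\<not> real_fun.dependent V" "card V = real_fun.dim (real_col ` U)"
      by (rule real_fun.basis_exists)
    have "card V = card (real_col ` U)"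
      using V(3) c U(2) dim_span unfolding sp[symmetric] real_fun.dim_span by simp
    then have "V = real_col ` U" using V(1) fU by (intro card_subset_eq) auto
    then show ?thesis using V(2) by simp
  qed
  ultimately show ?l using U sp span_T by simp
qed

text \<open>Sets of \<open>r\<close> facets with vanishing minor contribute 0, so the sum may run
  over all sets of that size, where Cauchy-Binet applies.\<close>

theorem sum_forests:
  "(\<Sum>U | forest U. (int (lattice_index L (mat_apply S U M ` int_vectors U)))\<^sup>2) = (sq_det r t)\<^sup>2 * sq_det r G"
proof -
  have "(\<Sum>U | forest U. (int (lattice_index L (mat_apply S U M ` int_vectors U)))\<^sup>2)
      = (\<Sum>U | forest U. (sq_det r t)\<^sup>2 * sq_det r (gram_on U))"
    by (rule sum.cong) (auto simp: forest_lattice(2))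
  also have "\<dots> = (\<Sum>U | U \<subseteq> T \<and> card U = r. (sq_det r t)\<^sup>2 * sq_det r (gram_on U))"
    by (rule sum.mono_neutral_left) (use finite_T in \<open>auto simp: forest_def\<close>)
  also have "\<dots> = (sq_det r t)\<^sup>2 * (\<Sum>U | U \<subseteq> T \<and> card U = r. sq_det r (gram_on U))"
    by (simp add: sum_distrib_left)
  also have "(\<Sum>U | U \<subseteq> T \<and> card U = r. sq_det r (gram_on U)) = sq_det r G"
    unfolding gram_on_def[abs_def] G_def[abs_def] by (rule cauchy_binet_gram[OF finite_T, symmetric])
  finally show ?thesis .
qed

text \<open>Its product with the square of \<open>det t\<close> is a sum of squares, and it is
  nonzero by \<open>det_G\<close>.\<close>

lemma det_G_pos: "sq_det r G > 0"
proof -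
  have "0 \<le> (sq_det r t)\<^sup>2 * sq_det r G" unfolding sum_forests[symmetric] by (intro sum_nonneg) simp
  then show ?thesis using det_t det_G by (simp add: zero_le_mult_iff)
qed

end

subsection \<open>The theorem for cellular chain complexes\<close>

lemma cell_chains_eq: "cell_chains E i = int_vectors (E i)"
  by (simp add: cell_chains_def int_vectors_def)

lemma boundary_eq: "boundary E B i = mat_apply (E (i - 1)) (E i) (\<lambda>f c. B c f)"
  by (simp add: boundary_def mat_apply_def fun_eq_iff)

lemma coboundary_eq: "coboundary E B i = mat_apply (E i) (E (i - 1)) B"
  by (simp add: coboundary_def mat_apply_def fun_eq_iff)

lemma add_subgroup_cycles: "add_subgroup (cycles E B i)"
  using add_subgroupD[OF add_subgroup_int_vectors[of "E i"]]
  by (auto simp: add_subgroup_def cycles_def cell_chains_eq boundary_eq mat_apply_diff mat_apply_0)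

text \<open>A chain with a positive multiple that is a cycle is itself a cycle, so the numerator of
  the torsion group can be described without cycles.\<close>

lemma torsion_eq_saturation:
  assumes "H \<subseteq> cycles E B i"
  shows "{x \<in> cycles E B i. \<exists>n::nat. 0 < n \<and> (\<lambda>c. int n * x c) \<in> H} = saturation (E i) H"
proof (intro equalityI subsetI)
  fix x assume "x \<in> saturation (E i) H"
  then obtain n :: nat where x: "x \<in> int_vectors (E i)" and n: "0 < n" "(\<lambda>c. int n * x c) \<in> H"
    by (auto simp: saturation_def)
  have "boundary E B i (\<lambda>c. int n * x c) = 0" using n(2) assms by (auto simp: cycles_def)
  then have "(\<lambda>c. int n * boundary E B i x c) = 0" by (simp add: boundary_eq mat_apply_scale)
  then have "boundary E B i x = 0" using n(1) by (auto simp: fun_eq_iff)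
  then show "x \<in> {x \<in> cycles E B i. \<exists>n::nat. 0 < n \<and> (\<lambda>c. int n * x c) \<in> H}"
    using x n by (auto simp: cycles_def cell_chains_eq)
qed (auto simp: saturation_def cycles_def cell_chains_eq)

text \<open>Replacing the facets by \<open>U\<close> changes the boundaries but not the cycles one
  dimension lower, which involve only the cells of dimensions \<open>d - 1\<close> and
  \<open>d - 2\<close>.\<close>

lemma torsion_number_eq:
  assumes U: "U \<subseteq> E d" and fin: "finite (E d)"
    and dd: "\<And>x. x \<in> cell_chains E d \<Longrightarrow> boundary E B (d - 1) (boundary E B d x) = 0"
  shows "torsion_number (E(d := U)) B (d - 1) =
    lattice_index (saturation (E (d - 1)) (mat_apply (E (d - 1)) U (\<lambda>f c. B c f) ` int_vectors U))
      (mat_apply (E (d - 1)) U (\<lambda>f c. B c f) ` int_vectors U)"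
proof -
  let ?H = "mat_apply (E (d - 1)) U (\<lambda>f c. B c f) ` int_vectors U"
  have cyc: "cycles (E(d := U)) B (d - 1) = cycles E B (d - 1)"
    by (simp add: cycles_def cell_chains_eq boundary_eq)
  have H: "?H \<subseteq> cycles E B (d - 1)"
  proof
    fix y assume "y \<in> ?H"
    then obtain x where x: "x \<in> int_vectors U" "y = mat_apply (E (d - 1)) U (\<lambda>f c. B c f) x" by blast
    have xd: "x \<in> cell_chains E d" using x(1) U by (auto simp: cell_chains_eq int_vectors_def)
    have "(\<Sum>c\<in>U. B c f * x c) = (\<Sum>c\<in>E d. B c f * x c)" for f
      by (rule sum.mono_neutral_left[OF fin U]) (use x(1) in \<open>auto simp: int_vectors_def\<close>)
    then have "y = boundary E B d x" unfolding x(2) boundary_eq mat_apply_def by (simp only:)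
    then show "y \<in> cycles E B (d - 1)"
      using dd[OF xd] mat_apply_in_int_vectors[of "E (d - 1)" U "\<lambda>f c. B c f" x] x(2)
      by (simp add: cycles_def cell_chains_eq)
  qed
  show ?thesis
    unfolding torsion_number_def cellular_homology_def cyc
    by (simp add: boundary_eq cell_chains_eq
        order_torsion_part[OF add_subgroup_cycles add_subgroup_mat_apply_image H] torsion_eq_saturation[OF H])
qed

text \<open>\<open>N\<close> consists of the new cells and \<open>D\<close> of their boundaries,
  transported back along \<open>j\<close>. Trivial homology in dimension \<open>d + 1\<close> makes
  \<open>D\<close> injective, and in dimension \<open>d\<close> it makes \<open>D\<close> onto the
  cycles. The cocritical group is then the cokernel of the Gram matrix of \<open>D\<close>.\<close>

lemma chain_acyclization_flow_basis:
  fixes E :: "int \<Rightarrow> 'b set" and E' :: "int \<Rightarrow> 't set"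
  assumes fin: "finite (E d)" and acyc: "chain_acyclization d E B E' A"
  obtains N :: "'t set" and D where "finite N"
    "\<And>z. z \<in> int_vectors N \<Longrightarrow> mat_apply (E d) N D z = 0 \<Longrightarrow> z = 0"
    "cycles E B d = mat_apply (E d) N D ` int_vectors N"
    "order (cocritical_group E' A d) = lattice_index (int_vectors N)
       ((\<lambda>x. mat_apply N (E d) (\<lambda>n c. D c n) (mat_apply (E d) N D x)) ` int_vectors N)"
proof -
  obtain j where j: "\<And>i. i \<le> d \<Longrightarrow> bij_betw j (E i) (E' i)"
    and AB: "\<And>c f. c \<in> E d \<Longrightarrow> f \<in> E (d - 1) \<Longrightarrow> A (j c) (j f) = B c f"
    and N: "finite (E' (d + 1))" and top: "E' (d + 2) = {}"
    and dd: "\<And>x. x \<in> cell_chains E' (d + 1) \<Longrightarrow> boundary E' A d (boundary E' A (d + 1) x) = 0"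
    and H1: "trivial_group (cellular_homology E' A (d + 1))" and H0: "trivial_group (cellular_homology E' A d)"
    using acyc unfolding chain_acyclization_def by (metis order_refl add_less_cancel_left one_less_numeral_iff semiring_norm(76))
  let ?N = "E' (d + 1)" and ?bd = "boundary E' A (d + 1)"
  define D where "D c n = A n (j c)" for c n
  have bij: "bij_betw j (E d) (E' d)" and bij1: "bij_betw j (E (d - 1)) (E' (d - 1))" using j by auto
  have D: "mat_apply (E d) ?N D z = (\<lambda>c. if c \<in> E d then ?bd z (j c) else 0)" for z
    using bij by (auto simp: boundary_def mat_apply_def D_def bij_betw_def fun_eq_iff)
  \<comment> \<open>There are no cells of dimension \<open>d + 2\<close>, so trivial homology leaves
    no nonzero cycle.\<close>
  have cyc1: "cycles E' A (d + 1) \<subseteq> {0}"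
  proof -
    have "cycles E' A (d + 1) \<subseteq> boundary E' A (d + 1 + 1) ` cell_chains E' (d + 1 + 1)"
      by (rule trivial_additive_Mod[OF add_subgroup_cycles _ H1[unfolded cellular_homology_def]])
        (simp add: boundary_eq cell_chains_eq add_subgroup_mat_apply_image)
    then show ?thesis using top by (auto simp: boundary_def fun_eq_iff add.assoc)
  qed
  have cyc0: "cycles E' A d \<subseteq> ?bd ` cell_chains E' (d + 1)"
    by (rule trivial_additive_Mod[OF add_subgroup_cycles _ H0[unfolded cellular_homology_def]])
      (simp add: boundary_eq cell_chains_eq add_subgroup_mat_apply_image)
  have bd_j: "boundary E' A d y (j f) = boundary E B d x f"
    if "f \<in> E (d - 1)" "\<And>c. c \<in> E d \<Longrightarrow> y (j c) = x c" for x y f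
  proof -
    have "(\<Sum>c'\<in>E' d. A c' (j f) * y c') = (\<Sum>c\<in>E d. A (j c) (j f) * y (j c))"
      by (rule sum.reindex_bij_betw[OF bij, symmetric])
    also have "\<dots> = (\<Sum>c\<in>E d. B c f * x c)" by (intro sum.cong refl) (simp add: AB that)
    finally show ?thesis using that(1) bij1 by (auto simp: boundary_def bij_betw_def)
  qed
  show thesis
  proof (rule that[OF N])
    fix z assume z: "z \<in> int_vectors ?N" "mat_apply (E d) ?N D z = 0"
    have "?bd z = 0"
    proof
      fix c' show "?bd z c' = 0 c'"
      proof (cases "c' \<in> E' d")
        case True
        then obtain c where "c \<in> E d" "c' = j c" using bij by (auto simp: bij_betw_def)
        then show ?thesis using fun_cong[OF z(2), of c] unfolding D by simp
      qed (simp add: boundary_def)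
    qed
    then have "z \<in> cycles E' A (d + 1)" using z(1) by (simp add: cycles_def cell_chains_eq)
    then show "z = 0" using cyc1 by blast
  next
    show "cycles E B d = mat_apply (E d) ?N D ` int_vectors ?N"
    proof (intro equalityI subsetI)
      fix x assume x: "x \<in> cycles E B d"
      define y where "y c' = (if c' \<in> E' d then x (inv_into (E d) j c') else 0)" for c'
      have yj: "y (j c) = x c" if "c \<in> E d" for c
        using that bij by (auto simp: y_def bij_betw_def)
      have "boundary E' A d y f' = 0" for f'
      proof (cases "f' \<in> E' (d - 1)")
        case True
        then obtain f where "f \<in> E (d - 1)" "f' = j f" using bij1 by (auto simp: bij_betw_def)
        then show ?thesis using bd_j[of f y x] yj x by (simp add: cycles_def)
      qed (simp add: boundary_def)
      then have "y \<in> cycles E' A d" by (auto simp: cycles_def cell_chains_def y_def fun_eq_iff)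
      then obtain z where z: "z \<in> cell_chains E' (d + 1)" "y = ?bd z" using cyc0 by blast
      have "x = mat_apply (E d) ?N D z"
        unfolding D z(2)[symmetric] using yj x by (auto simp: cycles_def cell_chains_def fun_eq_iff)
      then show "x \<in> mat_apply (E d) ?N D ` int_vectors ?N" using z(1) by (simp add: cell_chains_eq)
    next
      fix x assume "x \<in> mat_apply (E d) ?N D ` int_vectors ?N"
      then obtain z where z: "z \<in> cell_chains E' (d + 1)" "x = mat_apply (E d) ?N D z"
        by (auto simp: cell_chains_eq)
      have "boundary E B d x f = 0" for f
      proof (cases "f \<in> E (d - 1)")
        case True
        then show ?thesis using bd_j[of f "?bd z" x] dd[OF z(1)] z(2) unfolding D by simp
      qed (simp add: boundary_def)
      then have "boundary E B d x = 0" by (intro ext) simp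
      moreover have "x \<in> int_vectors (E d)" unfolding z(2) by (rule mat_apply_in_int_vectors)
      ultimately show "x \<in> cycles E B d" by (simp add: cycles_def cell_chains_eq)
    qed
  next
    have "coboundary E' A (d + 1) (?bd x) = mat_apply ?N (E d) (\<lambda>n c. D c n) (mat_apply (E d) ?N D x)" for x
    proof -
      have "(\<Sum>f\<in>E' d. A n f * ?bd x f) = (\<Sum>c\<in>E d. A n (j c) * ?bd x (j c))" for n
        by (rule sum.reindex_bij_betw[OF bij, symmetric])
      then show ?thesis unfolding D by (simp add: coboundary_def mat_apply_def D_def fun_eq_iff)
    qed
    then show "order (cocritical_group E' A d) = lattice_index (int_vectors ?N)
       ((\<lambda>x. mat_apply ?N (E d) (\<lambda>n c. D c n) (mat_apply (E d) ?N D x)) ` int_vectors ?N)"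
      by (simp add: cocritical_group_def lattice_index_def cell_chains_eq)
  qed
qed

text \<open>The purely algebraic form: topology will supply the vanishing of the double boundary and
  the comparison with a CW acyclization.\<close>

theorem critical_groups_of_chain_complex:
  fixes E :: "int \<Rightarrow> 'b set" and B :: "'b \<Rightarrow> 'b \<Rightarrow> int" and E' :: "int \<Rightarrow> 't set"
  assumes fin: "finite (E d)" "finite (E (d - 1))"
    and dd: "\<And>x. x \<in> cell_chains E d \<Longrightarrow> boundary E B (d - 1) (boundary E B d x) = 0"
  defines "C \<equiv> cut_lattice E B d" and "F \<equiv> flow_lattice E B d"
    and "\<tau> \<equiv> complexity E B d" and "t \<equiv> torsion_number E B (d - 1)"
  shows "order (discriminant_group (E d) C) = order (critical_group E B d)"
    and "order (critical_group E B d) = \<tau>"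
    and "real (order (additive_group (cell_chains E d) Mod {x + y | x y. x \<in> C \<and> y \<in> F})) = real \<tau> / real t"
    and "real (order (discriminant_group (E d) F)) = real \<tau> / (real t)\<^sup>2"
    and "chain_acyclization d E B E' A \<Longrightarrow>
      order (discriminant_group (E d) F) = order (cocritical_group E' A d)"
proof -
  let ?S = "E (d - 1)" and ?T = "E d" and ?M = "\<lambda>f c. B c f"
  obtain r p p' q q' where "matrix_bases ?S ?T ?M r p p' q q'"
    by (rule matrix_bases_exist[OF fin(2,1)])
  then interpret X: matrix_bases ?S ?T ?M r p p' q q' .
  have bd: "boundary E B d = X.bd" and cobd: "coboundary E B d = X.cobd"
    by (simp_all add: boundary_eq coboundary_eq)
  have C: "C = X.cobd ` int_vectors ?S" by (simp add: C_def cut_lattice_def cobd cell_chains_eq)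
  have F: "F = X.F" by (simp add: F_def flow_lattice_def cycles_def bd cell_chains_eq)
  have tt: "t = nat \<bar>sq_det r X.t\<bar>"
    using torsion_number_eq[of "E d" E d B, OF order_refl fin(1) dd] X.index_L_bd
    by (simp add: t_def)
  have G: "sq_det r X.G > 0" by (rule X.det_G_pos)
  have "int \<tau> = (\<Sum>U | X.forest U. (int (lattice_index X.L (mat_apply ?S U ?M ` int_vectors U)))\<^sup>2)"
  proof -
    have col: "boundary_column E B d = X.real_col"
      by (simp add: boundary_column_def X.real_col_def fun_eq_iff)
    have "{U. spanning_forest E B d U} = {U. X.forest U}"
      unfolding spanning_forest_def col X.forest_iff ..
    moreover have "torsion_number (E(d := U)) B (d - 1)
        = lattice_index X.L (mat_apply ?S U ?M ` int_vectors U)" if "X.forest U" for U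
      using torsion_number_eq[of U E d B, OF _ fin(1) dd] that X.forest_lattice(1)[OF that]
      by (simp add: X.forest_def)
    ultimately show ?thesis by (simp add: \<tau>_def complexity_def)
  qed
  also have "\<dots> = (sq_det r X.t)\<^sup>2 * sq_det r X.G" by (rule X.sum_forests)
  finally have tau: "int \<tau> = (sq_det r X.t)\<^sup>2 * sq_det r X.G" .
  have t2: "(real t)\<^sup>2 * real_of_int (sq_det r X.G) = real \<tau>"
  proof -
    have "(int t)\<^sup>2 * sq_det r X.G = int \<tau>" using tau tt by simp
    then have "real_of_int ((int t)\<^sup>2 * sq_det r X.G) = real_of_int (int \<tau>)" by (rule arg_cong)
    then show ?thesis by simp
  qed
  \<comment> \<open>Positivity makes the divisions by \<open>t\<close> genuine, away from the
    convention \<open>x / 0 = 0\<close>.\<close>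
  have t0: "real t > 0" using tt X.det_t by simp
  have H: "(\<lambda>y. boundary E B d (coboundary E B d y)) ` cell_chains E (d - 1)
      = (\<lambda>y. X.bd (X.cobd y)) ` int_vectors ?S"
    by (simp add: bd cobd cell_chains_eq)
  have Hc: "(\<lambda>y. X.bd (X.cobd y)) ` int_vectors ?S \<subseteq> cycles E B (d - 1)"
  proof (rule image_subsetI)
    fix y
    have "X.cobd y \<in> cell_chains E d" unfolding cell_chains_eq by (rule mat_apply_in_int_vectors)
    then have "boundary E B (d - 1) (X.bd (X.cobd y)) = 0" unfolding bd[symmetric] by (rule dd)
    then show "X.bd (X.cobd y) \<in> cycles E B (d - 1)"
      by (simp add: cycles_def cell_chains_eq mat_apply_in_int_vectors)
  qed
  have sgH: "add_subgroup ((\<lambda>y. X.bd (X.cobd y)) ` int_vectors ?S)"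
    by (intro add_subgroup_image add_subgroup_int_vectors) (simp add: mat_apply_diff)
  have K: "order (critical_group E B d) = nat ((sq_det r X.t)\<^sup>2 * \<bar>sq_det r X.G\<bar>)"
    unfolding critical_group_def H order_torsion_part[OF add_subgroup_cycles sgH Hc]
      torsion_eq_saturation[OF Hc] X.saturation_bd_cobd by (rule X.index_L_bd_cobd)
  show "order (discriminant_group (E d) C) = order (critical_group E B d)"
    unfolding C K by (rule X.order_discriminant_cut)
  show "order (critical_group E B d) = \<tau>" using K tau G by simp
  have "order (additive_group (cell_chains E d) Mod {x + y | x y. x \<in> C \<and> y \<in> F})
      = nat (\<bar>sq_det r X.t\<bar> * \<bar>sq_det r X.G\<bar>)"
    using X.index_cut_flow unfolding C F lattice_index_def cell_chains_eq .
  then have "real (order (additive_group (cell_chains E d) Mod {x + y | x y. x \<in> C \<and> y \<in> F}))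
      = real t * real_of_int (sq_det r X.G)"
    using tt G by (simp add: nat_mult_distrib)
  then show "real (order (additive_group (cell_chains E d) Mod {x + y | x y. x \<in> C \<and> y \<in> F})) = real \<tau> / real t"
    unfolding t2[symmetric] using t0 by (simp add: power2_eq_square)
  have oF: "order (discriminant_group (E d) F) = nat \<bar>sq_det r X.G\<bar>"
    unfolding F by (rule X.order_discriminant_flow)
  then show "real (order (discriminant_group (E d) F)) = real \<tau> / (real t)\<^sup>2"
    unfolding t2[symmetric] using t0 G by simp
  assume "chain_acyclization d E B E' A"
  from chain_acyclization_flow_basis[OF fin(1) this] obtain N :: "'t set" and D where
    N: "finite N" and inj: "\<And>z. z \<in> int_vectors N \<Longrightarrow> mat_apply (E d) N D z = 0 \<Longrightarrow> z = 0"
    and im: "cycles E B d = mat_apply (E d) N D ` int_vectors N"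
    and o: "order (cocritical_group E' A d) = lattice_index (int_vectors N)
       ((\<lambda>x. mat_apply N (E d) (\<lambda>n c. D c n) (mat_apply (E d) N D x)) ` int_vectors N)"
    by blast
  have "X.F = mat_apply (E d) N D ` int_vectors N"
    using im F unfolding F_def flow_lattice_def by simp
  from X.order_discriminant_flow_basis[OF N inj this]
  show "order (discriminant_group (E d) F) = order (cocritical_group E' A d)"
    unfolding F o .
qed

subsection \<open>The homology of the disc relative to its boundary\<close>

text \<open>As a subspace of a product, the disc admits coordinatewise continuity proofs.\<close>

lemma disc_topology_powertop:
  "disc_topology k = subtopology (powertop_real UNIV) {x. (\<forall>i\<ge>k. x i = 0) \<and> (\<Sum>i<k. (x i)\<^sup>2) \<le> 1}"
  by (simp add: disc_topology_def Euclidean_space_def subtopology_subtopology Collect_conj_eq)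

lemma topspace_disc: "topspace (disc_topology k) = {x. (\<forall>i\<ge>k. x i = 0) \<and> (\<Sum>i<k. (x i)\<^sup>2) \<le> 1}"
  by (simp add: disc_topology_powertop)

lemma disc_boundary_eq: "disc_boundary k = {x. (\<forall>i\<ge>k. x i = 0) \<and> (\<Sum>i<k. (x i)\<^sup>2) = 1}"
  by (auto simp: disc_boundary_def topspace_disc)

lemma disc_boundary_subset: "disc_boundary k \<subseteq> topspace (disc_topology k)"
  by (auto simp: disc_boundary_def)

lemma continuous_map_disc_coordinate: "continuous_map (disc_topology k) euclideanreal (\<lambda>x. x i)"
  unfolding disc_topology_powertop
  by (blast intro: continuous_map_from_subtopology continuous_map_product_projection)

lemma continuous_map_disc_norm: "continuous_map (disc_topology k) euclideanreal (\<lambda>x. \<Sum>i<k. (x i)\<^sup>2)"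
  by (intro continuous_intros continuous_map_disc_coordinate) auto

lemma zero_in_disc: "(\<lambda>_. 0) \<in> topspace (disc_topology k)" "(\<lambda>_. 0) \<notin> disc_boundary k"
  by (auto simp: topspace_disc disc_boundary_eq)

text \<open>The disc is a closed subset of a product of compact intervals.\<close>

lemma compact_disc: "compact_space (disc_topology k)"
proof -
  let ?P = "powertop_real (UNIV :: nat set)"
  let ?D = "{x :: nat \<Rightarrow> real. (\<forall>i\<ge>k. x i = 0) \<and> (\<Sum>i<k. (x i)\<^sup>2) \<le> 1}"
  have "compactin ?P (PiE UNIV (\<lambda>_. {-1..1::real}))"
    by (simp add: compactin_PiE)
  moreover have "?D \<subseteq> PiE UNIV (\<lambda>_. {-1..1::real})"
  proof
    fix x assume x: "x \<in> ?D"
    have "\<bar>x i\<bar> \<le> 1" for i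
    proof (cases "i < k")
      case True
      then have "(x i)\<^sup>2 \<le> (\<Sum>i<k. (x i)\<^sup>2)" by (intro member_le_sum) auto
      then have "(x i)\<^sup>2 \<le> 1" using x by simp
      then show ?thesis by (simp add: abs_square_le_1)
    qed (use x in auto)
    then have "- 1 \<le> x i \<and> x i \<le> 1" for i by (metis abs_le_iff minus_le_iff)
    then show "x \<in> PiE UNIV (\<lambda>_. {-1..1::real})" by auto
  qed
  moreover have "closedin ?P ?D"
  proof -
    have "continuous_map ?P euclideanreal (\<lambda>x. \<Sum>i<k. (x i)\<^sup>2)"
      by (intro continuous_intros continuous_map_product_projection) auto
    then have "closedin ?P {x \<in> topspace ?P. (\<Sum>i<k. (x i)\<^sup>2) \<in> {..1}}"
      by (rule closedin_continuous_map_preimage) simp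
    then have "closedin ?P (topspace (Euclidean_space k) \<inter> {x \<in> topspace ?P. (\<Sum>i<k. (x i)\<^sup>2) \<in> {..1}})"
      by (intro closedin_Int closedin_Euclidean_space)
    also have "topspace (Euclidean_space k) \<inter> {x \<in> topspace ?P. (\<Sum>i<k. (x i)\<^sup>2) \<in> {..1}} = ?D"
      by (auto simp: topspace_Euclidean_space)
    finally show ?thesis .
  qed
  ultimately have "compactin ?P ?D" by (rule closed_compactin)
  then show ?thesis unfolding disc_topology_powertop by (rule compact_space_subtopology)
qed

lemma Hausdorff_disc: "Hausdorff_space (disc_topology k)"
  unfolding disc_topology_def by (intro Hausdorff_space_subtopology Hausdorff_Euclidean_space)

lemma closedin_disc_boundary: "closedin (disc_topology k) (disc_boundary k)"
proof -
  have "closedin (disc_topology k) {x \<in> topspace (disc_topology k). (\<Sum>i<k. (x i)\<^sup>2) \<in> {1}}"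
    by (rule closedin_continuous_map_preimage[OF continuous_map_disc_norm]) simp
  then show ?thesis by (simp add: disc_boundary_def)
qed

text \<open>Contraction along rays to the origin.\<close>

lemma contractible_disc: "contractible_space (disc_topology k)"
proof -
  let ?h = "\<lambda>(t, x) i. (1 - t) * x i"
  have "continuous_map (prod_topology (top_of_set {0..1}) (disc_topology k)) (disc_topology k) ?h"
    unfolding disc_topology_powertop[of k] continuous_map_in_subtopology
  proof (intro conjI)
    show "continuous_map (prod_topology (top_of_set {0..1}) (subtopology (powertop_real UNIV)
        {x. (\<forall>i\<ge>k. x i = 0) \<and> (\<Sum>i<k. (x i)\<^sup>2) \<le> 1})) (powertop_real UNIV) ?h"
      unfolding disc_topology_powertop[symmetric] continuous_map_componentwise_UNIV case_prod_unfold
    proof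
      fix i
      have "continuous_map (prod_topology (top_of_set {0..1}) (disc_topology k)) euclideanreal (\<lambda>z. snd z i)"
        using continuous_map_compose[OF continuous_map_snd continuous_map_disc_coordinate] by (simp add: o_def)
      moreover have "continuous_map (prod_topology (top_of_set {0..1}) (disc_topology k)) euclideanreal (fst :: real \<times> _ \<Rightarrow> real)"
        by (rule continuous_map_into_fulltopology[OF continuous_map_fst])
      ultimately show "continuous_map (prod_topology (top_of_set {0..1}) (disc_topology k)) euclideanreal
          (\<lambda>z. (1 - fst z) * snd z i)"
        by (intro continuous_intros)
    qed
    have "(\<Sum>i<k. ((1 - t) * x i)\<^sup>2) \<le> 1" if "0 \<le> t" "t \<le> 1" "(\<Sum>i<k. (x i)\<^sup>2) \<le> 1" for t :: real and x
    proof -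
      have "(\<Sum>i<k. ((1 - t) * x i)\<^sup>2) = (1 - t)\<^sup>2 * (\<Sum>i<k. (x i)\<^sup>2)"
        by (simp add: power_mult_distrib sum_distrib_left)
      also have "\<dots> \<le> 1 * 1"
        by (rule mult_mono) (use that in \<open>auto simp: sum_nonneg abs_square_le_1\<close>)
      finally show ?thesis by simp
    qed
    then show "?h \<in> topspace (prod_topology (top_of_set {0..1}) (subtopology (powertop_real UNIV)
        {x. (\<forall>i\<ge>k. x i = 0) \<and> (\<Sum>i<k. (x i)\<^sup>2) \<le> 1})) \<rightarrow> {x. (\<forall>i\<ge>k. x i = 0) \<and> (\<Sum>i<k. (x i)\<^sup>2) \<le> 1}"
      by auto
  qed
  moreover have "?h (0, x) = x" "?h (1, x) = (\<lambda>_. 0)" for x :: "nat \<Rightarrow> real" by auto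
  ultimately show ?thesis
    unfolding contractible_space_def
    by (intro exI[of _ "\<lambda>_. 0"]) (auto simp: homotopic_with intro!: exI[of _ ?h])
qed

lemma subtopology_disc_boundary: "subtopology (disc_topology (Suc n)) (disc_boundary (Suc n)) = nsphere n"
proof -
  have "{x. (\<forall>i\<ge>Suc n. x i = 0) \<and> (\<Sum>i<Suc n. (x i)\<^sup>2) \<le> 1} \<inter> disc_boundary (Suc n)
      = {x. (\<Sum>i\<le>n. (x i)\<^sup>2) = 1 \<and> (\<forall>i>n. x i = (0 :: real))}"
    unfolding disc_boundary_eq lessThan_Suc_atMost by (auto simp: Suc_le_eq)
  then show ?thesis
    unfolding disc_topology_powertop subtopology_subtopology nsphere by simp
qed

text \<open>Radial projection, defined off the origin. It makes the homology of the sphere inject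
  into that of the punctured disc.\<close>

lemma retract_disc_boundary:
  "disc_boundary k retract_of_space subtopology (disc_topology k) (topspace (disc_topology k) - {\<lambda>_. 0})"
proof -
  let ?X = "subtopology (disc_topology k) (topspace (disc_topology k) - {\<lambda>_. 0})"
  define r :: "(nat \<Rightarrow> real) \<Rightarrow> nat \<Rightarrow> real" where "r x = (\<lambda>i. x i / sqrt (\<Sum>j<k. (x j)\<^sup>2))" for x
  have pos: "(\<Sum>j<k. (x j)\<^sup>2) > 0" if "x \<in> topspace ?X" for x
  proof -
    have "x \<noteq> (\<lambda>_. 0)" "\<forall>i\<ge>k. x i = 0" using that by (auto simp: topspace_disc)
    then obtain i where "i < k" "x i \<noteq> 0" by (metis ext not_less)
    then show ?thesis by (intro sum_pos2[of _ i]) auto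
  qed
  have bd: "r x \<in> disc_boundary k" if "x \<in> topspace ?X" for x
  proof -
    have "(\<Sum>i<k. (x i / sqrt (\<Sum>j<k. (x j)\<^sup>2))\<^sup>2) = (\<Sum>i<k. (x i)\<^sup>2) / (\<Sum>j<k. (x j)\<^sup>2)"
      using pos[OF that] by (simp add: power_divide flip: sum_divide_distrib)
    then show ?thesis using pos[OF that] that by (simp add: r_def disc_boundary_eq topspace_disc)
  qed
  have ss: "disc_boundary k \<subseteq> topspace ?X" using disc_boundary_subset zero_in_disc(2) by auto
  have "continuous_map ?X (powertop_real UNIV) r"
    unfolding continuous_map_componentwise_UNIV r_def
  proof
    fix i
    show "continuous_map ?X euclideanreal (\<lambda>x. x i / sqrt (\<Sum>j<k. (x j)\<^sup>2))"
      by (intro continuous_intros continuous_map_from_subtopology continuous_map_disc_coordinate)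
        (use pos in fastforce)+
  qed
  moreover have "r \<in> topspace ?X \<rightarrow> {x. (\<forall>i\<ge>k. x i = 0) \<and> (\<Sum>i<k. (x i)\<^sup>2) \<le> 1}"
  proof (rule Pi_I)
    fix x assume "x \<in> topspace ?X"
    then have "r x \<in> topspace (disc_topology k)" by (rule subsetD[OF disc_boundary_subset bd])
    then show "r x \<in> {x. (\<forall>i\<ge>k. x i = 0) \<and> (\<Sum>i<k. (x i)\<^sup>2) \<le> 1}" by (simp only: topspace_disc)
  qed
  ultimately have "continuous_map ?X (disc_topology k) r"
    unfolding disc_topology_powertop[of k] by (simp add: continuous_map_in_subtopology)
  then have "continuous_map ?X (subtopology ?X (disc_boundary k)) r"
    using bd ss by (auto simp: continuous_map_in_subtopology)
  moreover have "r x = x" if "x \<in> disc_boundary k" for x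
    using that by (auto simp: r_def disc_boundary_eq)
  ultimately show ?thesis unfolding retract_of_space_def using ss by blast
qed

text \<open>As the disc is contractible, the connecting map to the reduced homology of the sphere is
  an isomorphism. This argument uses a nonempty sphere, so the one-point disc is treated
  separately.\<close>

lemma relative_homology_disc: "relative_homology_group (int k) (disc_topology k) (disc_boundary k) \<cong> integer_group"
proof (cases k)
  case 0
  have "topspace (disc_topology 0) = {\<lambda>_. 0}" by (auto simp: topspace_disc)
  moreover have "disc_boundary 0 = {}" by (auto simp: disc_boundary_eq)
  ultimately show ?thesis using homology_coefficients[of "disc_topology 0"] 0 by simp
next
  case (Suc n)
  have "topspace (disc_topology k) \<inter> disc_boundary k \<noteq> {}"
    using in_topspace_nsphere[of n] subtopology_disc_boundary[of n] Suc by (metis empty_iff topspace_subtopology)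
  then have "relative_homology_group (int k) (disc_topology k) (disc_boundary k)
      \<cong> reduced_homology_group (int k - 1) (subtopology (disc_topology k) (disc_boundary k))"
    by (rule isomorphic_group_relative_homology_of_contractible[OF contractible_disc])
  also have "\<dots> = reduced_homology_group (int n) (nsphere n)"
    using Suc by (simp add: subtopology_disc_boundary)
  also have "\<dots> \<cong> integer_group" by (rule reduced_homology_group_nsphere)
  finally show ?thesis .
qed

text \<open>Weaker than being a generator, but preserved by injective homomorphisms and enough to
  compare exponents.\<close>

definition infinite_order_in :: "'g monoid \<Rightarrow> 'g \<Rightarrow> bool" where
  "infinite_order_in G x \<longleftrightarrow> x \<in> carrier G \<and> (\<forall>n::int. x [^]\<^bsub>G\<^esub> n = \<one>\<^bsub>G\<^esub> \<longrightarrow> n = 0)"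

text \<open>The group is infinite cyclic, so the \<open>SOME\<close> in \<open>disc_class\<close>
  picks an actual generator.\<close>

lemma infinite_order_disc_class:
  "infinite_order_in (relative_homology_group (int k) (disc_topology k) (disc_boundary k)) (disc_class k)"
proof -
  let ?G = "relative_homology_group (int k) (disc_topology k) (disc_boundary k)"
  interpret G: group ?G by simp
  have inf: "infinite (carrier ?G)"
    using relative_homology_disc[of k] iso_finite by (metis carrier_integer_group infinite_UNIV_int)
  have "cyclic_group ?G"
    using relative_homology_disc[of k] isomorphic_group_cyclicity cyclic_integer_group group_integer_group
      G.group_axioms by blast
  then have "\<exists>g. g \<in> carrier ?G \<and> carrier (subgroup_generated ?G {g}) = carrier ?G"
    unfolding cyclic_group_def by metis
  then have g: "disc_class k \<in> carrier ?G" "carrier (subgroup_generated ?G {disc_class k}) = carrier ?G"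
    unfolding disc_class_def Let_def by (rule someI2_ex; blast)+
  have "G.ord (disc_class k) = 0" using G.infinite_cyclic_subgroup_order[OF g(1)] inf g(2) by simp
  then show ?thesis using g(1) G.int_pow_eq_id[OF g(1)] by (simp add: infinite_order_in_def)
qed

lemma infinite_order_inj_hom:
  assumes "infinite_order_in G x" "h \<in> hom G H" "inj_on h (carrier G)" "Group.group G" "Group.group H"
  shows "infinite_order_in H (h x)"
proof -
  have x: "x \<in> carrier G" using assms(1) by (simp add: infinite_order_in_def)
  have "n = 0" if "(h x) [^]\<^bsub>H\<^esub> n = \<one>\<^bsub>H\<^esub>" for n :: int
  proof -
    have "h (x [^]\<^bsub>G\<^esub> n) = h \<one>\<^bsub>G\<^esub>"
      using that hom_int_pow[OF assms(2) x assms(4,5)] hom_one[OF assms(2,4,5)] by simp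
    then have "x [^]\<^bsub>G\<^esub> n = \<one>\<^bsub>G\<^esub>"
      using assms(3,4) x by (meson Group.group.int_pow_closed group.is_monoid inj_onD monoid.one_closed)
    then show ?thesis using assms(1) by (simp add: infinite_order_in_def)
  qed
  then show ?thesis using x hom_in_carrier[OF assms(2) x] by (simp add: infinite_order_in_def)
qed

text \<open>By naturality, this map followed by a connecting map equals the connecting map of the
  sphere followed by the inclusion of the sphere into the punctured disc. Those two are injective,
  by contractibility and by the retraction, hence so is this map.\<close>

lemma inj_disc_minus_origin:
  "inj_on (hom_induced (int k) (disc_topology k) (disc_boundary k) (disc_topology k) (topspace (disc_topology k) - {\<lambda>_. 0}) id)
     (carrier (relative_homology_group (int k) (disc_topology k) (disc_boundary k)))"
proof (cases k)
  case 0
  \<comment> \<open>In dimension 0 both subspaces are empty and the induced map is the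
    identity.\<close>
  have eq: "disc_boundary k = {}" "topspace (disc_topology k) - {\<lambda>_. 0} = {}"
    using 0 by (auto simp: disc_boundary_eq topspace_disc)
  show ?thesis unfolding eq by (rule inj_onI) (simp add: hom_induced_id)
next
  case (Suc n)
  let ?D = "disc_topology k" and ?S = "disc_boundary k"
  let ?V = "topspace ?D - {\<lambda>_. 0}"
  have ne: "topspace ?D \<inter> ?S \<noteq> {}"
    using in_topspace_nsphere[of n] subtopology_disc_boundary[of n] Suc by (metis empty_iff topspace_subtopology)
  have SV: "?S \<subseteq> ?V" using disc_boundary_subset zero_in_disc(2) by auto
  have sub: "subtopology (subtopology ?D ?V) ?S = subtopology ?D ?S"
    using SV by (simp add: subtopology_subtopology Int_absorb1)
  have nat: "hom_boundary (int k) ?D ?V \<circ> hom_induced (int k) ?D ?S ?D ?V id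
       = hom_induced (int k - 1) (subtopology ?D ?S) {} (subtopology ?D ?V) {} id \<circ> hom_boundary (int k) ?D ?S"
    by (rule naturality_hom_induced) (use SV in auto)
  have "hom_boundary (int k) ?D ?S \<in> iso (relative_homology_group (int k) ?D ?S)
      (reduced_homology_group (int k - 1) (subtopology ?D ?S))"
    by (rule iso_relative_homology_of_contractible[OF contractible_disc ne])
  then have bij: "inj_on (hom_boundary (int k) ?D ?S) (carrier (relative_homology_group (int k) ?D ?S))"
    "hom_boundary (int k) ?D ?S ` carrier (relative_homology_group (int k) ?D ?S)
      \<subseteq> carrier (homology_group (int k - 1) (subtopology ?D ?S))"
    using carrier_reduced_homology_group_subset hom_boundary_carrier by (auto simp: iso_def bij_betw_def)
  have "inj_on (hom_induced (int k - 1) (subtopology ?D ?S) {} (subtopology ?D ?V) {} id)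
      (carrier (homology_group (int k - 1) (subtopology ?D ?S)))"
    using inj_on_hom_induced_inclusion[of ?S "subtopology ?D ?V" "int k - 1"] retract_disc_boundary[of k]
    unfolding sub by blast
  then have "inj_on (hom_induced (int k - 1) (subtopology ?D ?S) {} (subtopology ?D ?V) {} id \<circ> hom_boundary (int k) ?D ?S)
      (carrier (relative_homology_group (int k) ?D ?S))"
    by (intro comp_inj_on[OF bij(1)]) (rule inj_on_subset[OF _ bij(2)])
  then show ?thesis unfolding nat[symmetric] by (rule inj_on_imageI2)
qed

subsection \<open>Independence of the cell classes\<close>

lemma hom_finprod:
  assumes h: "h \<in> hom G H" and G: "comm_group G" and H: "comm_group H" and u: "u \<in> A \<rightarrow> carrier G"
  shows "h (finprod G u A) = finprod H (\<lambda>a. h (u a)) A"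
proof -
  interpret G: comm_group G by (rule G)
  interpret H: comm_group H by (rule H)
  have one: "h \<one>\<^bsub>G\<^esub> = \<one>\<^bsub>H\<^esub>" by (rule hom_one[OF h G.is_group H.is_group])
  show ?thesis using u
  proof (induction A rule: infinite_finite_induct)
    case (insert a A)
    have "(\<lambda>a. h (u a)) \<in> A \<rightarrow> carrier H" "h (u a) \<in> carrier H"
      using insert.prems hom_in_carrier[OF h] by auto
    then show ?case using insert by (simp add: hom_mult[OF h])
  qed (simp_all add: one)
qed

lemma finprod_single:
  assumes H: "comm_group H" and A: "finite A" "c \<in> A" and uc: "u c \<in> carrier H"
    and u: "\<And>f. f \<in> A \<Longrightarrow> f \<noteq> c \<Longrightarrow> u f = \<one>\<^bsub>H\<^esub>"
  shows "finprod H (\<lambda>f. u f [^]\<^bsub>H\<^esub> (n f :: int)) A = u c [^]\<^bsub>H\<^esub> n c"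
proof -
  interpret H: comm_group H by (rule H)
  have "finprod H (\<lambda>f. u f [^]\<^bsub>H\<^esub> n f) A = finprod H (\<lambda>f. if c = f then u f [^]\<^bsub>H\<^esub> n f else \<one>\<^bsub>H\<^esub>) A"
    by (rule H.finprod_cong') (use uc u in \<open>auto simp: Pi_iff\<close>)
  also have "\<dots> = u c [^]\<^bsub>H\<^esub> n c"
  proof -
    have "finprod H (\<lambda>f. if c = f then u c [^]\<^bsub>H\<^esub> n c else \<one>\<^bsub>H\<^esub>) A = u c [^]\<^bsub>H\<^esub> n c"
      by (rule H.finprod_singleton[OF A(2,1), of "\<lambda>_. u c [^]\<^bsub>H\<^esub> n c"]) (use uc in auto)
    moreover have "(\<lambda>f. if c = f then u f [^]\<^bsub>H\<^esub> n f else \<one>\<^bsub>H\<^esub>) = (\<lambda>f. if c = f then u c [^]\<^bsub>H\<^esub> n c else \<one>\<^bsub>H\<^esub>)"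
      by auto
    ultimately show ?thesis by simp
  qed
  finally show ?thesis .
qed

lemma finprod_int_pow:
  assumes H: "comm_group H" and y: "y \<in> carrier H" and A: "finite A"
  shows "finprod H (\<lambda>f. y [^]\<^bsub>H\<^esub> (n f :: int)) A = y [^]\<^bsub>H\<^esub> (\<Sum>f\<in>A. n f)"
proof -
  interpret H: comm_group H by (rule H)
  show ?thesis using A
    by (induction A rule: finite_induct) (simp_all add: y Pi_iff H.int_pow_mult)
qed

lemma infinite_order_int_pow_inj:
  assumes "infinite_order_in G x" "Group.group G" "x [^]\<^bsub>G\<^esub> m = x [^]\<^bsub>G\<^esub> (n :: int)"
  shows "m = n"
proof -
  interpret G: group G by (rule assms(2))
  have x: "x \<in> carrier G" using assms(1) by (simp add: infinite_order_in_def)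
  have "x [^]\<^bsub>G\<^esub> (m - n) = \<one>\<^bsub>G\<^esub>" using assms(3) x by (simp add: G.int_pow_diff)
  then show ?thesis using assms(1) by (auto simp: infinite_order_in_def)
qed

locale finite_cw_complex =
  fixes X :: "('a, 'c) cw"
  assumes finite_cw: "finite_cw X"
begin

abbreviation "disc c \<equiv> disc_topology (cw_dim X c)"
abbreviation "sphere_of c \<equiv> disc_boundary (cw_dim X c)"
abbreviation "cells_of k \<equiv> {f \<in> cw_cells X. int (cw_dim X f) = k}"
abbreviation "H_skel k \<equiv> relative_homology_group k (skel_topology X k) (skel X (k - 1))"

lemma finite_cells: "finite (cw_cells X)"
  and Hausdorff: "Hausdorff_space (cw_space X)"
  and topspace_eq: "topspace (cw_space X) = (\<Union>c \<in> cw_cells X. open_cell X c)"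
  and disjoint_cells: "disjoint_family_on (open_cell X) (cw_cells X)"
  and continuous_char: "c \<in> cw_cells X \<Longrightarrow> continuous_map (disc c) (cw_space X) (cw_char X c)"
  and inj_char: "c \<in> cw_cells X \<Longrightarrow> inj_on (cw_char X c) (topspace (disc c) - sphere_of c)"
  and char_boundary: "c \<in> cw_cells X \<Longrightarrow> cw_char X c ` sphere_of c \<subseteq> skel X (int (cw_dim X c) - 1)"
  using finite_cw by (auto simp: finite_cw_def)

lemma open_cell_subset_skel: "c \<in> cw_cells X \<Longrightarrow> int (cw_dim X c) \<le> k \<Longrightarrow> open_cell X c \<subseteq> skel X k"
  by (auto simp: skel_def)

lemma skel_mono: "k \<le> l \<Longrightarrow> skel X k \<subseteq> skel X l"
  unfolding skel_def by (rule UN_mono) auto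

lemma skel_subset: "skel X k \<subseteq> topspace (cw_space X)"
  by (auto simp: skel_def topspace_eq)

lemma topspace_skel: "topspace (skel_topology X k) = skel X k"
  using skel_subset by auto

lemma subtopology_skel: "l \<le> k \<Longrightarrow> subtopology (skel_topology X k) (skel X l) = skel_topology X l"
  using skel_mono by (simp add: subtopology_subtopology Int_absorb1)

lemma char_image_subset:
  assumes c: "c \<in> cw_cells X"
  shows "cw_char X c ` topspace (disc c) \<subseteq> open_cell X c \<union> skel X (int (cw_dim X c) - 1)"
  using char_boundary[OF c] by (auto simp: open_cell_def)

lemma char_image_subset_skel:
  assumes "c \<in> cw_cells X" "int (cw_dim X c) \<le> k"
  shows "cw_char X c ` topspace (disc c) \<subseteq> skel X k"
  using char_image_subset[OF assms(1)] open_cell_subset_skel[OF assms]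
    skel_mono[of "int (cw_dim X c) - 1" k] assms(2) by fastforce

lemma open_cell_disjoint_skel:
  assumes "c \<in> cw_cells X" "k < int (cw_dim X c)"
  shows "open_cell X c \<inter> skel X k = {}"
proof -
  have "open_cell X c \<inter> open_cell X f = {}" if "f \<in> cw_cells X" "int (cw_dim X f) \<le> k" for f
    using disjoint_cells that assms unfolding disjoint_family_on_def by force
  then show ?thesis by (auto simp: skel_def)
qed

lemma continuous_char_skel:
  assumes "c \<in> cw_cells X" "int (cw_dim X c) \<le> k"
  shows "continuous_map (disc c) (skel_topology X k) (cw_char X c)"
  using continuous_char[OF assms(1)] char_image_subset_skel[OF assms]
  by (auto simp: continuous_map_in_subtopology)

lemma closedin_char_image:
  assumes "c \<in> cw_cells X"
  shows "closedin (cw_space X) (cw_char X c ` topspace (disc c))"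
proof -
  have "compactin (cw_space X) (cw_char X c ` topspace (disc c))"
    by (rule image_compactin[OF _ continuous_char[OF assms]]) (use compact_disc in \<open>simp add: compact_space_def\<close>)
  then show ?thesis using Hausdorff compactin_imp_closedin by blast
qed

text \<open>The complement is the finite union of the other closed cells of dimension at most
  \<open>k\<close>: their boundaries lie in lower skeleta and so miss the open cell of
  \<open>c\<close>. Excision in the skeleton uses this.\<close>

lemma closedin_skel_minus_cell:
  assumes c: "c \<in> cw_cells X" "int (cw_dim X c) = k"
  shows "closedin (skel_topology X k) (skel X k - open_cell X c)"
proof -
  let ?A = "{f \<in> cw_cells X. int (cw_dim X f) \<le> k \<and> f \<noteq> c}"
  have "skel X k - open_cell X c = (\<Union>f\<in>?A. cw_char X f ` topspace (disc f))"
  proof (intro equalityI subsetI)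
    fix x assume "x \<in> skel X k - open_cell X c"
    then show "x \<in> (\<Union>f\<in>?A. cw_char X f ` topspace (disc f))"
      by (force simp: skel_def open_cell_def)
  next
    fix x assume "x \<in> (\<Union>f\<in>?A. cw_char X f ` topspace (disc f))"
    then obtain f where f: "f \<in> ?A" "x \<in> cw_char X f ` topspace (disc f)" by blast
    then have "x \<in> skel X k" using char_image_subset_skel[of f k] by blast
    moreover have "open_cell X c \<inter> open_cell X f = {}"
      using disjoint_cells f(1) c(1) unfolding disjoint_family_on_def by force
    moreover have "open_cell X c \<inter> skel X (int (cw_dim X f) - 1) = {}"
      by (rule open_cell_disjoint_skel) (use c f(1) in auto)
    ultimately show "x \<in> skel X k - open_cell X c" using f char_image_subset[of f] by blast
  qed
  moreover have "closedin (cw_space X) (\<Union>f\<in>?A. cw_char X f ` topspace (disc f))"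
    by (rule closedin_Union) (use finite_cells closedin_char_image in auto)
  ultimately show ?thesis by (metis Diff_subset closedin_subset_topspace)
qed

text \<open>A continuous map from a compact to a Hausdorff space is closed, and stays closed on a
  full preimage. The preimage of the open cell is exactly the open disc, since the sphere goes to a
  lower skeleton.\<close>

lemma homeomorphic_char:
  assumes c: "c \<in> cw_cells X" "int (cw_dim X c) = k"
  shows "homeomorphic_map (subtopology (disc c) (topspace (disc c) - sphere_of c))
    (subtopology (skel_topology X k) (open_cell X c)) (cw_char X c)"
proof -
  have cont: "continuous_map (disc c) (skel_topology X k) (cw_char X c)"
    using c by (intro continuous_char_skel) auto
  have "closed_map (disc c) (skel_topology X k) (cw_char X c)"
    by (rule T1_Spaces.continuous_imp_closed_map[OF cont compact_disc])
      (simp add: Hausdorff Hausdorff_space_subtopology)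
  moreover have pre: "{x \<in> topspace (disc c). cw_char X c x \<in> open_cell X c} = topspace (disc c) - sphere_of c"
    using char_boundary[OF c(1)] open_cell_disjoint_skel[OF c(1), of "int (cw_dim X c) - 1"]
    by (auto simp: open_cell_def)
  ultimately have cl: "closed_map (subtopology (disc c) (topspace (disc c) - sphere_of c))
      (subtopology (skel_topology X k) (open_cell X c)) (cw_char X c)"
    by (rule closed_map_restriction)
  have "continuous_map (subtopology (disc c) (topspace (disc c) - sphere_of c))
      (subtopology (skel_topology X k) (open_cell X c)) (cw_char X c)"
    using continuous_map_from_subtopology[OF cont, of "topspace (disc c) - sphere_of c"]
    by (auto simp: continuous_map_in_subtopology open_cell_def)
  moreover have "open_cell X c \<subseteq> skel X k" using c by (intro open_cell_subset_skel) auto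
  then have "cw_char X c ` topspace (subtopology (disc c) (topspace (disc c) - sphere_of c))
      = topspace (subtopology (skel_topology X k) (open_cell X c))"
    using skel_subset[of k] by (auto simp: open_cell_def)
  moreover have "inj_on (cw_char X c) (topspace (subtopology (disc c) (topspace (disc c) - sphere_of c)))"
    using inj_char[OF c(1)] by (rule inj_on_subset) auto
  ultimately show ?thesis using cl by (intro bijective_closed_imp_homeomorphic_map)
qed

section \<open>Local homology at the centre of a cell\<close>

definition "center c = cw_char X c (\<lambda>_. 0)"
definition "punctured c k = skel X k - {center c}"
text \<open>Serves as a coordinate functional that detects the coefficient of the cell
  \<open>c\<close>.\<close>

definition "local_class_map c k = hom_induced k (skel_topology X k) (skel X (k - 1)) (skel_topology X k) (punctured c k) id"

abbreviation "local_homology c k \<equiv> relative_homology_group k (skel_topology X k) (punctured c k)"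

lemma center_mem: "center c \<in> open_cell X c"
  using zero_in_disc by (auto simp: center_def open_cell_def)

lemma skel_subset_punctured: "c \<in> cw_cells X \<Longrightarrow> int (cw_dim X c) = k \<Longrightarrow> skel X (k - 1) \<subseteq> punctured c k"
  using center_mem[of c] open_cell_disjoint_skel[of c "k - 1"] skel_mono[of "k - 1" k]
  by (auto simp: punctured_def)

lemma cell_class_eq:
  "int (cw_dim X c) = k \<Longrightarrow> cell_class X c =
     hom_induced k (disc c) (sphere_of c) (skel_topology X k) (skel X (k - 1)) (cw_char X c) (disc_class (cw_dim X c))"
  by (auto simp: cell_class_def Let_def)

lemma cell_class_carrier: "int (cw_dim X c) = k \<Longrightarrow> cell_class X c \<in> carrier (H_skel k)"
  by (simp add: cell_class_eq hom_induced_carrier)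

lemma local_class_map_hom: "local_class_map c k \<in> hom (H_skel k) (local_homology c k)"
  unfolding local_class_map_def by (rule hom_induced_hom)

lemma local_class_cell:
  assumes c: "c \<in> cw_cells X" "int (cw_dim X c) = k" and f: "f \<in> cw_cells X" "int (cw_dim X f) = k"
  shows "local_class_map c k (cell_class X f) =
    hom_induced k (disc f) (sphere_of f) (skel_topology X k) (punctured c k) (cw_char X f) (disc_class (cw_dim X f))"
proof -
  have "local_class_map c k (cell_class X f) = hom_induced k (disc f) (sphere_of f)
      (skel_topology X k) (punctured c k) (id \<circ> cw_char X f) (disc_class (cw_dim X f))"
    unfolding local_class_map_def cell_class_eq[OF f(2)]
  proof (rule hom_induced_compose')
    show "continuous_map (disc f) (skel_topology X k) (cw_char X f)"
      using f by (intro continuous_char_skel) auto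
    show "cw_char X f \<in> sphere_of f \<rightarrow> skel X (k - 1)" using char_boundary[OF f(1)] f(2) by auto
    show "id \<in> skel X (k - 1) \<rightarrow> punctured c k" using skel_subset_punctured[OF c] by auto
  qed simp
  then show ?thesis by simp
qed

text \<open>The closed cell of \<open>f\<close> misses the centre of \<open>c\<close>, so its class
  factors through the homology of a disc relative to itself, which is trivial.\<close>

lemma local_class_other_cell:
  assumes c: "c \<in> cw_cells X" "int (cw_dim X c) = k" and f: "f \<in> cw_cells X" "int (cw_dim X f) = k"
    and ne: "f \<noteq> c"
  shows "local_class_map c k (cell_class X f) = \<one>\<^bsub>local_homology c k\<^esub>"
proof -
  let ?D = "disc f"
  have "center c \<notin> open_cell X f"
    using disjoint_cells center_mem[of c] c(1) f(1) ne unfolding disjoint_family_on_def by blast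
  moreover have "center c \<notin> skel X (k - 1)"
    using skel_subset_punctured[OF c] by (auto simp: punctured_def)
  ultimately have "cw_char X f ` topspace ?D \<subseteq> punctured c k"
    using char_image_subset[OF f(1)] char_image_subset_skel[OF f(1), of k] f(2) by (auto simp: punctured_def)
  then have "hom_induced k ?D (topspace ?D) (skel_topology X k) (punctured c k) (cw_char X f)
      (hom_induced k ?D (sphere_of f) ?D (topspace ?D) id (disc_class (cw_dim X f)))
     = hom_induced k ?D (sphere_of f) (skel_topology X k) (punctured c k) (cw_char X f \<circ> id) (disc_class (cw_dim X f))"
    using disc_boundary_subset[of "cw_dim X f"] continuous_char_skel[OF f(1), of k] f(2)
    by (intro hom_induced_compose') auto
  moreover have "hom_induced k ?D (sphere_of f) ?D (topspace ?D) id (disc_class (cw_dim X f))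
      = \<one>\<^bsub>relative_homology_group k ?D (topspace ?D)\<^esub>" (is "?u = ?one")
  proof -
    have "carrier (relative_homology_group k ?D (topspace ?D)) = {?one}"
      using trivial_relative_homology_group_topspace[of k ?D] unfolding trivial_group_def by (rule conjunct2)
    moreover have "?u \<in> carrier (relative_homology_group k ?D (topspace ?D))" by (rule hom_induced_carrier)
    ultimately show ?thesis by (simp only: singleton_iff)
  qed
  moreover have "hom_induced k ?D (topspace ?D) (skel_topology X k) (punctured c k) (cw_char X f)
      \<one>\<^bsub>relative_homology_group k ?D (topspace ?D)\<^esub> = \<one>\<^bsub>local_homology c k\<^esub>"
    by (rule hom_one[OF hom_induced_hom]) simp_all
  ultimately show ?thesis unfolding local_class_cell[OF c f] by simp
qed

lemma char_minus_origin:
  assumes c: "c \<in> cw_cells X" "int (cw_dim X c) = k"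
  shows "cw_char X c \<in> topspace (disc c) - {\<lambda>_. 0} \<rightarrow> punctured c k"
proof
  fix x assume x: "x \<in> topspace (disc c) - {\<lambda>_. 0}"
  have "cw_char X c x \<in> skel X k" using x char_image_subset_skel[of c k] c by auto
  moreover have "cw_char X c x \<noteq> center c"
  proof (cases "x \<in> sphere_of c")
    case True
    then have "cw_char X c x \<in> skel X (k - 1)" using char_boundary[OF c(1)] c(2) by auto
    then show ?thesis using skel_subset_punctured[OF c] by (auto simp: punctured_def)
  next
    case False
    then show ?thesis using inj_onD[OF inj_char[OF c(1)], of x "\<lambda>_. 0"] x zero_in_disc
      by (auto simp: center_def)
  qed
  ultimately show "cw_char X c x \<in> punctured c k" by (simp add: punctured_def)
qed

text \<open>Excising the sphere from the disc and the complement of the open cell from the skeleton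
  leaves two pairs that the characteristic map identifies homeomorphically; the excision
  isomorphisms carry this back.\<close>

lemma inj_char_local:
  assumes c: "c \<in> cw_cells X" "int (cw_dim X c) = k"
  shows "inj_on (hom_induced k (disc c) (topspace (disc c) - {\<lambda>_. 0}) (skel_topology X k) (punctured c k) (cw_char X c))
    (carrier (relative_homology_group k (disc c) (topspace (disc c) - {\<lambda>_. 0})))"
proof -
  let ?D = "disc c" and ?S = "sphere_of c" and ?Y = "skel_topology X k" and ?e = "open_cell X c"
    and ?V = "punctured c k" and ?\<Phi> = "cw_char X c"
  let ?PD = "topspace ?D - {\<lambda>_. 0}" and ?W = "skel X k - ?e" and ?B = "topspace ?D - ?S"
  have eY: "?e \<subseteq> skel X k" using c by (intro open_cell_subset_skel) auto
  have SV: "?S \<subseteq> ?PD" using disc_boundary_subset zero_in_disc(2) by auto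
  have WV: "?W \<subseteq> ?V" using center_mem[of c] by (auto simp: punctured_def)
  have open0: "openin ?D ?PD"
    using Hausdorff_disc zero_in_disc(1) by (intro openin_diff closedin_Hausdorff_singleton) auto
  have "center c \<in> topspace ?Y" using center_mem[of c] eY unfolding topspace_skel by blast
  then have "closedin ?Y {center c}"
    by (intro closedin_Hausdorff_singleton Hausdorff_space_subtopology Hausdorff)
  then have "openin ?Y (topspace ?Y - {center c})" by (rule openin_diff[OF openin_topspace])
  then have openV: "openin ?Y ?V" by (simp only: topspace_skel punctured_def)
  have e1: "hom_induced k (subtopology ?D ?B) (?PD - ?S) ?D ?PD id
      \<in> iso (relative_homology_group k (subtopology ?D ?B) (?PD - ?S)) (relative_homology_group k ?D ?PD)"
  proof -
    have "?D closure_of ?S \<subseteq> ?D interior_of ?PD"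
      using SV closedin_disc_boundary open0 by (simp add: closure_of_closedin interior_of_openin)
    from homology_excision_axiom[OF this, of "topspace ?D" k] show ?thesis by simp
  qed
  have e2: "hom_induced k (subtopology ?Y ?e) (?V - ?W) ?Y ?V id
      \<in> iso (relative_homology_group k (subtopology ?Y ?e) (?V - ?W)) (relative_homology_group k ?Y ?V)"
  proof -
    have "?Y closure_of ?W \<subseteq> ?Y interior_of ?V"
      using WV closedin_skel_minus_cell[OF c] openV by (simp add: closure_of_closedin interior_of_openin)
    moreover have "?V \<subseteq> topspace ?Y" unfolding topspace_skel by (auto simp: punctured_def)
    ultimately have "hom_induced k (subtopology ?Y (topspace ?Y - ?W)) (?V - ?W) (subtopology ?Y (topspace ?Y)) ?V id
      \<in> iso (relative_homology_group k (subtopology ?Y (topspace ?Y - ?W)) (?V - ?W))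
          (relative_homology_group k (subtopology ?Y (topspace ?Y)) ?V)"
      by (rule homology_excision_axiom)
    moreover have "topspace ?Y - ?W = ?e" using eY unfolding topspace_skel by blast
    ultimately show ?thesis by (simp only: subtopology_topspace)
  qed
  have img: "?\<Phi> ` (?PD - ?S) = ?V - ?W"
  proof -
    have "?PD - ?S = ?B - {\<lambda>_. 0}" by auto
    moreover have "?\<Phi> ` (?B - {\<lambda>_. 0}) = ?\<Phi> ` ?B - ?\<Phi> ` {\<lambda>_. 0}"
      using zero_in_disc by (intro inj_on_image_set_diff[OF inj_char[OF c(1)]]) auto
    moreover have "?V - ?W = ?e - {center c}" using eY by (auto simp: punctured_def)
    ultimately show ?thesis by (simp add: open_cell_def center_def)
  qed
  have h: "hom_induced k (subtopology ?D ?B) (?PD - ?S) (subtopology ?Y ?e) (?V - ?W) ?\<Phi>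
      \<in> iso (relative_homology_group k (subtopology ?D ?B) (?PD - ?S))
          (relative_homology_group k (subtopology ?Y ?e) (?V - ?W))"
    by (rule homeomorphic_map_relative_homology_iso[OF homeomorphic_char[OF c] _ img]) auto
  let ?F = "hom_induced k ?D ?PD ?Y ?V ?\<Phi>"
  have cont: "continuous_map ?D ?Y ?\<Phi>" using c by (intro continuous_char_skel) auto
  have \<Phi>V: "?\<Phi> \<in> ?PD \<rightarrow> ?V" by (rule char_minus_origin[OF c])
  have "?F \<circ> hom_induced k (subtopology ?D ?B) (?PD - ?S) ?D ?PD id
      = hom_induced k (subtopology ?D ?B) (?PD - ?S) ?Y ?V (?\<Phi> \<circ> id)"
    by (rule hom_induced_compose[symmetric]) (use cont \<Phi>V in \<open>auto intro: continuous_map_from_subtopology\<close>)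
  also have "\<dots> = hom_induced k (subtopology ?D ?B) (?PD - ?S) ?Y ?V (id \<circ> ?\<Phi>)" by simp
  also have "\<dots> = hom_induced k (subtopology ?Y ?e) (?V - ?W) ?Y ?V id
      \<circ> hom_induced k (subtopology ?D ?B) (?PD - ?S) (subtopology ?Y ?e) (?V - ?W) ?\<Phi>"
  proof (rule hom_induced_compose)
    show "continuous_map (subtopology ?D ?B) (subtopology ?Y ?e) ?\<Phi>"
      by (rule homeomorphic_imp_continuous_map[OF homeomorphic_char[OF c]])
    show "?\<Phi> \<in> ?PD - ?S \<rightarrow> ?V - ?W" using img by blast
  qed (auto intro: continuous_map_from_subtopology)
  finally have comp: "?F \<circ> hom_induced k (subtopology ?D ?B) (?PD - ?S) ?D ?PD id = \<dots>" .
  let ?G = "relative_homology_group k (subtopology ?D ?B) (?PD - ?S)"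
  have "inj_on (?F \<circ> hom_induced k (subtopology ?D ?B) (?PD - ?S) ?D ?PD id) (carrier ?G)"
    unfolding comp using h e2 by (intro comp_inj_on) (auto simp: iso_def bij_betw_def)
  \<comment> \<open>The excision map on the disc side is onto, so injectivity on its image is
    injectivity everywhere.\<close>
  then have "inj_on ?F (hom_induced k (subtopology ?D ?B) (?PD - ?S) ?D ?PD id ` carrier ?G)"
    by (rule inj_on_imageI)
  then show ?thesis using e1 by (simp add: iso_def bij_betw_def)
qed

text \<open>The class of the disc survives two injective maps: passing to the punctured disc and
  then applying the characteristic map.\<close>

lemma infinite_order_local_class:
  assumes c: "c \<in> cw_cells X" "int (cw_dim X c) = k"
  shows "infinite_order_in (local_homology c k) (local_class_map c k (cell_class X c))"
proof -
  let ?PD = "topspace (disc c) - {\<lambda>_. 0}" and ?g = "disc_class (cw_dim X c)"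
  let ?i = "hom_induced k (disc c) (sphere_of c) (disc c) ?PD id"
  let ?F = "hom_induced k (disc c) ?PD (skel_topology X k) (punctured c k) (cw_char X c)"
  have 1: "infinite_order_in (relative_homology_group k (disc c) ?PD) (?i ?g)"
    using infinite_order_inj_hom[OF infinite_order_disc_class[of "cw_dim X c"] hom_induced_hom
        inj_disc_minus_origin[of "cw_dim X c"]] c(2) by simp
  have "infinite_order_in (local_homology c k) (?F (?i ?g))"
    by (rule infinite_order_inj_hom[OF 1 hom_induced_hom inj_char_local[OF c]]) simp_all
  moreover have "?F (?i ?g) = local_class_map c k (cell_class X c)"
  proof -
    note char_minus_origin[OF c]
    moreover have "sphere_of c \<subseteq> ?PD" using disc_boundary_subset zero_in_disc(2) by auto
    ultimately have "?F (?i ?g) = hom_induced k (disc c) (sphere_of c) (skel_topology X k) (punctured c k)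
        (cw_char X c \<circ> id) ?g"
      using continuous_char_skel[OF c(1), of k] c(2) by (intro hom_induced_compose') auto
    then show ?thesis unfolding local_class_cell[OF c c] by simp
  qed
  ultimately show ?thesis by simp
qed

text \<open>Every factor except the one at \<open>c\<close> becomes trivial.\<close>

lemma local_class_finprod:
  assumes c: "c \<in> cw_cells X" "int (cw_dim X c) = k"
  shows "local_class_map c k (finprod (H_skel k) (\<lambda>f. cell_class X f [^]\<^bsub>H_skel k\<^esub> (n f :: int)) (cells_of k))
    = local_class_map c k (cell_class X c) [^]\<^bsub>local_homology c k\<^esub> n c"
proof -
  interpret H: comm_group "H_skel k" by simp
  interpret K: comm_group "local_homology c k" by simp
  have "local_class_map c k (finprod (H_skel k) (\<lambda>f. cell_class X f [^]\<^bsub>H_skel k\<^esub> n f) (cells_of k))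
      = finprod (local_homology c k) (\<lambda>f. local_class_map c k (cell_class X f [^]\<^bsub>H_skel k\<^esub> n f)) (cells_of k)"
    by (rule hom_finprod[OF local_class_map_hom]) (auto simp: cell_class_carrier)
  also have "\<dots> = finprod (local_homology c k)
      (\<lambda>f. local_class_map c k (cell_class X f) [^]\<^bsub>local_homology c k\<^esub> n f) (cells_of k)"
    by (rule K.finprod_cong')
      (auto simp: hom_int_pow[OF local_class_map_hom] cell_class_carrier hom_in_carrier[OF local_class_map_hom])
  also have "\<dots> = local_class_map c k (cell_class X c) [^]\<^bsub>local_homology c k\<^esub> n c"
    by (rule finprod_single)
      (use finite_cells c local_class_other_cell[OF c] in
        \<open>auto simp: hom_in_carrier[OF local_class_map_hom] cell_class_carrier\<close>)
  finally show ?thesis .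
qed

end

context finite_cw_complex
begin

lemma cell_class_pow_carrier: "f \<in> cells_of k \<Longrightarrow> cell_class X f [^]\<^bsub>H_skel k\<^esub> (n :: int) \<in> carrier (H_skel k)"
  by (simp add: cell_class_carrier group.int_pow_closed)

text \<open>Stating the hypothesis after the local map lets the exponent \<open>m\<close> come from
  a computation in another complex.\<close>

lemma cell_classes_independent:
  assumes c: "c \<in> cw_cells X" "int (cw_dim X c) = k"
    and eq: "local_class_map c k (finprod (H_skel k) (\<lambda>f. cell_class X f [^]\<^bsub>H_skel k\<^esub> (n f :: int)) (cells_of k))
      = local_class_map c k (cell_class X c) [^]\<^bsub>local_homology c k\<^esub> m"
  shows "n c = m"
  using infinite_order_int_pow_inj[OF infinite_order_local_class[OF c]] eq
  unfolding local_class_finprod[OF c] by simp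

subsection \<open>The cellular boundary of a boundary\<close>

text \<open>Recognising the connecting map of a triple of skeleta makes its homomorphism property
  and naturality available.\<close>

lemma cellular_boundary_relboundary:
  "cellular_boundary X k = hom_relboundary k (skel_topology X k) (skel X (k - 1)) (skel X (k - 2))"
  by (simp add: cellular_boundary_def hom_relboundary_def subtopology_skel fun_eq_iff)

lemma cellular_boundary_hom: "cellular_boundary X k \<in> hom (H_skel k) (H_skel (k - 1))"
  using group_homomorphism_hom_relboundary[of k "skel_topology X k" "skel X (k - 1)" "skel X (k - 2)"]
  by (simp add: cellular_boundary_relboundary subtopology_skel)

text \<open>The composite passes through two consecutive maps in the exact sequence of the skeleta
  of dimensions \<open>k - 1\<close> and \<open>k - 2\<close>.\<close>

lemma cellular_boundary_twice:
  "cellular_boundary X (k - 1) (cellular_boundary X k z) = \<one>\<^bsub>H_skel (k - 2)\<^esub>"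
proof -
  let ?Y = "skel_topology X (k - 1)" and ?S = "skel X (k - 2)"
  define w where "w = hom_boundary k (skel_topology X k) (skel X (k - 1)) z"
  have w: "w \<in> carrier (homology_group (k - 1) ?Y)"
    using hom_boundary_carrier[of k "skel_topology X k" "skel X (k - 1)" z]
    by (simp add: w_def subtopology_skel)
  have cb: "cellular_boundary X k z = hom_induced (k - 1) ?Y {} ?Y ?S id w"
    by (simp add: cellular_boundary_def w_def subtopology_skel)
  have ker: "kernel (relative_homology_group (k - 1) ?Y ?S) (homology_group (k - 1 - 1) (subtopology ?Y ?S))
      (hom_boundary (k - 1) ?Y ?S) = hom_induced (k - 1) ?Y {} ?Y ?S id ` carrier (homology_group (k - 1) ?Y)"
    using homology_exactness_axiom_1[of "k - 1" ?Y ?S] by simp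
  have "hom_induced (k - 1) ?Y {} ?Y ?S id w \<in> kernel (relative_homology_group (k - 1) ?Y ?S)
      (homology_group (k - 1 - 1) (subtopology ?Y ?S)) (hom_boundary (k - 1) ?Y ?S)"
    unfolding ker using w by (rule imageI)
  then have "hom_boundary (k - 1) ?Y ?S (hom_induced (k - 1) ?Y {} ?Y ?S id w)
      = \<one>\<^bsub>homology_group (k - 2) (skel_topology X (k - 2))\<^esub>"
    by (simp add: kernel_def subtopology_skel)
  then have "cellular_boundary X (k - 1) (cellular_boundary X k z)
      = hom_induced (k - 2) (skel_topology X (k - 2)) {} (skel_topology X (k - 2)) (skel X (k - 3)) id
          \<one>\<^bsub>homology_group (k - 2) (skel_topology X (k - 2))\<^esub>"
    unfolding cb by (simp add: cellular_boundary_def subtopology_skel)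
  also have "\<dots> = \<one>\<^bsub>H_skel (k - 2)\<^esub>" by (simp add: hom_one[OF hom_induced_hom])
  finally show ?thesis .
qed

lemma cellular_matrix_boundary:
  assumes "cellular_matrix X B" "c \<in> cw_cells X" "int (cw_dim X c) = k" "k \<ge> 1"
  shows "cellular_boundary X k (cell_class X c) =
    finprod (H_skel (k - 1)) (\<lambda>f. cell_class X f [^]\<^bsub>H_skel (k - 1)\<^esub> B (Some c) (Some f)) (cells_of (k - 1))"
proof -
  have "cw_dim X c \<ge> 1" using assms(3,4) by simp
  then show ?thesis
    using assms(1,2) unfolding cellular_matrix_def Let_def assms(3)[symmetric] by simp
qed

text \<open>\<psi> reads off the coefficient of \<open>g\<close> in a boundary. Applied to the
  boundary of \<open>c\<close> it gives the identity element, but also a power of a class of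
  infinite order whose exponent is the sum in question.\<close>

lemma matrix_square_cells:
  assumes B: "cellular_matrix X B" and k: "k \<ge> 2"
    and c: "c \<in> cw_cells X" "int (cw_dim X c) = k" and g: "g \<in> cw_cells X" "int (cw_dim X g) = k - 2"
  shows "(\<Sum>f\<in>cells_of (k - 1). B (Some f) (Some g) * B (Some c) (Some f)) = 0"
proof -
  let ?K = "local_homology g (k - 2)" and ?H = "H_skel (k - 1)"
  define y where "y = local_class_map g (k - 2) (cell_class X g)"
  define \<psi> where "\<psi> = local_class_map g (k - 2) \<circ> cellular_boundary X (k - 1)"
  interpret K: comm_group ?K by simp
  have inf: "infinite_order_in ?K y" unfolding y_def by (rule infinite_order_local_class[OF g])
  then have y: "y \<in> carrier ?K" by (simp add: infinite_order_in_def)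
  have cb: "cellular_boundary X (k - 1) \<in> hom ?H (H_skel (k - 2))"
    using cellular_boundary_hom[of "k - 1"] by simp
  have \<psi>: "\<psi> \<in> hom ?H ?K" unfolding \<psi>_def by (rule hom_compose[OF cb local_class_map_hom])
  have \<psi>f: "\<psi> (cell_class X f) = y [^]\<^bsub>?K\<^esub> B (Some f) (Some g)" if "f \<in> cells_of (k - 1)" for f
  proof -
    have "cellular_boundary X (k - 1) (cell_class X f) = finprod (H_skel (k - 2))
        (\<lambda>h. cell_class X h [^]\<^bsub>H_skel (k - 2)\<^esub> B (Some f) (Some h)) (cells_of (k - 2))"
      using cellular_matrix_boundary[OF B, of f "k - 1"] that k by simp
    then have "\<psi> (cell_class X f) = local_class_map g (k - 2) (finprod (H_skel (k - 2))
        (\<lambda>h. cell_class X h [^]\<^bsub>H_skel (k - 2)\<^esub> B (Some f) (Some h)) (cells_of (k - 2)))"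
      unfolding \<psi>_def comp_apply by (rule arg_cong)
    then show ?thesis unfolding y_def local_class_finprod[OF g] .
  qed
  have "\<one>\<^bsub>?K\<^esub> = local_class_map g (k - 2) \<one>\<^bsub>H_skel (k - 2)\<^esub>"
    by (rule hom_one[OF local_class_map_hom, symmetric]) simp_all
  also have "\<dots> = \<psi> (cellular_boundary X k (cell_class X c))"
    unfolding \<psi>_def by (simp add: cellular_boundary_twice)
  also have "\<dots> = \<psi> (finprod ?H (\<lambda>f. cell_class X f [^]\<^bsub>?H\<^esub> B (Some c) (Some f)) (cells_of (k - 1)))"
    using cellular_matrix_boundary[OF B c] k by simp
  also have "\<dots> = finprod ?K (\<lambda>f. \<psi> (cell_class X f [^]\<^bsub>?H\<^esub> B (Some c) (Some f))) (cells_of (k - 1))"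
    by (rule hom_finprod[OF \<psi>]) (rule abelian_relative_homology_group Pi_I cell_class_pow_carrier, assumption?)+
  also have "\<dots> = finprod ?K (\<lambda>f. y [^]\<^bsub>?K\<^esub> (B (Some f) (Some g) * B (Some c) (Some f))) (cells_of (k - 1))"
  proof (rule K.finprod_cong'[OF refl])
    fix f assume f: "f \<in> cells_of (k - 1)"
    have "\<psi> (cell_class X f [^]\<^bsub>?H\<^esub> B (Some c) (Some f)) = \<psi> (cell_class X f) [^]\<^bsub>?K\<^esub> B (Some c) (Some f)"
      by (rule hom_int_pow[OF \<psi> cell_class_carrier]) (use f in simp_all)
    also have "\<dots> = y [^]\<^bsub>?K\<^esub> (B (Some f) (Some g) * B (Some c) (Some f))"
      unfolding \<psi>f[OF f] by (rule K.int_pow_pow[OF y])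
    finally show "\<psi> (cell_class X f [^]\<^bsub>?H\<^esub> B (Some c) (Some f))
        = y [^]\<^bsub>?K\<^esub> (B (Some f) (Some g) * B (Some c) (Some f))" .
  qed (use y in auto)
  also have "\<dots> = y [^]\<^bsub>?K\<^esub> (\<Sum>f\<in>cells_of (k - 1). B (Some f) (Some g) * B (Some c) (Some f))"
    by (rule finprod_int_pow) (use y finite_cells in auto)
  finally show ?thesis using inf by (simp add: infinite_order_in_def)
qed

lemma skel_negative: "k < 0 \<Longrightarrow> skel X k = {}"
  by (auto simp: skel_def)

text \<open>In dimension 1 the augmentation \<open>H\<^sub>0(X\<^sub>0) \<rightarrow> H\<^sub>0(D\<^sup>0)\<close> replaces the local homology maps.\<close>

lemma augmentation_edge:
  assumes B: "cellular_matrix X B" and c: "c \<in> cw_cells X" "cw_dim X c = 1"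
  shows "(\<Sum>f\<in>cells_of 0. B (Some c) (Some f)) = 0"
proof -
  let ?D = "disc_topology 0" and ?H = "homology_group 0 (skel_topology X 0)"
  let ?K = "homology_group 0 ?D" and ?const = "\<lambda>_. (\<lambda>_. 0) :: nat \<Rightarrow> real"
  define \<epsilon> where "\<epsilon> = hom_induced 0 (skel_topology X 0) {} ?D {} ?const"
  define y where "y = disc_class 0"
  interpret K: comm_group ?K by simp
  have top: "topspace ?D = {\<lambda>_. 0}" and bd: "disc_boundary 0 = {}" by (auto simp: topspace_disc disc_boundary_eq)
  have H: "H_skel 0 = ?H" by (simp add: skel_negative)
  have inf: "infinite_order_in ?K y"
    using infinite_order_disc_class[of 0] by (simp add: bd y_def)
  then have y: "y \<in> carrier ?K" by (simp add: infinite_order_in_def)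
  have \<epsilon>: "\<epsilon> \<in> hom ?H ?K" unfolding \<epsilon>_def by (rule hom_induced_hom)
  have contc: "continuous_map Y ?D ?const" for Y :: "'z topology" using zero_in_disc(1) by simp
  have \<epsilon>f: "\<epsilon> (cell_class X f) = y" if f: "f \<in> cells_of 0" for f
  proof -
    have d: "cw_dim X f = 0" and fc: "f \<in> cw_cells X" using f by auto
    have "cell_class X f = hom_induced 0 ?D {} (skel_topology X 0) {} (cw_char X f) y"
      using cell_class_eq[of f 0] d by (simp add: bd skel_negative y_def)
    then have "\<epsilon> (cell_class X f) = \<epsilon> (hom_induced 0 ?D {} (skel_topology X 0) {} (cw_char X f) y)"
      by (rule arg_cong)
    also have "\<dots> = hom_induced 0 ?D {} ?D {} (?const \<circ> cw_char X f) y"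
      unfolding \<epsilon>_def by (rule hom_induced_compose'[OF _ _ contc])
        (use continuous_char_skel[OF fc, of 0] d in auto)
    \<comment> \<open>The disc of dimension 0 is a single point, so the constant map on it is the
      identity.\<close>
    also have "\<dots> = y"
      by (rule hom_induced_id_gen[OF _ _ y]) (use contc top in auto)
    finally show ?thesis .
  qed
  have "\<epsilon> (cellular_boundary X 1 (cell_class X c)) = \<one>\<^bsub>?K\<^esub>"
  proof -
    let ?Y = "skel_topology X 1"
    define w where "w = hom_boundary 1 ?Y (skel X 0) (cell_class X c)"
    have sub: "subtopology ?Y (skel X 0) = skel_topology X 0" by (rule subtopology_skel) simp
    have w: "w \<in> carrier ?H"
      using hom_boundary_carrier[of 1 ?Y "skel X 0" "cell_class X c"] by (simp add: w_def sub)
    have "cellular_boundary X 1 (cell_class X c) = hom_induced 0 (skel_topology X 0) {} (skel_topology X 0) {} id w"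
      by (simp add: cellular_boundary_def w_def sub skel_negative)
    also have "\<dots> = w" using w by (rule hom_induced_id)
    finally have cb: "cellular_boundary X 1 (cell_class X c) = w" .
    have incl: "continuous_map (skel_topology X 0) ?Y id"
      using sub by (metis continuous_map_from_subtopology continuous_map_id)
    \<comment> \<open>The constant map extends over the 1-skeleton, where the boundary
      \<open>w\<close> of an edge becomes trivial by exactness.\<close>
    have "\<epsilon> w = hom_induced 0 ?Y {} ?D {} ?const (hom_induced 0 (skel_topology X 0) {} ?Y {} id w)"
      unfolding \<epsilon>_def by (subst hom_induced_compose'[OF incl _ contc]) (auto simp: o_def)
    also have "hom_induced 0 (skel_topology X 0) {} ?Y {} id w = \<one>\<^bsub>homology_group 0 ?Y\<^esub>"
    proof -
      have ker: "kernel (homology_group 0 (skel_topology X 0)) (homology_group 0 ?Y)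
          (hom_induced 0 (skel_topology X 0) {} ?Y {} id)
          = hom_boundary 1 ?Y (skel X 0) ` carrier (relative_homology_group 1 ?Y (skel X 0))"
        using homology_exactness_axiom_2[of 1 ?Y "skel X 0"] by (simp add: sub)
      have "cell_class X c \<in> carrier (relative_homology_group 1 ?Y (skel X 0))"
        using cell_class_carrier[of c 1] c by simp
      then have "w \<in> kernel (homology_group 0 (skel_topology X 0)) (homology_group 0 ?Y)
          (hom_induced 0 (skel_topology X 0) {} ?Y {} id)"
        unfolding ker w_def by (rule imageI)
      then show ?thesis by (simp add: kernel_def)
    qed
    also have "hom_induced 0 ?Y {} ?D {} ?const \<one>\<^bsub>homology_group 0 ?Y\<^esub> = \<one>\<^bsub>?K\<^esub>"
      by (rule hom_one[OF hom_induced_hom]) simp_all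
    finally show ?thesis unfolding cb .
  qed
  moreover have "\<epsilon> (cellular_boundary X 1 (cell_class X c)) = y [^]\<^bsub>?K\<^esub> (\<Sum>f\<in>cells_of 0. B (Some c) (Some f))"
  proof -
    have car: "cell_class X f \<in> carrier ?H" if "f \<in> cells_of 0" for f
      using cell_class_carrier[of f 0] that unfolding H by simp
    have "cellular_boundary X 1 (cell_class X c)
        = finprod ?H (\<lambda>f. cell_class X f [^]\<^bsub>?H\<^esub> B (Some c) (Some f)) (cells_of 0)"
      using cellular_matrix_boundary[OF B, of c 1] c by (simp add: skel_negative)
    then have "\<epsilon> (cellular_boundary X 1 (cell_class X c))
        = finprod ?K (\<lambda>f. \<epsilon> (cell_class X f [^]\<^bsub>?H\<^esub> B (Some c) (Some f))) (cells_of 0)"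
      using hom_finprod[OF \<epsilon>, of "\<lambda>f. cell_class X f [^]\<^bsub>?H\<^esub> B (Some c) (Some f)" "cells_of 0"] car
      by (simp add: Pi_iff group.int_pow_closed)
    also have "\<dots> = finprod ?K (\<lambda>f. y [^]\<^bsub>?K\<^esub> B (Some c) (Some f)) (cells_of 0)"
      by (rule K.finprod_cong') (use y car \<epsilon>f in \<open>auto simp: hom_int_pow[OF \<epsilon>]\<close>)
    also have "\<dots> = y [^]\<^bsub>?K\<^esub> (\<Sum>f\<in>cells_of 0. B (Some c) (Some f))"
      by (rule finprod_int_pow) (use y finite_cells in auto)
    finally show ?thesis .
  qed
  ultimately show ?thesis using inf by (simp add: infinite_order_in_def)
qed

lemma graded_cells_nonneg: "k \<ge> 0 \<Longrightarrow> graded_cells X k = Some ` cells_of k"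
  by (auto simp: graded_cells_def)

lemma finite_graded_cells: "finite (graded_cells X k)"
  using finite_cells by (auto simp: graded_cells_def)

lemma boundary_boundary:
  assumes B: "cellular_matrix X B"
  shows "boundary (graded_cells X) B (k - 1) (boundary (graded_cells X) B k x) = 0"
proof -
  let ?E = "graded_cells X"
  have "(\<Sum>f\<in>?E (k - 1). B f g * B c f) = 0" if c: "c \<in> ?E k" and g: "g \<in> ?E (k - 1 - 1)" for c g
  proof -
    consider "k \<le> 0" | "k = 1" | "k \<ge> 2" by linarith
    then show ?thesis
    proof cases
      case 1
      \<comment> \<open>The cell \<open>None\<close> of dimension -1 is the lowest one, so no such
        \<open>g\<close> exists.\<close>
      then have "k - 1 - 1 < - 1" by simp
      then show ?thesis using g by (auto simp: graded_cells_def)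
    next
      case 2
      then obtain c' where c': "c = Some c'" "c' \<in> cw_cells X" "cw_dim X c' = 1"
        using c by (auto simp: graded_cells_def)
      have gN: "g = None" using g 2 by (simp add: graded_cells_def)
      have "(\<Sum>f\<in>?E 0. B f g * B c f) = (\<Sum>f\<in>cells_of 0. B (Some f) None * B (Some c') (Some f))"
        by (simp add: graded_cells_nonneg sum.reindex c' gN)
      also have "\<dots> = (\<Sum>f\<in>cells_of 0. B (Some c') (Some f))"
        using B by (intro sum.cong refl) (simp add: cellular_matrix_def)
      also have "\<dots> = 0" by (rule augmentation_edge[OF B c'(2,3)])
      finally show ?thesis using 2 by simp
    next
      case 3
      then obtain c' g' where "c = Some c'" "c' \<in> cells_of k" "g = Some g'" "g' \<in> cells_of (k - 2)"
        using c g by (auto simp: graded_cells_nonneg)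
      then show ?thesis
        using 3 matrix_square_cells[OF B, of k c' g'] by (simp add: graded_cells_nonneg sum.reindex)
    qed
  qed
  then have "mat_apply (?E (k - 1 - 1)) (?E k) (\<lambda>g c. \<Sum>f\<in>?E (k - 1). B f g * B c f) x
      = mat_apply (?E (k - 1 - 1)) (?E k) (\<lambda>g c. 0) x"
    by (intro mat_apply_cong)
  then show ?thesis
    unfolding boundary_eq mat_apply_mat_apply by (auto simp: mat_apply_def fun_eq_iff)
qed

end

subsection \<open>Comparison with the skeleton of an acyclization\<close>

text \<open>The map \<open>h\<close> sends cell classes to cell classes and commutes with cellular
  boundaries. It carries the expansion of the boundary of \<open>c\<close> to one for
  \<open>j c\<close>, and the local map at \<open>j f\<close> compares the coefficients.\<close>

lemma skeleton_matrix:
  fixes X :: "('a, 'c) cw" and Y :: "('b, 'e) cw"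
  assumes X: "finite_cw X" and Y: "finite_cw Y"
    and B: "cellular_matrix X B" and A: "cellular_matrix Y A"
    and h: "continuous_map (cw_space X) (cw_space Y) h"
    and j: "bij_betw j (cw_cells X) {c \<in> cw_cells Y. cw_dim Y c \<le> d}"
    and dim: "\<And>c. c \<in> cw_cells X \<Longrightarrow> cw_dim Y (j c) = cw_dim X c"
    and char: "\<And>c x. c \<in> cw_cells X \<Longrightarrow> x \<in> topspace (disc_topology (cw_dim X c)) \<Longrightarrow>
      cw_char Y (j c) x = h (cw_char X c x)"
    and c: "c \<in> cw_cells X" "int (cw_dim X c) = k" "k \<ge> 1"
    and f: "f \<in> cw_cells X" "int (cw_dim X f) = k - 1"
  shows "A (Some (j c)) (Some (j f)) = B (Some c) (Some f)"
proof -
  interpret X: finite_cw_complex X by unfold_locales (rule X)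
  interpret Y: finite_cw_complex Y by unfold_locales (rule Y)
  have jY: "j c \<in> cw_cells Y" if "c \<in> cw_cells X" for c using j that by (auto simp: bij_betw_def)
  have inj: "inj_on j (cw_cells X)" using j by (simp add: bij_betw_def)
  have cell: "h ` open_cell X c \<subseteq> open_cell Y (j c)" if "c \<in> cw_cells X" for c
    using char[OF that] dim[OF that] by (force simp: open_cell_def)
  have hskel: "h \<in> skel X l \<rightarrow> skel Y l" for l
    using cell jY dim by (fastforce simp: skel_def)
  have cont: "continuous_map (skel_topology X l) (skel_topology Y l) h" for l
    using continuous_map_from_subtopology[OF h, of "skel X l"] hskel[of l]
    by (auto simp: continuous_map_in_subtopology)
  define \<eta> where "\<eta> l = hom_induced l (skel_topology X l) (skel X (l - 1)) (skel_topology Y l) (skel Y (l - 1)) h" for l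
  have \<eta>cell: "\<eta> l (cell_class X e) = cell_class Y (j e)" if e: "e \<in> cw_cells X" "int (cw_dim X e) = l" for e l
  proof -
    let ?D = "disc_topology (cw_dim X e)" and ?S = "disc_boundary (cw_dim X e)"
    have "\<eta> l (cell_class X e) = hom_induced l ?D ?S (skel_topology Y l) (skel Y (l - 1))
        (h \<circ> cw_char X e) (disc_class (cw_dim X e))"
      unfolding \<eta>_def X.cell_class_eq[OF e(2)]
      by (rule hom_induced_compose'[OF X.continuous_char_skel[OF e(1)] _ cont hskel])
        (use X.char_boundary[OF e(1)] e(2) in auto)
    also have "hom_induced l ?D ?S (skel_topology Y l) (skel Y (l - 1)) (h \<circ> cw_char X e)
        = hom_induced l ?D ?S (skel_topology Y l) (skel Y (l - 1)) (cw_char Y (j e))"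
      by (rule hom_induced_eq) (simp add: char[OF e(1)])
    finally show ?thesis using Y.cell_class_eq[of "j e" l] dim[OF e(1)] e(2) by simp
  qed
  have \<eta>hom: "\<eta> l \<in> hom (X.H_skel l) (Y.H_skel l)" for l unfolding \<eta>_def by (rule hom_induced_hom)
  have nat: "\<eta> (k - 1) (cellular_boundary X k z) = cellular_boundary Y k (\<eta> k z)" for z
  proof -
    have "cellular_boundary Y k \<circ> \<eta> k = \<eta> (k - 1) \<circ> cellular_boundary X k"
      using naturality_hom_induced_relboundary[OF cont[of k] hskel[of "k - 1"] hskel[of "k - 2"], of k]
      by (simp add: X.cellular_boundary_relboundary Y.cellular_boundary_relboundary \<eta>_def
          X.subtopology_skel Y.subtopology_skel)
    then show ?thesis by (metis comp_apply)
  qed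
  let ?\<phi> = "Y.local_class_map (j f) (k - 1)" and ?K = "Y.local_homology (j f) (k - 1)"
  let ?HX = "X.H_skel (k - 1)" and ?HY = "Y.H_skel (k - 1)"
  interpret K: comm_group ?K by simp
  have jf: "j f \<in> cw_cells Y" "int (cw_dim Y (j f)) = k - 1" using f jY dim by auto
  have jc: "j c \<in> cw_cells Y" "int (cw_dim Y (j c)) = k" using c jY dim by auto
  have \<psi>: "?\<phi> \<circ> \<eta> (k - 1) \<in> hom ?HX ?K" by (rule hom_compose[OF \<eta>hom Y.local_class_map_hom])
  have car: "?\<phi> (cell_class Y (j e)) \<in> carrier ?K" if "e \<in> X.cells_of (k - 1)" for e
    using that dim by (intro hom_in_carrier[OF Y.local_class_map_hom] Y.cell_class_carrier) auto
  have "cellular_boundary Y k (cell_class Y (j c)) = \<eta> (k - 1) (cellular_boundary X k (cell_class X c))"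
    using nat \<eta>cell[OF c(1,2)] by simp
  also have "\<dots> = \<eta> (k - 1) (finprod ?HX (\<lambda>e. cell_class X e [^]\<^bsub>?HX\<^esub> B (Some c) (Some e)) (X.cells_of (k - 1)))"
    unfolding X.cellular_matrix_boundary[OF B c] ..
  finally have "?\<phi> (cellular_boundary Y k (cell_class Y (j c)))
      = (?\<phi> \<circ> \<eta> (k - 1)) (finprod ?HX (\<lambda>e. cell_class X e [^]\<^bsub>?HX\<^esub> B (Some c) (Some e)) (X.cells_of (k - 1)))"
    by simp
  also have "\<dots> = finprod ?K (\<lambda>e. (?\<phi> \<circ> \<eta> (k - 1)) (cell_class X e [^]\<^bsub>?HX\<^esub> B (Some c) (Some e))) (X.cells_of (k - 1))"
    by (rule hom_finprod[OF \<psi>]) (rule abelian_relative_homology_group Pi_I X.cell_class_pow_carrier, assumption?)+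
  also have "\<dots> = finprod ?K (\<lambda>e. ?\<phi> (cell_class Y (j e)) [^]\<^bsub>?K\<^esub> B (Some c) (Some e)) (X.cells_of (k - 1))"
  proof (rule K.finprod_cong'[OF refl])
    fix e assume e: "e \<in> X.cells_of (k - 1)"
    have "(?\<phi> \<circ> \<eta> (k - 1)) (cell_class X e [^]\<^bsub>?HX\<^esub> B (Some c) (Some e))
        = (?\<phi> \<circ> \<eta> (k - 1)) (cell_class X e) [^]\<^bsub>?K\<^esub> B (Some c) (Some e)"
      by (rule hom_int_pow[OF \<psi> X.cell_class_carrier]) (use e in simp_all)
    then show "(?\<phi> \<circ> \<eta> (k - 1)) (cell_class X e [^]\<^bsub>?HX\<^esub> B (Some c) (Some e))
        = ?\<phi> (cell_class Y (j e)) [^]\<^bsub>?K\<^esub> B (Some c) (Some e)"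
      using \<eta>cell[of e "k - 1"] e by simp
  qed (use car in auto)
  also have "\<dots> = ?\<phi> (cell_class Y (j f)) [^]\<^bsub>?K\<^esub> B (Some c) (Some f)"
  proof (rule finprod_single)
    \<comment> \<open>By injectivity of \<open>j\<close> only \<open>f\<close> lies over
      \<open>j f\<close>; the local map kills the other cells.\<close>
    fix e assume e: "e \<in> X.cells_of (k - 1)" "e \<noteq> f"
    then have "j e \<noteq> j f" using inj f(1) by (auto simp: inj_on_def)
    then show "?\<phi> (cell_class Y (j e)) = \<one>\<^bsub>?K\<^esub>"
      using e dim jY by (intro Y.local_class_other_cell[OF jf]) auto
  qed (use f X.finite_cells car in auto)
  finally show ?thesis
    unfolding Y.cellular_matrix_boundary[OF A jc c(3)] by (rule Y.cell_classes_independent[OF jf])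
qed

lemma acyclization_imp_chain_acyclization:
  assumes X: "finite_cw X" and B: "cellular_matrix X B" and acyc: "acyclization d X Y A"
  shows "chain_acyclization (int d) (graded_cells X) B (graded_cells Y) A"
proof -
  have Y: "finite_cw Y" and dimY: "\<And>c. c \<in> cw_cells Y \<Longrightarrow> cw_dim Y c \<le> d + 1" and A: "cellular_matrix Y A"
    and H: "trivial_group (cellular_homology (graded_cells Y) A (int d + 1))"
      "trivial_group (cellular_homology (graded_cells Y) A (int d))"
    using acyc by (auto simp: acyclization_def)
  interpret X: finite_cw_complex X by unfold_locales (rule X)
  interpret Y: finite_cw_complex Y by unfold_locales (rule Y)
  have "is_skeleton d X Y" using acyc by (simp add: acyclization_def)
  then obtain h j where hj: "homeomorphic_map (cw_space X) (skel_topology Y (int d)) h \<and>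
      bij_betw j (cw_cells X) {c \<in> cw_cells Y. cw_dim Y c \<le> d} \<and>
      (\<forall>c \<in> cw_cells X. cw_dim Y (j c) = cw_dim X c \<and>
        (\<forall>x \<in> topspace (disc_topology (cw_dim X c)). cw_char Y (j c) x = h (cw_char X c x)))"
    unfolding is_skeleton_def by (elim exE)
  note h = hj[THEN conjunct1] and j = hj[THEN conjunct2, THEN conjunct1]
  have dim: "\<And>c. c \<in> cw_cells X \<Longrightarrow> cw_dim Y (j c) = cw_dim X c"
    and char: "\<And>c x. c \<in> cw_cells X \<Longrightarrow> x \<in> topspace (disc_topology (cw_dim X c)) \<Longrightarrow>
      cw_char Y (j c) x = h (cw_char X c x)"
    using hj by simp_all
  have cont: "continuous_map (cw_space X) (cw_space Y) h"
    using homeomorphic_imp_continuous_map[OF h] by (rule continuous_map_into_fulltopology)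
  \<comment> \<open>\<open>map_option\<close> extends \<open>j\<close> by matching the two cells of
    dimension -1.\<close>
  have bij: "bij_betw (map_option j) (graded_cells X i) (graded_cells Y i)" if "i \<le> int d" for i
  proof (cases "i = - 1")
    case True
    then show ?thesis by (simp add: graded_cells_def bij_betw_def)
  next
    case False
    have inj: "inj_on (map_option j) (Some ` X.cells_of i)"
      using j by (auto simp: inj_on_def bij_betw_def)
    have "j ` X.cells_of i = Y.cells_of i"
    proof (intro equalityI subsetI)
      fix e assume e: "e \<in> Y.cells_of i"
      then have "e \<in> {c \<in> cw_cells Y. cw_dim Y c \<le> d}" using that by auto
      then obtain c where "c \<in> cw_cells X" "e = j c" using j by (auto simp: bij_betw_def)
      then show "e \<in> j ` X.cells_of i" using e dim by auto
    qed (use j dim in \<open>auto simp: bij_betw_def\<close>)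
    then have "map_option j ` Some ` X.cells_of i = Some ` Y.cells_of i"
      by (auto simp: image_image)
    then show ?thesis using inj False by (simp add: graded_cells_def bij_betw_def)
  qed
  have mat: "A (map_option j c) (map_option j f) = B c f"
    if i: "i \<le> int d" and c: "c \<in> graded_cells X i" and f: "f \<in> graded_cells X (i - 1)" for i c f
  proof -
    consider "i < 0" | "i = 0" | "i \<ge> 1" by linarith
    then show ?thesis
    proof cases
      case 1
      then have "i - 1 < - 1" by simp
      then show ?thesis using f by (auto simp: graded_cells_def)
    next
      case 2
      \<comment> \<open>In dimension 0 both matrices are the augmentation, whose entries are fixed
        to be 1.\<close>
      then obtain v where v: "c = Some v" "v \<in> cw_cells X" "cw_dim X v = 0" and "f = None"
        using c f by (auto simp: graded_cells_def)
      moreover have "j v \<in> cw_cells Y" using v(2) j by (auto simp: bij_betw_def)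
      ultimately show ?thesis using A B dim[OF v(2)] by (simp add: cellular_matrix_def)
    next
      case 3
      then obtain c' f' where c': "c = Some c'" "c' \<in> cw_cells X" "int (cw_dim X c') = i"
        and f': "f = Some f'" "f' \<in> cw_cells X" "int (cw_dim X f') = i - 1"
        using c f by (auto simp: X.graded_cells_nonneg)
      have "A (Some (j c')) (Some (j f')) = B (Some c') (Some f')"
        by (rule skeleton_matrix[OF X Y B A cont j dim char c'(2,3) 3 f'(2,3)])
      then show ?thesis using c'(1) f'(1) by simp
    qed
  qed
  have top: "graded_cells Y i = {}" if "i > int d + 1" for i
    using that dimY by (fastforce simp: graded_cells_def)
  show ?thesis
    unfolding chain_acyclization_def
  proof (intro exI[of _ "map_option j"] conjI allI impI ballI)
    show "boundary (graded_cells Y) A (int d) (boundary (graded_cells Y) A (int d + 1) x) = 0" for x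
      using Y.boundary_boundary[OF A, of "int d + 1" x] by simp
  qed (use bij mat Y.finite_graded_cells top H in auto)
qed

text \<open>The clause for chain acyclizations gives the cocritical equality content also for
  complexes without a CW acyclization.\<close>

theorem theorem8p1:
  fixes \<Sigma> :: "('a, 'c) cw" and B :: "'c option \<Rightarrow> 'c option \<Rightarrow> int" and d :: nat
    and \<Omega> :: "('b, 'e) cw" and B\<^sub>\<Omega> :: "'e option \<Rightarrow> 'e option \<Rightarrow> int"
    and E' :: "int \<Rightarrow> 't set" and A :: "'t \<Rightarrow> 't \<Rightarrow> int"
  assumes "finite_cw \<Sigma>" and "cw_has_dim \<Sigma> d" and "cellular_matrix \<Sigma> B"
  shows "let E = graded_cells \<Sigma>;
             C = cut_lattice E B d;
             F = flow_lattice E B d;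
             \<tau> = complexity E B d;
             t = torsion_number E B (int d - 1)
         in order (discriminant_group (E d) C) = order (critical_group E B d) \<and>
            order (critical_group E B d) = \<tau> \<and>
            real (order (additive_group (cell_chains E d) Mod {x + y | x y. x \<in> C \<and> y \<in> F}))
              = real \<tau> / real t \<and>
            real (order (discriminant_group (E d) F)) = real \<tau> / (real t)\<^sup>2 \<and>
            (acyclization d \<Sigma> \<Omega> B\<^sub>\<Omega> \<longrightarrow>
               order (discriminant_group (E d) F) = order (cocritical_group (graded_cells \<Omega>) B\<^sub>\<Omega> d)) \<and>
            (chain_acyclization d E B E' A \<longrightarrow>
               order (discriminant_group (E d) F) = order (cocritical_group E' A d))"
proof -
  interpret X: finite_cw_complex \<Sigma> by unfold_locales (rule assms(1))
  note main = critical_groups_of_chain_complex[of "graded_cells \<Sigma>" "int d" B,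
      OF X.finite_graded_cells X.finite_graded_cells X.boundary_boundary[OF assms(3)]]
  show ?thesis
    unfolding Let_def
    by (intro conjI impI main acyclization_imp_chain_acyclization[OF assms(1,3)])
qed

end
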